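(* For any $N\geq 8$, a Hamilton path in the graph $\mathcal{F}_N$ can be computed (i.e., all nodes of $\mathcal{F}_N$ can be listed so that consecutive ones are adjacent) in time $\mathcal{O}(1)$ on average per node.
   Context: Label the points of a convex $N$-gon $1,\ldots,N$ counterclockwise; color point $i$ red if $i$ is odd and blue if $i$ is even. The associahedron $\mathcal{G}_N$ has as nodes all triangulations of the convex $N$-gon, two adjacent if they differ in a flip (removing a diagonal shared by two triangles and replacing it by the other diagonal of the resulting quadrilateral). A triangulation is colorful if no triangle has all three points of the same color; $\mathcal{F}_N$ is the subgraph of $\mathcal{G}_N$ induced by the colorful triangulations. *)

theory Defs
  imports "Graph_Theory.Digraph_Component" "Graph_Theory.Vertex_Walk"
begin

section \<open>Triangulations of a convex polygon\<close>

text \<open>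
  The points of the convex \<open>N\<close>-gon are \<open>1, \<dots>, N\<close> in counterclockwise order, a segment is the
  two-element set of its end points, and a triangulation is represented by its set of diagonals,
  that is, by an inclusion-maximal set of pairwise non-crossing diagonals.
\<close>

definition sides :: "nat \<Rightarrow> nat set set" where
  "sides N = {{i, i + 1} | i. 1 \<le> i \<and> i < N} \<union> {{1, N}}"

definition diagonals :: "nat \<Rightarrow> nat set set" where
  "diagonals N = {{a, b} | a b. 1 \<le> a \<and> a < b \<and> b \<le> N} - sides N"

definition crossing :: "nat set \<Rightarrow> nat set \<Rightarrow> bool" where
  "crossing e f \<longleftrightarrow> (\<exists>a b c d. a < b \<and> b < c \<and> c < d \<and>
     (e = {a, c} \<and> f = {b, d} \<or> e = {b, d} \<and> f = {a, c}))"

definition triangulation :: "nat \<Rightarrow> nat set set \<Rightarrow> bool" where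
  "triangulation N T \<longleftrightarrow> T \<subseteq> diagonals N \<and> (\<forall>e\<in>T. \<forall>f\<in>T. \<not> crossing e f) \<and>
     (\<forall>e\<in>diagonals N - T. \<exists>f\<in>T. crossing e f)"

text \<open>
  Since the points are in convex position, three points that are pairwise joined by sides or
  diagonals of \<open>T\<close> always bound a face of \<open>T\<close>.
\<close>

definition triangle :: "nat \<Rightarrow> nat set set \<Rightarrow> nat \<Rightarrow> nat \<Rightarrow> nat \<Rightarrow> bool" where
  "triangle N T a b c \<longleftrightarrow> a \<noteq> b \<and> b \<noteq> c \<and> a \<noteq> c \<and> {{a, b}, {b, c}, {a, c}} \<subseteq> sides N \<union> T"

definition flip :: "nat \<Rightarrow> nat set set \<Rightarrow> nat set set \<Rightarrow> bool" where
  "flip N T T' \<longleftrightarrow> (\<exists>a b c d. {a, b} \<in> T \<and> triangle N T a b c \<and> triangle N T a b d \<and> c \<noteq> d \<and>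
     T' = insert {c, d} (T - {{a, b}}))"

datatype color = Red | Blue

definition point_color :: "nat \<Rightarrow> color" where
  "point_color i = (if odd i then Red else Blue)"

definition colorful :: "nat \<Rightarrow> nat set set \<Rightarrow> bool" where
  "colorful N T \<longleftrightarrow> \<not> (\<exists>a b c. triangle N T a b c \<and>
     point_color a = point_color b \<and> point_color b = point_color c)"

text \<open>
  Undirected graphs are symmetric digraphs. The relation \<open>flip\<close> is symmetric on triangulations.
\<close>

definition associahedron :: "nat \<Rightarrow> (nat set set, nat set set \<times> nat set set) pre_digraph" where
  "associahedron N = \<lparr>verts = {T. triangulation N T},
     arcs = {(T, T'). triangulation N T \<and> triangulation N T' \<and> flip N T T'},
     tail = fst, head = snd\<rparr>"

definition colorful_graph :: "nat \<Rightarrow> (nat set set, nat set set \<times> nat set set) pre_digraph" where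
  "colorful_graph N = associahedron N \<restriction> {T. triangulation N T \<and> colorful N T}"

definition hamilton_path :: "('a, 'b) pre_digraph \<Rightarrow> 'a list \<Rightarrow> bool" where
  "hamilton_path G p \<longleftrightarrow> vpath p G \<and> set p = verts G"


section \<open>A word RAM with structured control flow\<close>

text \<open>
  The memory of the machine consists of arrays; a program can only name finitely many of them.
  All arithmetic is performed on words from \<open>{0..<W}\<close>, reducing modulo \<open>W\<close> on overflow, with
  subtraction truncated at \<open>0\<close>. Every evaluated expression node and every executed command or
  test costs one time unit.

  The command \<open>Visit\<close> reports the object that is currently stored in memory; the list of stores at
  all executions of \<open>Visit\<close> is the output of a run. A listing algorithm with constant average time
  cannot copy every object to the output, as one object already has size linear in \<open>N\<close>.
\<close>

datatype expr =
    Const nat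
  | Read nat expr \<comment> \<open>array, index\<close>
  | Add expr expr
  | Sub expr expr
  | Mul expr expr
  | Div expr expr
  | Less expr expr
  | Equal expr expr

datatype com =
    Write nat expr expr \<comment> \<open>array, index, value\<close>
  | Seq com com
  | If expr com com
  | While expr com
  | Skip
  | Visit

type_synonym store = "nat \<Rightarrow> nat \<Rightarrow> nat"

fun eval_expr :: "nat \<Rightarrow> store \<Rightarrow> expr \<Rightarrow> nat" where
  "eval_expr W s (Const n) = n mod W"
| "eval_expr W s (Read a e) = s a (eval_expr W s e)"
| "eval_expr W s (Add e f) = (eval_expr W s e + eval_expr W s f) mod W"
| "eval_expr W s (Sub e f) = eval_expr W s e - eval_expr W s f"
| "eval_expr W s (Mul e f) = (eval_expr W s e * eval_expr W s f) mod W"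
| "eval_expr W s (Div e f) = eval_expr W s e div eval_expr W s f"
| "eval_expr W s (Less e f) = (if eval_expr W s e < eval_expr W s f then 1 else 0)"
| "eval_expr W s (Equal e f) = (if eval_expr W s e = eval_expr W s f then 1 else 0)"

fun expr_cost :: "expr \<Rightarrow> nat" where
  "expr_cost (Const n) = 1"
| "expr_cost (Read a e) = expr_cost e + 1"
| "expr_cost (Add e f) = expr_cost e + expr_cost f + 1"
| "expr_cost (Sub e f) = expr_cost e + expr_cost f + 1"
| "expr_cost (Mul e f) = expr_cost e + expr_cost f + 1"
| "expr_cost (Div e f) = expr_cost e + expr_cost f + 1"
| "expr_cost (Less e f) = expr_cost e + expr_cost f + 1"
| "expr_cost (Equal e f) = expr_cost e + expr_cost f + 1"

text \<open>
  \<open>exec W c s s' vs t\<close>: with word bound \<open>W\<close>, the command \<open>c\<close> started in store \<open>s\<close> terminates in store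
  \<open>s'\<close> after \<open>t\<close> time units, and \<open>vs\<close> is the list of visited stores.
\<close>

inductive exec :: "nat \<Rightarrow> com \<Rightarrow> store \<Rightarrow> store \<Rightarrow> store list \<Rightarrow> nat \<Rightarrow> bool" for W :: nat where
  Skip: "exec W Skip s s [] 1"
| Visit: "exec W Visit s s [s] 1"
| Write: "exec W (Write a i e) s (s(a := (s a)(eval_expr W s i := eval_expr W s e))) []
    (expr_cost i + expr_cost e + 1)"
| Seq: "exec W c s s' vs t \<Longrightarrow> exec W d s' s'' vs' t' \<Longrightarrow>
    exec W (Seq c d) s s'' (vs @ vs') (t + t')"
| IfTrue: "eval_expr W s e \<noteq> 0 \<Longrightarrow> exec W c s s' vs t \<Longrightarrow>
    exec W (If e c d) s s' vs (expr_cost e + 1 + t)"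
| IfFalse: "eval_expr W s e = 0 \<Longrightarrow> exec W d s s' vs t \<Longrightarrow>
    exec W (If e c d) s s' vs (expr_cost e + 1 + t)"
| WhileFalse: "eval_expr W s e = 0 \<Longrightarrow> exec W (While e c) s s [] (expr_cost e + 1)"
| WhileTrue: "eval_expr W s e \<noteq> 0 \<Longrightarrow> exec W c s s' vs t \<Longrightarrow>
    exec W (While e c) s' s'' vs' t' \<Longrightarrow>
    exec W (While e c) s s'' (vs @ vs') (expr_cost e + 1 + t + t')"

inductive_cases exec_elims:
  "exec W Skip s s' vs t"
  "exec W Visit s s' vs t"
  "exec W (Write a i e) s s' vs t"
  "exec W (Seq c d) s s' vs t"
  "exec W (If e c d) s s' vs t"
  "exec W (While e c) s s' vs t"

lemma exec_deterministic:
  "exec W c s s1 vs1 t1 \<Longrightarrow> exec W c s s2 vs2 t2 \<Longrightarrow> s1 = s2 \<and> vs1 = vs2 \<and> t1 = t2"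
proof (induction arbitrary: s2 vs2 t2 rule: exec.induct)
  case Seq
  from Seq.prems show ?case
    by (rule exec_elims(4)) (use Seq.IH in fastforce)+
next
  case IfTrue
  from IfTrue.prems show ?case
    by (rule exec_elims(5)) (use IfTrue.hyps(1) IfTrue.IH in fastforce)+
next
  case IfFalse
  from IfFalse.prems show ?case
    by (rule exec_elims(5)) (use IfFalse.hyps(1) IfFalse.IH in fastforce)+
next
  case WhileFalse
  from WhileFalse.prems show ?case
    by (rule exec_elims(6)) (use WhileFalse.hyps(1) in fastforce)+
next
  case WhileTrue
  from WhileTrue.prems show ?case
    by (rule exec_elims(6)) (use WhileTrue.hyps(1) WhileTrue.IH in fastforce)+
qed (auto elim: exec_elims)

text \<open>Array \<open>0\<close> holds the input; array \<open>1\<close> holds the current triangulation as an adjacency matrix.\<close>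

definition input_store :: "nat \<Rightarrow> store" where
  "input_store N = (\<lambda>a i. if a = 0 \<and> i = 0 then N else 0)"

definition stored_triangulation :: "nat \<Rightarrow> store \<Rightarrow> nat set set" where
  "stored_triangulation N s =
     {{a, b} | a b. a < b \<and> {a, b} \<in> diagonals N \<and> s 1 (a * N + b) \<noteq> 0}"

end

theory Submission
  imports Defs
begin

text \<open>
  In a colorful triangulation every triangle has exactly one side with equally colored ends. Removing
  these diagonals leaves a dissection into quadrilaterals (and one triangle at the side \<open>{1, N}\<close> if
  \<open>N\<close> is odd), and each quadrilateral may carry either of its two diagonals. So the nodes over a
  fixed dissection form a hypercube, whose dimension exceeds \<open>N / 2 - 2\<close>; this leaves time exponential
  in \<open>N\<close> for each dissection.

  A dissection is encoded by a sequence \<open>a\<close> that records on which sides ears are glued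
  successively. Lowering suitable entries of \<open>a\<close> by one is a flip, provided that the quadrilaterals at
  two consecutive positions carry the right diagonals; these moves form a spanning forest with two trees.
  Each hypercube is traversed by a Gray code in which steps of two kinds alternate. Each
  edge of the forest is assigned a pair of parallel Gray code edges, one in either hypercube, that flip
  a third quadrilateral; replacing the two by the two moves that join their ends merges
  the cycles. As the steps of either kind form a perfect matching, the resulting walk depends on
  the current node only. It consists of one cycle per tree, and the two cycles are joined by one more flip.

  The pairs are chosen such that only few bits are set, so the costly search for the pair and the
  reconstruction of the adjacency matrix happen for polynomially many nodes of each hypercube.
\<close>

section \<open>Gluing ears to triangulations\<close>

text \<open>The bit of a quadrilateral records the color of the ends of its diagonal, not which of
  two positions it takes. Lowering an entry keeps the diagonal of the moved ear in place, so a move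
  along the forest changes no bit, and the Gray codes over its two ends have parallel edges. The
  difficulty is that all exchanges of edges are made at once. Instead of an induction over the
  exchanges, it is shown that the two ends of a given-up edge remain connected: the nodes over the
  subtree below a forest edge are left at only two places, and a parity count joins these two from
  inside. The hypercubes and then the trees are connected by such detours. A move at the last
  position prescribes bit \<open>m\<close>, so the edge given up for it cannot flip bit
  \<open>m\<close>. This forces a second kind of pair, which flips bit \<open>f\<close>, and a Gray
  code whose reading of bit \<open>m\<close> depends on the code. Search and reconstruction cost
  order \<open>N * N\<close> and occur at order \<open>N * N\<close> nodes of a hypercube, which its
  exponential size pays for. What else is not constant, the scan for the lowest set bit, has
  constant mean.\<close>

text \<open>
  \<open>ear k b T\<close> glues a quadrilateral to the side \<open>{k, k + 1}\<close> of the polygon, so that its corners become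
  \<open>k, \<dots>, k + 3\<close> and larger labels increase by 2. Its diagonal joins the two odd corners iff \<open>b\<close>.
\<close>

definition skip :: "nat \<Rightarrow> nat \<Rightarrow> nat" where
  "skip k i = (if i \<le> k then i else i + 2)"

definition unskip :: "nat \<Rightarrow> nat \<Rightarrow> nat" where
  "unskip k x = (if x \<le> k then x else x - 2)"

definition cdiag :: "nat \<Rightarrow> bool \<Rightarrow> nat set" where
  "cdiag k b = (if odd k = b then {k, k + 2} else {k + 1, k + 3})"

definition ear :: "nat \<Rightarrow> bool \<Rightarrow> nat set set \<Rightarrow> nat set set" where
  "ear k b T = insert {k, k + 3} (insert (cdiag k b) ((`) (skip k) ` T))"

abbreviation joined :: "nat \<Rightarrow> nat set set \<Rightarrow> nat \<Rightarrow> nat \<Rightarrow> bool" where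
  "joined N T x y \<equiv> {x, y} \<in> sides N \<union> T"

section \<open>Sides, diagonals and crossings in terms of ordered labels\<close>

lemma pair_in_sides:
  assumes "x < y" "1 \<le> N"
  shows "{x, y} \<in> sides N \<longleftrightarrow> 1 \<le> x \<and> y = x + 1 \<and> y \<le> N \<or> x = 1 \<and> y = N"
  using assms unfolding sides_def by (auto simp: doubleton_eq_iff)

lemma pair_in_diagonals:
  assumes "x < y"
  shows "{x, y} \<in> diagonals N \<longleftrightarrow> 1 \<le> x \<and> x + 1 < y \<and> y \<le> N \<and> \<not> (x = 1 \<and> y = N)"
proof (cases "1 \<le> N")
  case True
  have "{x, y} \<in> {{a, b} | a b. 1 \<le> a \<and> a < b \<and> b \<le> N} \<longleftrightarrow> 1 \<le> x \<and> y \<le> N"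
    using assms by (auto simp: doubleton_eq_iff)
  then show ?thesis
    unfolding diagonals_def Diff_iff pair_in_sides[OF assms True] using assms by auto
next
  case False
  then show ?thesis unfolding diagonals_def using assms by auto
qed

lemma diagonal_cases:
  assumes "e \<in> diagonals N"
  obtains x y where "e = {x, y}" "x < y"
  using assms unfolding diagonals_def by blast

lemma crossing_pair:
  assumes "x < y" "u < v"
  shows "crossing {x, y} {u, v} \<longleftrightarrow> x < u \<and> u < y \<and> y < v \<or> u < x \<and> x < v \<and> v < y"
proof
  assume "crossing {x, y} {u, v}"
  then obtain a b c d where "a < b" "b < c" "c < d"
    "{x, y} = {a, c} \<and> {u, v} = {b, d} \<or> {x, y} = {b, d} \<and> {u, v} = {a, c}"
    unfolding crossing_def by blast
  with assms show "x < u \<and> u < y \<and> y < v \<or> u < x \<and> x < v \<and> v < y"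
    by (auto simp: doubleton_eq_iff)
next
  assume "x < u \<and> u < y \<and> y < v \<or> u < x \<and> x < v \<and> v < y"
  then show "crossing {x, y} {u, v}"
    unfolding crossing_def by blast
qed

text \<open>One order pattern suffices for the non-crossing condition, as the other one arises by
  exchanging the two segments. Maximality has to allow both.\<close>

lemma triangulationI:
  assumes "T \<subseteq> diagonals N"
    and "\<And>x y u v. x < u \<Longrightarrow> u < y \<Longrightarrow> y < v \<Longrightarrow> {x, y} \<in> T \<Longrightarrow> {u, v} \<in> T \<Longrightarrow> False"
    and "\<And>x y. x < y \<Longrightarrow> {x, y} \<in> diagonals N \<Longrightarrow> {x, y} \<notin> T \<Longrightarrow>
      \<exists>u v. u < v \<and> {u, v} \<in> T \<and> (x < u \<and> u < y \<and> y < v \<or> u < x \<and> x < v \<and> v < y)"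
  shows "triangulation N T"
  unfolding triangulation_def
proof (intro conjI ballI notI)
  fix e g assume "e \<in> T" "g \<in> T" "crossing e g"
  then show False unfolding crossing_def using assms(2) by blast
next
  fix e assume e: "e \<in> diagonals N - T"
  then obtain x y where xy: "e = {x, y}" "x < y" by (auto elim: diagonal_cases)
  with e assms(3)[of x y] obtain u v where
    "u < v" "{u, v} \<in> T" "x < u \<and> u < y \<and> y < v \<or> u < x \<and> x < v \<and> v < y" by blast
  then show "\<exists>g\<in>T. crossing e g" using xy crossing_pair by blast
qed (use assms in auto)

lemma triangulation_noncrossing:
  assumes "triangulation N T" "{x, y} \<in> T" "{u, v} \<in> T" "x < u" "u < y" "y < v"
  shows False
  using assms crossing_pair[of x y u v] unfolding triangulation_def by (meson order.strict_trans)

lemma triangulation_maximal: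
  assumes "triangulation N T" "x < y" "{x, y} \<in> diagonals N" "{x, y} \<notin> T"
  obtains u v where "u < v" "{u, v} \<in> T" "x < u \<and> u < y \<and> y < v \<or> u < x \<and> x < v \<and> v < y"
proof -
  from assms obtain g where g: "g \<in> T" "crossing {x, y} g" unfolding triangulation_def by blast
  then obtain u v where "g = {u, v}" "u < v"
    using assms(1) unfolding triangulation_def by (blast elim: diagonal_cases)
  with g that crossing_pair[OF assms(2)] show thesis by blast
qed

lemma triangulation_diagonals: "triangulation N T \<Longrightarrow> T \<subseteq> diagonals N"
  unfolding triangulation_def by blast

lemma triangulation_pairE:
  assumes "triangulation N T" "{x, y} \<in> T" "x < y"
  shows "1 \<le> x \<and> x + 1 < y \<and> y \<le> N \<and> \<not> (x = 1 \<and> y = N)"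
  using assms triangulation_diagonals pair_in_diagonals by blast

section \<open>Relabelling, and gluing an ear to a triangulation\<close>

lemma strict_mono_skip: "i < j \<Longrightarrow> skip k i < skip k j"
  unfolding skip_def by auto

lemma inj_skip: "inj (skip k)"
  by (rule linorder_injI) (simp add: strict_mono_skip less_imp_neq)

lemma skip_unskip: "x \<noteq> k + 1 \<Longrightarrow> x \<noteq> k + 2 \<Longrightarrow> skip k (unskip k x) = x"
  unfolding skip_def unskip_def by auto

lemma unskip_skip: "unskip k (skip k i) = i"
  unfolding skip_def unskip_def by auto

lemma skip_not_gap: "skip k i \<noteq> k + 1" "skip k i \<noteq> k + 2"
  "k + 1 \<noteq> skip k i" "k + 2 \<noteq> skip k i"
  unfolding skip_def by auto

lemma skip_image_side: "skip k ` {k, k + 1} = {k, k + 3}"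
  by (auto simp: skip_def)

lemma even_skip: "even (skip k i) = even i"
  unfolding skip_def by auto

lemma strict_mono_unskip:
  "x < y \<Longrightarrow> x \<noteq> k + 1 \<Longrightarrow> x \<noteq> k + 2 \<Longrightarrow> y \<noteq> k + 1 \<Longrightarrow> y \<noteq> k + 2 \<Longrightarrow> unskip k x < unskip k y"
  unfolding unskip_def by auto

lemma pair_in_skip_image:
  assumes "x \<noteq> k + 1" "x \<noteq> k + 2" "y \<noteq> k + 1" "y \<noteq> k + 2"
  shows "{x, y} \<in> (`) (skip k) ` T \<longleftrightarrow> {unskip k x, unskip k y} \<in> T"
proof -
  have eq: "{x, y} = skip k ` {unskip k x, unskip k y}"
    using assms by (simp add: skip_unskip)
  show ?thesis unfolding eq by (rule inj_image_mem_iff) (simp add: inj_def inj_image_eq_iff[OF inj_skip])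
qed

lemma skip_image_no_gap: "e \<in> (`) (skip k) ` T \<Longrightarrow> k + 1 \<notin> e \<and> k + 2 \<notin> e"
  using skip_not_gap by auto

lemma cdiag_cases: "cdiag k b = {k, k + 2} \<or> cdiag k b = {k + 1, k + 3}"
  unfolding cdiag_def by auto

lemma pair_in_ear:
  assumes "x < y" "x \<noteq> k + 1" "x \<noteq> k + 2" "y \<noteq> k + 1" "y \<noteq> k + 2"
  shows "{x, y} \<in> ear k b T \<longleftrightarrow> x = k \<and> y = k + 3 \<or> {unskip k x, unskip k y} \<in> T"
  using assms cdiag_cases[of k b] unfolding ear_def
  by (auto simp: pair_in_skip_image doubleton_eq_iff)

lemma pair_in_ear_gap:
  assumes "x < y" "x = k + 1 \<or> x = k + 2 \<or> y = k + 1 \<or> y = k + 2"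
  shows "{x, y} \<in> ear k b T \<longleftrightarrow> {x, y} = cdiag k b"
  using assms skip_image_no_gap[of "{x, y}" k T] unfolding ear_def
  by (auto simp: doubleton_eq_iff)

lemma skip_pair_in_ear:
  assumes "{x, y} \<in> T"
  shows "{skip k x, skip k y} \<in> ear k b T"
proof -
  have "{skip k x, skip k y} = skip k ` {x, y}" by simp
  then show ?thesis using assms unfolding ear_def by blast
qed

text \<open>Segments fall into two classes. Among those that end at a new point \<open>k + 1\<close>
  or \<open>k + 2\<close>, only the diagonal of the ear is drawn. The others are pulled back by
  \<open>unskip\<close> to the old polygon, where the base \<open>{k, k + 3}\<close> becomes the
  side \<open>{k, k + 1}\<close>.\<close>

lemma triangulation_ear:
  assumes T: "triangulation N T" and k: "1 \<le> k" "k < N" and N: "3 \<le> N"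
  shows "triangulation (N + 2) (ear k b T)"
proof (rule triangulationI)
  have "skip k ` e \<in> diagonals (N + 2)" if "e \<in> T" for e
  proof -
    have "e \<in> diagonals N" using T that triangulation_diagonals by blast
    then obtain x y where e: "e = {x, y}" "x < y" by (rule diagonal_cases)
    with triangulation_pairE[OF T] that have "1 \<le> x \<and> x + 1 < y \<and> y \<le> N \<and> \<not> (x = 1 \<and> y = N)"
      by blast
    with e k show ?thesis
      by (simp add: pair_in_diagonals strict_mono_skip) (auto simp: skip_def)
  qed
  moreover have "{k, k + 3} \<in> diagonals (N + 2)" using k N by (simp add: pair_in_diagonals)
  moreover have "cdiag k b \<in> diagonals (N + 2)"
    using k N unfolding cdiag_def by (simp add: pair_in_diagonals)
  ultimately show "ear k b T \<subseteq> diagonals (N + 2)" unfolding ear_def by auto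
next
  fix x y u v assume lt: "x < u" "u < y" "y < v" and xy: "{x, y} \<in> ear k b T" and uv: "{u, v} \<in> ear k b T"
  have xy': "x < y" and uv': "u < v" using lt by auto
  note c = cdiag_cases[of k b]
  show False
  proof (cases "x = k + 1 \<or> x = k + 2 \<or> y = k + 1 \<or> y = k + 2")
    case True
    with xy pair_in_ear_gap[OF xy'] have 1: "{x, y} = cdiag k b" by blast
    show False
    proof (cases "u = k + 1 \<or> u = k + 2 \<or> v = k + 1 \<or> v = k + 2")
      case True
      with uv pair_in_ear_gap[OF uv'] 1 have "{u, v} = {x, y}" by blast
      then show False using lt by (auto simp: doubleton_eq_iff)
    next
      case False
      then show False using 1 c lt by (auto simp: doubleton_eq_iff)
    qed
  next
    case xyF: False
    show False
    proof (cases "u = k + 1 \<or> u = k + 2 \<or> v = k + 1 \<or> v = k + 2")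
      case True
      with uv pair_in_ear_gap[OF uv'] have "{u, v} = cdiag k b" by blast
      then show False using c lt xyF by (auto simp: doubleton_eq_iff)
    next
      case False
      have x: "x = k \<and> y = k + 3 \<or> {unskip k x, unskip k y} \<in> T"
        using pair_in_ear[OF xy'] xyF xy by blast
      have u: "u = k \<and> v = k + 3 \<or> {unskip k u, unskip k v} \<in> T"
        using pair_in_ear[OF uv'] False uv by blast
      have lt': "unskip k x < unskip k u" "unskip k u < unskip k y" "unskip k y < unskip k v"
        using strict_mono_unskip[OF lt(1), of k] strict_mono_unskip[OF lt(2), of k]
          strict_mono_unskip[OF lt(3), of k] xyF False by blast+
      from x u show False
      proof (elim disjE)
        assume "{unskip k x, unskip k y} \<in> T" "{unskip k u, unskip k v} \<in> T"
        then show False using triangulation_noncrossing[OF T] lt' by blast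
      qed (use lt False xyF in auto)
    qed
  qed
next
  fix x y assume xy: "x < y" and d: "{x, y} \<in> diagonals (N + 2)" and n: "{x, y} \<notin> ear k b T"
  have base: "{k, k + 3} \<in> ear k b T" unfolding ear_def by simp
  have cd: "cdiag k b \<in> ear k b T" unfolding ear_def by simp
  note c = cdiag_cases[of k b]
  from d xy have d': "1 \<le> x" "x + 1 < y" "y \<le> N + 2" "\<not> (x = 1 \<and> y = N + 2)"
    by (auto simp: pair_in_diagonals)
  show "\<exists>u v. u < v \<and> {u, v} \<in> ear k b T \<and> (x < u \<and> u < y \<and> y < v \<or> u < x \<and> x < v \<and> v < y)"
  proof (cases "x = k + 1 \<or> x = k + 2 \<or> y = k + 1 \<or> y = k + 2")
    case True
    show ?thesis
    proof (cases "{x, y} = {k, k + 2} \<or> {x, y} = {k + 1, k + 3}")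
      case True
      then have "x = k \<and> y = k + 2 \<or> x = k + 1 \<and> y = k + 3"
        using xy by (auto simp: doubleton_eq_iff)
      moreover have "{x, y} \<noteq> cdiag k b" using n cd by auto
      ultimately have "x = k \<and> y = k + 2 \<and> cdiag k b = {k + 1, k + 3} \<or>
        x = k + 1 \<and> y = k + 3 \<and> cdiag k b = {k, k + 2}" using c by blast
      then show ?thesis
      proof
        assume "x = k \<and> y = k + 2 \<and> cdiag k b = {k + 1, k + 3}"
        then show ?thesis using cd by (intro exI[of _ "k + 1"] exI[of _ "k + 3"]) auto
      next
        assume "x = k + 1 \<and> y = k + 3 \<and> cdiag k b = {k, k + 2}"
        then show ?thesis using cd by (intro exI[of _ "k"] exI[of _ "k + 2"]) auto
      qed
    next
      case False
      then have "\<not> (x = k \<and> y = k + 2)" "\<not> (x = k + 1 \<and> y = k + 3)" by auto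
      \<comment> \<open>A diagonal at a new point that stays inside the quadrilateral is one of its
        two diagonals; any other one leaves through the base.\<close>
      with True d' have "x < k \<and> k < y \<and> y < k + 3 \<or> k < x \<and> x < k + 3 \<and> k + 3 < y" by arith
      then show ?thesis using base by (intro exI[of _ "k"] exI[of _ "k + 3"]) auto
    qed
  next
    case False
    define i j where "i = unskip k x" and "j = unskip k y"
    have ij: "x = skip k i" "y = skip k j" "i < j"
      using False xy by (auto simp: i_def j_def skip_unskip strict_mono_unskip)
    have nT: "{i, j} \<notin> T" "\<not> (x = k \<and> y = k + 3)"
      using pair_in_ear[OF xy, of k b T] False n by (auto simp: i_def j_def)
    have "{i, j} \<in> diagonals N"
      using ij nT(2) d' k by (simp add: pair_in_diagonals) (auto simp: skip_def split: if_splits)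
    then obtain u v where uv: "u < v" "{u, v} \<in> T" "i < u \<and> u < j \<and> j < v \<or> u < i \<and> i < v \<and> v < j"
      using triangulation_maximal[OF T ij(3)] nT(1) by blast
    then show ?thesis
      using ij by (intro exI[of _ "skip k u"] exI[of _ "skip k v"])
        (auto intro: skip_pair_in_ear strict_mono_skip)
  qed
qed


section \<open>Colorfulness and flips under gluing\<close>

lemma joined_ear:
  assumes T: "triangulation N T" and k: "1 \<le> k" "k < N" and N: "3 \<le> N" and "x \<noteq> y"
    "x \<noteq> k + 1" "x \<noteq> k + 2" "y \<noteq> k + 1" "y \<noteq> k + 2"
  shows "joined (N + 2) (ear k b T) x y \<longleftrightarrow> joined N T (unskip k x) (unskip k y)"
proof -
  have *: "joined (N + 2) (ear k b T) x y \<longleftrightarrow> joined N T (unskip k x) (unskip k y)"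
    if "x < y" "x \<noteq> k + 1" "x \<noteq> k + 2" "y \<noteq> k + 1" "y \<noteq> k + 2" for x y
  proof -
    have lt: "unskip k x < unskip k y" using that by (rule strict_mono_unskip)
    have "{x, y} \<in> sides (N + 2) \<or> x = k \<and> y = k + 3 \<longleftrightarrow> {unskip k x, unskip k y} \<in> sides N"
    proof -
      have "1 \<le> N" "1 \<le> N + 2" using N by auto
      then show ?thesis
        using that k N unfolding pair_in_sides[OF lt \<open>1 \<le> N\<close>] pair_in_sides[OF that(1) \<open>1 \<le> N + 2\<close>]
        by (auto simp: unskip_def)
    qed
    then show ?thesis using pair_in_ear[OF that] by blast
  qed
  show ?thesis
  proof (cases "x < y")
    case True then show ?thesis using * assms by blast
  next
    case False then show ?thesis using *[of y x] assms by (simp add: insert_commute)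
  qed
qed

lemma joined_skip:
  assumes "triangulation N T" "1 \<le> k" "k < N" "3 \<le> N" "x \<noteq> y" "joined N T x y"
  shows "joined (N + 2) (ear k b T) (skip k x) (skip k y)"
proof -
  have "skip k x \<noteq> skip k y" using assms(5) inj_skip by (auto dest: injD)
  then show ?thesis
    using joined_ear[OF assms(1-4), of "skip k x" "skip k y"] skip_not_gap assms(6)
    by (simp add: unskip_skip)
qed

lemma point_color_eq: "point_color a = point_color b \<longleftrightarrow> (even a \<longleftrightarrow> even b)"
  unfolding point_color_def by auto

lemma colorful_iff: "colorful N T \<longleftrightarrow> (\<forall>x y z. x \<noteq> y \<longrightarrow> y \<noteq> z \<longrightarrow> x \<noteq> z \<longrightarrow>
  joined N T x y \<longrightarrow> joined N T y z \<longrightarrow> joined N T x z \<longrightarrow> \<not> (even x = even y \<and> even y = even z))"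
  unfolding colorful_def triangle_def point_color_eq insert_subset by (simp add: conj_ac) blast

lemma joined_gap_same_color:
  assumes "1 \<le> k" "k < N" "3 \<le> N" "joined (N + 2) (ear k b T) x y" "x = k + 1 \<or> x = k + 2"
    "even x = even y" "x \<noteq> y"
  shows "{x, y} = cdiag k b"
proof -
  have *: "{x, y} = cdiag k b" if "x < y" "joined (N + 2) (ear k b T) x y"
    "x = k + 1 \<or> x = k + 2 \<or> y = k + 1 \<or> y = k + 2" "even x = even y" for x y
  proof -
    from that have "{x, y} \<in> sides (N + 2) \<or> {x, y} = cdiag k b"
      using pair_in_ear_gap by blast
    then show ?thesis using that assms(1-3) by (auto simp: pair_in_sides)
  qed
  show ?thesis
  proof (cases "x < y")
    case True then show ?thesis using * assms by blast
  next
    case False then show ?thesis using *[of y x] assms by (simp add: insert_commute)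
  qed
qed

text \<open>A new point is joined to only one point of its own color, across the diagonal of the
  ear, so it lies in no one-colored triangle. On the old points \<open>skip\<close> preserves parity
  and adjacency.\<close>

lemma colorful_ear:
  assumes T: "triangulation N T" and k: "1 \<le> k" "k < N" and N: "3 \<le> N"
  shows "colorful (N + 2) (ear k b T) \<longleftrightarrow> colorful N T"
proof
  assume c: "colorful N T"
  have gap: False if "x \<noteq> y" "y \<noteq> z" "x \<noteq> z" "joined (N + 2) (ear k b T) x y"
    "joined (N + 2) (ear k b T) x z" "even x = even y" "even y = even z" "x = k + 1 \<or> x = k + 2" for x y z
  proof -
    have "{x, y} = cdiag k b" "{x, z} = cdiag k b"
      using that joined_gap_same_color[OF k N] by blast+
    then show False using that by (metis doubleton_eq_iff)
  qed
  show "colorful (N + 2) (ear k b T)"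
    unfolding colorful_iff
  proof (intro allI impI notI)
    fix x y z assume t: "x \<noteq> y" "y \<noteq> z" "x \<noteq> z" "joined (N + 2) (ear k b T) x y"
      "joined (N + 2) (ear k b T) y z" "joined (N + 2) (ear k b T) x z"
      and e: "even x = even y \<and> even y = even z"
    have "x \<noteq> k + 1 \<and> x \<noteq> k + 2" using gap[of x y z] t e by blast
    moreover have "y \<noteq> k + 1 \<and> y \<noteq> k + 2" using gap[of y x z] t e by (auto simp: insert_commute)
    moreover have "z \<noteq> k + 1 \<and> z \<noteq> k + 2" using gap[of z x y] t e by (auto simp: insert_commute)
    moreover have "even (unskip k w) = even w" if "w \<noteq> k + 1 \<and> w \<noteq> k + 2" for w
      using that even_skip[of k "unskip k w"] skip_unskip[of w k] by auto
    moreover have "unskip k v \<noteq> unskip k w"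
      if "v \<noteq> k + 1 \<and> v \<noteq> k + 2" "w \<noteq> k + 1 \<and> w \<noteq> k + 2" "v \<noteq> w" for v w
      using that skip_unskip by metis
    ultimately show False
      using t e c joined_ear[OF T k N] unfolding colorful_iff by metis
  qed
next
  assume c: "colorful (N + 2) (ear k b T)"
  show "colorful N T"
    unfolding colorful_iff
  proof (intro allI impI notI)
    fix x y z assume "x \<noteq> y" "y \<noteq> z" "x \<noteq> z" "joined N T x y" "joined N T y z" "joined N T x z"
      "even x = even y \<and> even y = even z"
    then show False
      using c joined_skip[OF T k N] injD[OF inj_skip] even_skip unfolding colorful_iff by metis
  qed
qed

text \<open>The definition of \<open>flip\<close> does not demand that the new diagonal was absent
  before. If it was present, then \<open>T'\<close> would just be \<open>T\<close> without
  \<open>{a, b}\<close>, and no segment of \<open>T'\<close> would cross \<open>{a, b}\<close>,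
  against the maximality of \<open>T'\<close>.\<close>

lemma flip_sym:
  assumes "triangulation N T" "triangulation N T'" "flip N T T'"
  shows "flip N T' T"
proof -
  from assms(3) obtain a b c d where ab: "{a, b} \<in> T" and t: "triangle N T a b c" "triangle N T a b d"
    and cd: "c \<noteq> d" and T': "T' = insert {c, d} (T - {{a, b}})"
    unfolding flip_def by blast
  have notin: "{c, d} \<notin> T"
  proof
    assume c: "{c, d} \<in> T"
    have ne: "{c, d} \<noteq> {a, b}" using t cd unfolding triangle_def by (auto simp: doubleton_eq_iff)
    have sub: "T' \<subseteq> T" using T' c by auto
    have "{a, b} \<in> diagonals N - T'"
      using ab assms(1) T' ne triangulation_diagonals by blast
    then obtain g where "g \<in> T'" "crossing {a, b} g" using assms(2) unfolding triangulation_def by blast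
    then show False using sub ab assms(1) unfolding triangulation_def by blast
  qed
  have ne: "{x, y} \<noteq> {a, b}" if "x = c \<or> x = d" for x y
    using that t unfolding triangle_def by (auto simp: doubleton_eq_iff)
  have "{c, d} \<in> T'" using T' by blast
  moreover have "triangle N T' c d a" "triangle N T' c d b"
    using t T' cd ne unfolding triangle_def by (auto simp: insert_commute)
  moreover have "a \<noteq> b" using t unfolding triangle_def by blast
  moreover have "T = insert {a, b} (T' - {{c, d}})" using T' notin ab by auto
  ultimately show ?thesis unfolding flip_def by blast
qed

lemma flip_ear:
  assumes T: "triangulation N T" and k: "1 \<le> k" "k < N" and N: "3 \<le> N" and fl: "flip N T T'"
  shows "flip (N + 2) (ear k b T) (ear k b T')"
proof -
  from fl obtain x y c d where xy: "{x, y} \<in> T" and t: "triangle N T x y c" "triangle N T x y d"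
    and cd: "c \<noteq> d" and T': "T' = insert {c, d} (T - {{x, y}})"
    unfolding flip_def by blast
  let ?s = "skip k"
  have inj: "?s v = ?s w \<longleftrightarrow> v = w" for v w using injD[OF inj_skip] by blast
  have tr: "triangle (N + 2) (ear k b T) (?s v) (?s w) (?s z)" if "triangle N T v w z" for v w z
    using that joined_skip[OF T k N] unfolding triangle_def by (simp add: inj)
  have ne: "{?s x, ?s y} \<noteq> {k, k + 3}" "{?s x, ?s y} \<noteq> cdiag k b"
  proof -
    \<comment> \<open>The preimage of the base is a side of the old polygon, hence it cannot be the
      diagonal that is flipped.\<close>
    have "{k, k + 1} \<notin> T" using triangulation_pairE[OF T, of k "k + 1"] by auto
    then have "{x, y} \<noteq> {k, k + 1}" using xy by auto
    then have "?s ` {x, y} \<noteq> ?s ` {k, k + 1}"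
      using inj_image_eq_iff[OF inj_skip, of k "{x, y}" "{k, k + 1}"] by simp
    then show "{?s x, ?s y} \<noteq> {k, k + 3}" unfolding skip_image_side by simp
    show "{?s x, ?s y} \<noteq> cdiag k b"
      using cdiag_cases[of k b] skip_not_gap[of k] by (metis doubleton_eq_iff)
  qed
  have im: "(`) ?s ` T' = insert {?s c, ?s d} ((`) ?s ` T - {{?s x, ?s y}})"
  proof -
    have "(`) ?s ` (T - {{x, y}}) = (`) ?s ` T - (`) ?s ` {{x, y}}"
      by (rule image_set_diff) (simp add: inj_def inj_image_eq_iff[OF inj_skip])
    then show ?thesis unfolding T' by simp
  qed
  have "ear k b T' = insert {?s c, ?s d} (ear k b T - {{?s x, ?s y}})"
  proof -
    have "insert A (insert B (insert X (I - {E}))) = insert X (insert A (insert B I) - {E})"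
      if "E \<noteq> A" "E \<noteq> B" for A B X E :: "nat set" and I using that by blast
    then show ?thesis unfolding ear_def im using ne by presburger
  qed
  moreover have "{?s x, ?s y} \<in> ear k b T" using xy by (rule skip_pair_in_ear)
  ultimately show ?thesis using tr t cd unfolding flip_def by (metis inj)
qed

lemma flip_color:
  assumes T: "triangulation N T" and k: "1 \<le> k" "k < N" and N: "3 \<le> N"
  shows "flip (N + 2) (ear k b T) (ear k (\<not> b) T)"
proof -
  have sd: "{k, k + 1} \<in> sides (N + 2)" "{k + 1, k + 2} \<in> sides (N + 2)" "{k + 2, k + 3} \<in> sides (N + 2)"
    using k by (auto simp: pair_in_sides)
  have base: "{k, k + 3} \<in> ear k b T" for b unfolding ear_def by simp
  have *: "flip (N + 2) (ear k b T) (ear k (\<not> b) T)" if "b = odd k" for b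
  proof -
    have c: "cdiag k b = {k, k + 2}" "cdiag k (\<not> b) = {k + 1, k + 3}" using that unfolding cdiag_def by auto
    have "{k, k + 2} \<notin> (`) (skip k) ` T" using skip_image_no_gap by blast
    moreover have "{k, k + 2} \<noteq> {k, k + 3}" by (auto simp: doubleton_eq_iff)
    ultimately have "ear k (\<not> b) T = insert {k + 1, k + 3} (ear k b T - {{k, k + 2}})"
      unfolding ear_def c by auto
    moreover have "triangle (N + 2) (ear k b T) k (k + 2) (k + 1)" "triangle (N + 2) (ear k b T) k (k + 2) (k + 3)"
      using sd base[of b] c unfolding triangle_def by (auto simp: insert_commute ear_def)
    moreover have "{k, k + 2} \<in> ear k b T" using c unfolding ear_def by auto
    ultimately show ?thesis unfolding flip_def by (metis add_left_cancel numeral_eq_one_iff semiring_norm(84))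
  qed
  show ?thesis
  proof (cases "b = odd k")
    case True then show ?thesis by (rule *)
  next
    case False
    then show ?thesis using *[of "\<not> b"] flip_sym triangulation_ear[OF T k N] by auto
  qed
qed

text \<open>The triangle \<open>v - 1, v, v + 1\<close> of \<open>T\<close> becomes
  \<open>v - 1, v, v + 3\<close> beside the ear. For \<open>b = odd v\<close> the diagonal of the
  ear is \<open>{v, v + 2}\<close>, whether the ear sits at \<open>v\<close> or at
  \<open>v - 1\<close>. So the two results differ only in the diagonal of the quadrilateral
  \<open>v - 1, v, v + 2, v + 3\<close>.\<close>

lemma flip_shift:
  assumes T: "triangulation N T" and v: "2 \<le> v" "v < N" and j: "joined N T (v - 1) (v + 1)"
    and b: "b = odd v"
  shows "flip (N + 2) (ear v b T) (ear (v - 1) b T)"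
proof -
  have v': "v - 1 < v + 1" "1 \<le> N" using v by auto
  \<comment> \<open>The segment \<open>{v - 1, v + 1}\<close> cuts off \<open>v\<close>. As no
    diagonal ends there, gluing at \<open>v\<close> and gluing at \<open>v - 1\<close> relabel
    \<open>T\<close> in the same way.\<close>
  have free: "v \<notin> e" if "e \<in> T" for e
  proof
    assume ve: "v \<in> e"
    have "e \<in> diagonals N" using T that triangulation_diagonals by blast
    then obtain x y where e: "e = {x, y}" "x < y" by (rule diagonal_cases)
    note d = triangulation_pairE[OF T, of x y]
    show False
    proof (cases "{v - 1, v + 1} \<in> T")
      case True
      show False
        using ve e that d triangulation_noncrossing[OF T True, of v y]
          triangulation_noncrossing[OF T _ True, of x v] by force
    next
      case False
      then show False using j pair_in_sides[OF v'] d e that by auto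
    qed
  qed
  have cd: "cdiag v b = {v, v + 2}" "cdiag (v - 1) b = {v, v + 2}"
    using b v unfolding cdiag_def by auto
  have im: "(`) (skip v) ` T = (`) (skip (v - 1)) ` T"
  proof (intro image_cong refl)
    fix e x assume "e \<in> T" "x \<in> e"
    then have "x \<noteq> v" using free by blast
    then show "skip v x = skip (v - 1) x" unfolding skip_def by auto
  qed
  have nim: "{v, v + 3} \<notin> (`) (skip (v - 1)) ` T"
    using skip_image_no_gap[of "{v, v + 3}" "v - 1" T] v by auto
  have ne: "{v, v + 3} \<noteq> {v, v + 2}" "{v, v + 3} \<noteq> {v - 1, v + 2}" by (auto simp: doubleton_eq_iff)
  have eq: "ear (v - 1) b T = insert {v + 2, v - 1} (ear v b T - {{v, v + 3}})"
  proof -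
    have "{v - 1, v - 1 + 3} = {v + 2, v - 1}" using v by auto
    then show ?thesis unfolding ear_def cd im using ne nim by auto
  qed
  have N: "3 \<le> N" using v by simp
  have "joined (N + 2) (ear v b T) (skip v (v - 1)) (skip v (v + 1))"
    using joined_skip[OF T _ v(2) N _ j] v by simp
  moreover have "skip v (v - 1) = v - 1" "skip v (v + 1) = v + 3" by (auto simp: skip_def)
  ultimately have j': "joined (N + 2) (ear v b T) (v - 1) (v + 3)" by metis
  have "{v + 3, v + 2} \<in> sides (N + 2)" using v by (subst insert_commute) (simp add: pair_in_sides)
  then have "triangle (N + 2) (ear v b T) v (v + 3) (v + 2)"
    unfolding triangle_def by (auto simp: ear_def cd)
  moreover have "{v - 1, v} \<in> sides (N + 2)" using v by (simp add: pair_in_sides)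
  then have "triangle (N + 2) (ear v b T) v (v + 3) (v - 1)"
    using v j' unfolding triangle_def by (auto simp: ear_def insert_commute)
  moreover have "{v, v + 3} \<in> ear v b T" unfolding ear_def by simp
  moreover have "v + 2 \<noteq> v - 1" by simp
  ultimately show ?thesis unfolding flip_def using eq by blast
qed


section \<open>Existence and removal of ears\<close>

lemma triangulation_apex:
  assumes T: "triangulation N T" and xy: "{x, y} \<in> T \<or> x = 1 \<and> y = N" and "x + 2 \<le> y"
  obtains z where "x < z" "z < y" "joined N T x z" "joined N T z y"
proof -
  have lt: "x < y" and N: "1 \<le> N" and b: "1 \<le> x" "y \<le> N"
    using assms triangulation_pairE[OF T, of x y] by auto
  \<comment> \<open>The apex is the largest point below \<open>y\<close> that is joined to
    \<open>x\<close>. A diagonal crossing the segment from it to \<open>y\<close> would cross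
    \<open>{x, y}\<close> or \<open>{x, z}\<close>, or start at \<open>x\<close> and provide a
    larger choice.\<close>
  define Z where "Z = {z. x < z \<and> z < y \<and> joined N T x z}"
  have "x + 1 \<in> Z" using assms b N by (auto simp: Z_def pair_in_sides)
  moreover have "finite Z" unfolding Z_def by (rule finite_subset[of _ "{..<y}"]) auto
  ultimately have z: "Max Z \<in> Z" "\<And>w. w \<in> Z \<Longrightarrow> w \<le> Max Z" by (auto intro: Max_in)
  define z where "z = Max Z"
  have z1: "x < z" "z < y" "joined N T x z" using z(1) by (auto simp: z_def Z_def)
  have "joined N T z y"
  proof (rule ccontr)
    assume n: "\<not> joined N T z y"
    then have "{z, y} \<in> diagonals N"
      using z1 b N pair_in_sides[OF z1(2) N] by (auto simp: pair_in_diagonals)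
    then obtain u v where uv: "u < v" "{u, v} \<in> T" "z < u \<and> u < y \<and> y < v \<or> u < z \<and> z < v \<and> v < y"
      using triangulation_maximal[OF T z1(2)] n by blast
    note d = triangulation_pairE[OF T uv(2) uv(1)]
    from uv(3) show False
    proof
      assume c: "z < u \<and> u < y \<and> y < v"
      show False
        using xy
      proof
        assume "{x, y} \<in> T"
        then show False using triangulation_noncrossing[OF T _ uv(2), of x y] c z1(1,2) by linarith
      qed (use c d in auto)
    next
      assume c: "u < z \<and> z < v \<and> v < y"
      have "\<not> u < x"
      proof
        assume "u < x"
        then show False using xy triangulation_noncrossing[OF T uv(2), of x y] c z1(1,2) d by linarith
      qed
      moreover have "\<not> x < u"
      proof
        assume l: "x < u"
        have "{x, z} \<in> T" using z1 c l b pair_in_sides[of x z N] N by auto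
        then show False using triangulation_noncrossing[OF T _ uv(2), of x z] c l by linarith
      qed
      ultimately have "v \<in> Z" using uv c z1 by (auto simp: Z_def)
      then show False using z(2)[of v] c by (auto simp: z_def)
    qed
  qed
  then show thesis using that z1 by blast
qed

lemma colorful_apex:
  assumes T: "triangulation N T" and c: "colorful N T" and xy: "{x, y} \<in> T \<or> x = 1 \<and> y = N"
    and "x + 2 \<le> y"
  obtains z where "x < z" "z < y" "joined N T x z" "joined N T z y" "\<not> (even x = even z \<and> even z = even y)"
proof -
  obtain z where z: "x < z" "z < y" "joined N T x z" "joined N T z y"
    using triangulation_apex[OF T xy assms(4)] by blast
  have "joined N T x y" using xy by (auto simp: sides_def)
  moreover have "x \<noteq> z" "z \<noteq> y" "x \<noteq> y" using z by auto
  ultimately have "\<not> (even x = even z \<and> even z = even y)"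
    using z(3,4) c[unfolded colorful_iff, rule_format, of x z y] by blast
  then show thesis using that z by blast
qed

text \<open>The shortest segment with ends of different colors that is not a side cuts off a quadrilateral.\<close>

lemma ear_exists:
  assumes T: "triangulation N T" and c: "colorful N T" and N: "5 \<le> N"
  obtains k where "1 \<le> k" "k + 3 \<le> N" "{k, k + 3} \<in> T"
proof -
  define P where "P d \<longleftrightarrow> (\<exists>x y. y = x + d \<and> 3 \<le> d \<and> odd d \<and> ({x, y} \<in> T \<or> x = 1 \<and> y = N))" for d
  \<comment> \<open>If both ends have the same color, then the apex has the other color, so both
    parts have odd length. As their lengths add up to at least 4, one part is not a side.\<close>
  have even_split: "\<exists>d'. P d' \<and> d' < y - x"
    if ev: "even (y - x)" and le: "x + 4 \<le> y" and xy: "{x, y} \<in> T \<or> x = 1 \<and> y = N" for x y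
  proof -
    obtain z where z: "x < z" "z < y" "joined N T x z" "joined N T z y" "\<not> (even x = even z \<and> even z = even y)"
      using colorful_apex[OF T c xy] le by auto
    have b: "1 \<le> x" "y \<le> N" "1 \<le> N" using xy le N triangulation_pairE[OF T, of x y] by auto
    have par: "odd (z - x)" "odd (y - z)" using z ev le by auto
    show ?thesis
    proof (cases "z = x + 1")
      case True
      then have "{z, y} \<in> T" using z b le pair_in_sides[of z y N] by auto
      moreover have "3 \<le> y - z" using True le by auto
      ultimately have "P (y - z)" using par z unfolding P_def by (intro exI[of _ z] exI[of _ y]) auto
      then show ?thesis using z by (intro exI[of _ "y - z"]) auto
    next
      case False
      then have "{x, z} \<in> T" using z b le pair_in_sides[of x z N] by auto
      moreover have "3 \<le> z - x" using False par z by presburger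
      ultimately have "P (z - x)" using par z unfolding P_def by (intro exI[of _ x] exI[of _ z]) auto
      then show ?thesis using z by (intro exI[of _ "z - x"]) auto
    qed
  qed
  have "\<exists>d. P d"
  proof (cases "even N")
    case True
    then show ?thesis using N unfolding P_def by (intro exI[of _ "N - 1"] exI[of _ 1] exI[of _ N]) auto
  next
    case False
    then show ?thesis using even_split[of N 1] N by auto
  qed
  then have P: "P (LEAST d. P d)" and least: "\<And>d. P d \<Longrightarrow> (LEAST d. P d) \<le> d"
    by (auto intro: LeastI_ex Least_le)
  define d where "d = (LEAST d. P d)"
  have nP: "\<not> P d'" if "d' < d" for d' using least[of d'] that by (auto simp: d_def)
  obtain x y where xy: "y = x + d" "3 \<le> d" "odd d" "{x, y} \<in> T \<or> x = 1 \<and> y = N"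
  proof -
    have "P d" using P by (simp add: d_def)
    then show ?thesis using that unfolding P_def by blast
  qed
  have b: "1 \<le> x" "y \<le> N" "1 \<le> N" using xy N triangulation_pairE[OF T, of x y] by auto
  have "d = 3"
  proof (rule ccontr)
    assume "d \<noteq> 3"
    then have d5: "5 \<le> d" using xy(2,3) by presburger
    obtain z where z: "x < z" "z < y" "joined N T x z" "joined N T z y"
      using triangulation_apex[OF T xy(4)] xy by auto
    show False
    proof (cases "even (z - x)")
      case True
      have "\<not> P (y - z)" using nP[of "y - z"] z xy by auto
      moreover have "odd (y - z)" using True z xy by auto
      moreover have "y = z + (y - z)" using z by auto
      ultimately have "\<not> (3 \<le> y - z \<and> {z, y} \<in> T)" unfolding P_def by blast
      moreover have "y = z + 1" if "3 \<le> y - z" "{z, y} \<notin> T"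
        using that z b pair_in_sides[of z y N] by auto
      moreover have "y - z = 1" if "\<not> 3 \<le> y - z" using \<open>odd (y - z)\<close> that by presburger
      ultimately have "y = z + 1" using z by force
      then have "{x, z} \<in> T" "x + 4 \<le> z" using z b d5 xy pair_in_sides[of x z N] by auto
      then show False using even_split[of z x] True nP \<open>y = z + 1\<close> xy by force
    next
      case False
      have "\<not> P (z - x)" using nP[of "z - x"] z xy by auto
      moreover have "z = x + (z - x)" using z by auto
      ultimately have "\<not> (3 \<le> z - x \<and> {x, z} \<in> T)" using False unfolding P_def by blast
      moreover have "z = x + 1" if "3 \<le> z - x" "{x, z} \<notin> T"
        using that z b pair_in_sides[of x z N] by auto
      moreover have "z - x = 1" if "\<not> 3 \<le> z - x" using False that by presburger
      ultimately have "z = x + 1" using z by force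
      then have "{z, y} \<in> T" "z + 4 \<le> y" using z b d5 xy pair_in_sides[of z y N] by auto
      moreover have "even (y - z)" using xy \<open>z = x + 1\<close> by auto
      ultimately show False using even_split[of y z] nP \<open>z = x + 1\<close> xy by force
    qed
  qed
  then show thesis using that[of x] xy b N by auto
qed

text \<open>A segment from \<open>k + 1\<close> or \<open>k + 2\<close> to a point outside the
  quadrilateral would cross its base, so by maximality exactly one of its two diagonals is present.
  Everything else avoids the two points and can be relabelled.\<close>

lemma ear_remove:
  assumes T: "triangulation (N + 2) T" and c: "colorful (N + 2) T" and N: "3 \<le> N"
    and k: "1 \<le> k" "k + 3 \<le> N + 2" "{k, k + 3} \<in> T"
  obtains b T' where "triangulation N T'" "colorful N T'" "T = ear k b T'"
proof -
  define b where "b = (({k, k + 2} \<in> T) = odd k)"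
  have k': "k < N" using k by simp
  have one: "{k, k + 2} \<in> T \<or> {k + 1, k + 3} \<in> T"
  proof (rule ccontr)
    assume n: "\<not> ?thesis"
    have "{k, k + 2} \<in> diagonals (N + 2)" using k N by (simp add: pair_in_diagonals)
    then obtain u v where uv: "u < v" "{u, v} \<in> T" "k < u \<and> u < k + 2 \<and> k + 2 < v \<or> u < k \<and> k < v \<and> v < k + 2"
      using triangulation_maximal[OF T, of k "k + 2"] n by auto
    from uv(3) show False
    proof
      assume "k < u \<and> u < k + 2 \<and> k + 2 < v"
      then have "u = k + 1" "k + 2 < v" by auto
      moreover from this n uv(2) have "v \<noteq> k + 3" by auto
      ultimately have "u = k + 1" "k + 3 < v" by auto
      then show False using triangulation_noncrossing[OF T k(3) uv(2)] by auto
    next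
      assume "u < k \<and> k < v \<and> v < k + 2"
      then show False using triangulation_noncrossing[OF T uv(2) k(3)] by auto
    qed
  qed
  have two: "\<not> ({k, k + 2} \<in> T \<and> {k + 1, k + 3} \<in> T)"
    using triangulation_noncrossing[OF T, of k "k + 2" "k + 1" "k + 3"] by auto
  have cd: "cdiag k b \<in> T" using one unfolding cdiag_def b_def by auto
  have cd': "e = cdiag k b" if "e \<in> T" "e = {k, k + 2} \<or> e = {k + 1, k + 3}" for e
    using that two unfolding cdiag_def b_def by auto
  \<comment> \<open>The base pulls back to the side \<open>{k, k + 1}\<close>, which must not be
    counted as a diagonal.\<close>
  define T' where "T' = {e. skip k ` e \<in> T \<and> e \<noteq> {k, k + 1}}"
  have gap: "{x, y} = cdiag k b" if "{x, y} \<in> T" "x < y"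
    "x = k + 1 \<or> x = k + 2 \<or> y = k + 1 \<or> y = k + 2" for x y
  proof (rule cd'[OF that(1)])
    note d = triangulation_pairE[OF T that(1,2)]
    have "\<not> (x < k \<and> k < y \<and> y < k + 3)" "\<not> (k < x \<and> x < k + 3 \<and> k + 3 < y)"
      using triangulation_noncrossing[OF T that(1) k(3)] triangulation_noncrossing[OF T k(3) that(1)] by auto
    then have "x = k \<and> y = k + 2 \<or> x = k + 1 \<and> y = k + 3" using d that(3) by arith
    then show "{x, y} = {k, k + 2} \<or> {x, y} = {k + 1, k + 3}" by auto
  qed
  have memT': "{i, j} \<in> T' \<longleftrightarrow> {skip k i, skip k j} \<in> T \<and> {i, j} \<noteq> {k, k + 1}" for i j
    unfolding T'_def by simp
  have eq: "T = ear k b T'"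
  proof
    show "T \<subseteq> ear k b T'"
    proof
      fix e assume e: "e \<in> T"
      then have "e \<in> diagonals (N + 2)" using T triangulation_diagonals by blast
      then obtain x y where xy: "e = {x, y}" "x < y" by (rule diagonal_cases)
      show "e \<in> ear k b T'"
      proof (cases "x = k + 1 \<or> x = k + 2 \<or> y = k + 1 \<or> y = k + 2")
        case True
        then show ?thesis using gap[of x y] xy e unfolding ear_def by simp
      next
        case False
        have "{x, y} \<in> ear k b T' \<longleftrightarrow> x = k \<and> y = k + 3 \<or> {unskip k x, unskip k y} \<in> T'"
          using pair_in_ear[OF xy(2)] False by blast
        moreover have "skip k (unskip k x) = x" "skip k (unskip k y) = y" using False skip_unskip by blast+
        moreover have "x = k \<and> y = k + 3" if "{unskip k x, unskip k y} = {k, k + 1}"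
        proof -
          have "skip k ` {unskip k x, unskip k y} = skip k ` {k, k + 1}" using that by simp
          then have "{x, y} = {k, k + 3}" using calculation(2,3) unfolding skip_image_side by simp
          then show ?thesis using xy by (auto simp: doubleton_eq_iff)
        qed
        ultimately show ?thesis using memT' e xy by metis
      qed
    qed
    show "ear k b T' \<subseteq> T" using k(3) cd unfolding ear_def T'_def by auto
  qed
  have "triangulation N T'"
  proof (rule triangulationI)
    show "T' \<subseteq> diagonals N"
    proof
      fix e assume e: "e \<in> T'"
      then have eT: "skip k ` e \<in> T" unfolding T'_def by blast
      then have "skip k ` e \<in> diagonals (N + 2)" using T triangulation_diagonals by blast
      then obtain x y where xy: "skip k ` e = {x, y}" "x < y" by (rule diagonal_cases)
      have "x \<in> skip k ` e" "y \<in> skip k ` e" using xy by auto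
      then obtain i j where ij: "x = skip k i" "y = skip k j" by blast
      have "skip k ` e = skip k ` {i, j}" using xy ij by simp
      then have eij: "e = {i, j}" using inj_image_eq_iff[OF inj_skip, of k e "{i, j}"] by simp
      have lt: "i < j" using xy ij by (metis strict_mono_skip linorder_neqE_nat order.asym)
      have "{i, j} \<noteq> {k, k + 1}" using e eij unfolding T'_def by blast
      then have "\<not> (i = k \<and> j = k + 1)" by auto
      moreover have "{skip k i, skip k j} \<in> T" using eT eij by simp
      then have "1 \<le> skip k i \<and> skip k i + 1 < skip k j \<and> skip k j \<le> N + 2 \<and> \<not> (skip k i = 1 \<and> skip k j = N + 2)"
        using triangulation_pairE[OF T] strict_mono_skip[OF lt] by blast
      ultimately show "e \<in> diagonals N"
        unfolding eij pair_in_diagonals[OF lt] using k by (auto simp: skip_def split: if_splits)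
    qed
  next
    fix x y u v assume "x < u" "u < y" "y < v" "{x, y} \<in> T'" "{u, v} \<in> T'"
    then show False using triangulation_noncrossing[OF T] memT' strict_mono_skip by metis
  next
    fix x y assume xy: "x < y" "{x, y} \<in> diagonals N" "{x, y} \<notin> T'"
    then have d: "1 \<le> x" "x + 1 < y" "y \<le> N" "\<not> (x = 1 \<and> y = N)" by (auto simp: pair_in_diagonals)
    have lt: "skip k x < skip k y" using xy(1) by (rule strict_mono_skip)
    have "{skip k x, skip k y} \<in> diagonals (N + 2)"
      unfolding pair_in_diagonals[OF lt] using d k by (auto simp: skip_def)
    moreover have "{skip k x, skip k y} \<notin> T"
      using xy d memT'[of x y] by (auto simp: doubleton_eq_iff)
    ultimately obtain u v where uv: "u < v" "{u, v} \<in> T"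
      "skip k x < u \<and> u < skip k y \<and> skip k y < v \<or> u < skip k x \<and> skip k x < v \<and> v < skip k y"
      using triangulation_maximal[OF T lt] by blast
    have nogap: "\<not> (u = k + 1 \<or> u = k + 2 \<or> v = k + 1 \<or> v = k + 2)"
    proof
      assume "u = k + 1 \<or> u = k + 2 \<or> v = k + 1 \<or> v = k + 2"
      then have "{u, v} = cdiag k b" using gap[OF uv(2,1)] by blast
      then have "{u, v} = {k, k + 2} \<or> {u, v} = {k + 1, k + 3}" using cdiag_cases[of k b] by simp
      then have "u = k \<and> v = k + 2 \<or> u = k + 1 \<and> v = k + 3" using uv(1) by (auto simp: doubleton_eq_iff)
      then show False using uv(3) skip_not_gap[of k x] skip_not_gap[of k y] by auto
    qed
    then have s: "skip k (unskip k u) = u" "skip k (unskip k v) = v" using skip_unskip by blast+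
    have ord: "i < j" if "skip k i < skip k j" for i j
      using that by (metis strict_mono_skip linorder_neqE_nat order.asym)
    have nb: "\<not> (u = k \<and> v = k + 3)"
      using uv(3) skip_not_gap[of k x] skip_not_gap[of k y] by auto
    have "{unskip k u, unskip k v} \<noteq> {k, k + 1}"
    proof
      assume "{unskip k u, unskip k v} = {k, k + 1}"
      then have "skip k ` {unskip k u, unskip k v} = skip k ` {k, k + 1}" by simp
      then have "{u, v} = {k, k + 3}" using s unfolding skip_image_side by simp
      then show False using nb uv(1) by (auto simp: doubleton_eq_iff)
    qed
    then have "{unskip k u, unskip k v} \<in> T'" using memT' s uv(2) by simp
    moreover have "unskip k u < unskip k v" using ord s uv(1) by simp
    moreover have "x < unskip k u \<and> unskip k u < y \<and> y < unskip k v \<or>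
        unskip k u < x \<and> x < unskip k v \<and> unskip k v < y"
      using uv(3) ord s by metis
    ultimately show "\<exists>u v. u < v \<and> {u, v} \<in> T' \<and> (x < u \<and> u < y \<and> y < v \<or> u < x \<and> x < v \<and> v < y)"
      by blast
  qed
  moreover from this have "colorful N T'" using colorful_ear[OF _ k(1) k' N] c eq by blast
  ultimately show thesis using that eq by blast
qed


section \<open>Codes of colorful triangulations\<close>

text \<open>
  The polygon has \<open>polygon_size f m\<close> points, and \<open>f\<close> is the parity of this number. Position 0 of a code stands
  for the initial quadrilateral if \<open>f = 0\<close>, and for the initial triangle, which has no diagonal, if \<open>f = 1\<close>.
  The ears are glued in such an order that the last one is always the leftmost one; this
  amounts to the bound on the increments and makes codes unique.
\<close>

definition polygon_size :: "nat \<Rightarrow> nat \<Rightarrow> nat" where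
  "polygon_size f m = 2 * m + 4 - f"

definition code :: "nat \<Rightarrow> nat \<Rightarrow> (nat \<Rightarrow> nat) \<Rightarrow> bool" where
  "code f m a \<longleftrightarrow> a 0 = 1 - f \<and> (\<forall>i<m. 1 \<le> a (Suc i) \<and> a (Suc i) \<le> a i + 2)"

primrec decode :: "nat \<Rightarrow> (nat \<Rightarrow> nat) \<Rightarrow> nat set \<Rightarrow> nat \<Rightarrow> nat set set" where
  "decode f a C 0 = (if f = 0 then {cdiag 1 (0 \<in> C)} else {})"
| "decode f a C (Suc m) = ear (a (Suc m)) (Suc m \<in> C) (decode f a C m)"

lemma polygon_size_Suc: "f \<le> 1 \<Longrightarrow> polygon_size f (Suc m) = polygon_size f m + 2"
  unfolding polygon_size_def by simp

lemma polygon_size_ge: "f \<le> 1 \<Longrightarrow> 3 \<le> polygon_size f m"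
  unfolding polygon_size_def by simp

lemma code_Suc: "code f (Suc m) a \<longleftrightarrow> code f m a \<and> 1 \<le> a (Suc m) \<and> a (Suc m) \<le> a m + 2"
  unfolding code_def by (auto simp: less_Suc_eq)

text \<open>The value \<open>a 0 = 1 - f\<close> lets the increment bound admit
  \<open>1, 2, 3\<close> as first position in the quadrilateral and \<open>1, 2\<close> in the
  triangle, that is, every side but the outer one. Afterwards each ear adds two sides while the
  bound moves by at most two.\<close>

lemma code_le: "code f m a \<Longrightarrow> f \<le> 1 \<Longrightarrow> a m + 2 < polygon_size f m"
  by (induction m) (auto simp: code_Suc polygon_size_def code_def[of _ 0])

lemma code_mono: "code f m a \<Longrightarrow> k \<le> m \<Longrightarrow> code f k a"
  unfolding code_def by auto

lemma code_cong: "(\<And>i. i \<le> m \<Longrightarrow> a i = a' i) \<Longrightarrow> code f m a = code f m a'"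
  unfolding code_def by (metis Suc_leI le_eq_less_or_eq zero_le)

lemma decode_cong:
  "(\<And>i. i \<le> m \<Longrightarrow> a i = a' i) \<Longrightarrow> (\<And>i. f \<le> i \<Longrightarrow> i \<le> m \<Longrightarrow> i \<in> C \<longleftrightarrow> i \<in> C') \<Longrightarrow> f \<le> 1 \<Longrightarrow>
    decode f a C m = decode f a' C' m"
proof (induction m)
  case (Suc m)
  then have "decode f a C m = decode f a' C' m" by simp
  moreover have "a (Suc m) = a' (Suc m)" "Suc m \<in> C \<longleftrightarrow> Suc m \<in> C'" using Suc.prems by auto
  ultimately show ?case by simp
qed simp

lemma triangulation_3_4: "triangulation 3 {}" "triangulation 4 {cdiag 1 b}"
proof -
  show "triangulation 3 {}"
    by (rule triangulationI) (auto simp: pair_in_diagonals)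
  show "triangulation 4 {cdiag 1 b}"
  proof (rule triangulationI)
    show "{cdiag 1 b} \<subseteq> diagonals 4" unfolding cdiag_def by (auto simp: pair_in_diagonals)
  next
    fix x y assume xy: "x < y" "{x, y} \<in> diagonals 4" "{x, y} \<notin> {cdiag 1 b}"
    then have "x = 1 \<and> y = 3 \<or> x = 2 \<and> y = 4" by (auto simp: pair_in_diagonals)
    then show "\<exists>u v. u < v \<and> {u, v} \<in> {cdiag 1 b} \<and> (x < u \<and> u < y \<and> y < v \<or> u < x \<and> x < v \<and> v < y)"
    proof
      assume "x = 1 \<and> y = 3"
      then show ?thesis using xy(3) unfolding cdiag_def
        by (intro exI[of _ 2] exI[of _ 4]) (auto split: if_splits)
    next
      assume "x = 2 \<and> y = 4"
      then show ?thesis using xy(3) unfolding cdiag_def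
        by (intro exI[of _ 1] exI[of _ 3]) (auto split: if_splits)
    qed
  qed (auto simp: cdiag_def doubleton_eq_iff split: if_splits)
qed

lemma triangulation_3_4_unique:
  "triangulation 3 T \<Longrightarrow> T = {}" "triangulation 4 T \<Longrightarrow> \<exists>b. T = {cdiag 1 b}"
proof -
  assume T: "triangulation 3 T"
  have "e \<notin> diagonals 3" for e
  proof
    assume e: "e \<in> diagonals 3"
    then obtain x y where "e = {x, y}" "x < y" by (rule diagonal_cases)
    then show False using e by (auto simp: pair_in_diagonals)
  qed
  then show "T = {}" using triangulation_diagonals[OF T] by blast
next
  assume T: "triangulation 4 T"
  have d: "e = {1, 3} \<or> e = {2, 4}" if e: "e \<in> diagonals 4" for e
  proof -
    obtain x y where xy: "e = {x, y}" "x < y" using e by (rule diagonal_cases)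
    then have "x = 1 \<and> y = 3 \<or> x = 2 \<and> y = 4" using e by (auto simp: pair_in_diagonals)
    then show ?thesis using xy by blast
  qed
  have "{1, 3} \<in> diagonals 4" by (simp add: pair_in_diagonals)
  have "T \<noteq> {}"
  proof
    assume "T = {}"
    then show False using T \<open>{1, 3} \<in> diagonals 4\<close> unfolding triangulation_def by blast
  qed
  moreover have "\<not> ({1, 3} \<in> T \<and> {2, 4} \<in> T)"
    using triangulation_noncrossing[OF T, of 1 3 2 4] by auto
  moreover have "T \<subseteq> {{1, 3}, {2, 4}}" using d triangulation_diagonals[OF T] by blast
  ultimately have "T = {{1, 3}} \<or> T = {{2, 4}}" by blast
  moreover have "cdiag 1 True = {1, 3}" "cdiag 1 False = {2, 4}" unfolding cdiag_def by auto
  ultimately show "\<exists>b. T = {cdiag 1 b}" by metis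
qed

lemma colorful_3_4: "colorful 3 {}" "colorful 4 {cdiag 1 b}"
proof -
  have j: "joined 3 {} x y \<Longrightarrow> x \<noteq> y \<Longrightarrow> even x = even y \<Longrightarrow> {x, y} = {1, 3}" for x y
    unfolding sides_def by (auto simp: doubleton_eq_iff)
  have j': "joined 4 {cdiag 1 b} x y \<Longrightarrow> x \<noteq> y \<Longrightarrow> even x = even y \<Longrightarrow> {x, y} = cdiag 1 b" for x y
    unfolding sides_def by (auto simp: doubleton_eq_iff)
  show "colorful 3 {}" unfolding colorful_iff using j by (metis doubleton_eq_iff)
  show "colorful 4 {cdiag 1 b}" unfolding colorful_iff using j' by (metis doubleton_eq_iff)
qed

lemma decode_triangulation:
  assumes "f \<le> 1" "code f m a"
  shows "triangulation (polygon_size f m) (decode f a C m)" and "colorful (polygon_size f m) (decode f a C m)"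
proof -
  have "triangulation (polygon_size f m) (decode f a C m) \<and> colorful (polygon_size f m) (decode f a C m)"
    using assms(2)
  proof (induction m)
    case 0
    have "f = 0 \<or> f = 1" using assms(1) by auto
    then show ?case using triangulation_3_4 colorful_3_4 by (auto simp: polygon_size_def)
  next
    case (Suc m)
    then have "code f m a" "1 \<le> a (Suc m)" "a (Suc m) < polygon_size f m"
      using code_le[of f m a] assms(1) by (auto simp: code_Suc)
    then show ?case
      using Suc.IH triangulation_ear colorful_ear polygon_size_ge[OF assms(1)] polygon_size_Suc[OF assms(1)] by simp
  qed
  then show "triangulation (polygon_size f m) (decode f a C m)" "colorful (polygon_size f m) (decode f a C m)" by auto
qed

section \<open>Every colorful triangulation has exactly one code\<close>

lemma ear_commute:
  assumes "k + 2 < l"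
  shows "ear l b (ear k b' T) = ear k b' (ear (l - 2) b T)"
proof -
  have s: "skip l (skip k i) = skip k (skip (l - 2) i)" for i using assms unfolding skip_def by auto
  have "skip l ` skip k ` e = skip k ` skip (l - 2) ` e" for e using s by (simp add: image_image)
  then have im: "(`) (skip l) ` (`) (skip k) ` T = (`) (skip k) ` (`) (skip (l - 2)) ` T"
    by (simp add: image_image)
  have "skip l ` {k, k + 3} = {k, k + 3}" "skip l ` cdiag k b' = cdiag k b'"
    using assms unfolding cdiag_def by (auto simp: skip_def)
  moreover have "skip k ` {l - 2, l - 2 + 3} = {l, l + 3}" using assms by (auto simp: skip_def)
  moreover have "skip k ` cdiag (l - 2) b = cdiag l b"
  proof -
    obtain j where "l = j + 2" using assms by (metis add.commute le_add2 less_imp_le_nat order.trans le_Suc_ex)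
    then show ?thesis using assms unfolding cdiag_def by (auto simp: skip_def)
  qed
  moreover have "(`) g ` insert A (insert B I) = insert (g ` A) (insert (g ` B) ((`) g ` I))"
    for g :: "nat \<Rightarrow> nat" and A B I by simp
  moreover have "insert P (insert Q (insert R (insert S I))) = insert R (insert S (insert P (insert Q I)))"
    for P Q R S :: "nat set" and I by blast
  ultimately show ?thesis unfolding ear_def by (simp only: im)
qed

text \<open>This is an insertion step of a sort: an ear that violates the increment bound lies to
  the right of the last ear, so the two commute and it can be glued below that one, with its
  position reduced by 2. The last entry is tracked because the bound for the ear moved to the top
  has to be checked against the entry now preceding it.\<close>

lemma decode_insert_ear:
  assumes f: "f \<le> 1"
  shows "code f m a \<Longrightarrow> 1 \<le> k \<Longrightarrow> k < polygon_size f m \<Longrightarrow> \<exists>a' C'. code f (Suc m) a' \<and>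
    decode f a' C' (Suc m) = ear k b (decode f a C m) \<and> (a' (Suc m) = k \<or> a' (Suc m) = a m)"
proof (induction m arbitrary: k)
  case 0
  have "code f (Suc 0) (a(Suc 0 := k))" using 0 f by (auto simp: code_def polygon_size_def)
  moreover have "decode f (a(Suc 0 := k)) (if b then insert 1 C else C - {1}) (Suc 0) = ear k b (decode f a C 0)"
    by auto
  ultimately show ?case by (metis fun_upd_same)
next
  case (Suc m)
  show ?case
  proof (cases "k \<le> a (Suc m) + 2")
    case True
    let ?a = "a(Suc (Suc m) := k)" and ?C = "if b then insert (Suc (Suc m)) C else C - {Suc (Suc m)}"
    have "code f (Suc m) ?a" using Suc.prems(1) code_cong[of "Suc m" a ?a f] by simp
    then have "code f (Suc (Suc m)) ?a" using True Suc.prems(2) by (simp add: code_Suc[of _ "Suc m"])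
    moreover have "decode f ?a ?C (Suc m) = decode f a C (Suc m)"
      by (rule decode_cong) (use f in auto)
    then have "decode f ?a ?C (Suc (Suc m)) = ear k b (decode f a C (Suc m))" by simp
    ultimately show ?thesis by (metis fun_upd_same)
  next
    case False
    let ?k = "a (Suc m)"
    have c: "code f m a" "?k \<le> a m + 2" "1 \<le> ?k" using Suc.prems(1) by (auto simp: code_Suc)
    obtain a' C' where a': "code f (Suc m) a'" "decode f a' C' (Suc m) = ear (k - 2) b (decode f a C m)"
      "a' (Suc m) = k - 2 \<or> a' (Suc m) = a m"
    proof -
      have "1 \<le> k - 2" "k - 2 < polygon_size f m"
        using False Suc.prems(3) c(3) polygon_size_Suc[OF f, of m] by auto
      then show ?thesis using Suc.IH[OF c(1)] that by blast
    qed
    let ?a = "a'(Suc (Suc m) := ?k)"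
      and ?C = "if Suc m \<in> C then insert (Suc (Suc m)) C' else C' - {Suc (Suc m)}"
    have "code f (Suc m) ?a" using a'(1) code_cong[of "Suc m" a' ?a f] by simp
    moreover have "?k \<le> a' (Suc m) + 2" using a'(3) c False by auto
    ultimately have "code f (Suc (Suc m)) ?a" using c(3) by (simp add: code_Suc[of _ "Suc m"])
    moreover have "decode f ?a ?C (Suc m) = decode f a' C' (Suc m)"
      by (rule decode_cong) (use f in auto)
    then have "decode f ?a ?C (Suc (Suc m)) = ear ?k (Suc m \<in> C) (ear (k - 2) b (decode f a C m))"
      using a'(2) by simp
    then have "decode f ?a ?C (Suc (Suc m)) = ear k b (decode f a C (Suc m))"
      using ear_commute[of ?k k b "Suc m \<in> C" "decode f a C m"] False by simp
    ultimately show ?thesis by (metis fun_upd_same)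
  qed
qed

lemma decode_surj:
  assumes f: "f \<le> 1"
  shows "triangulation (polygon_size f m) T \<Longrightarrow> colorful (polygon_size f m) T \<Longrightarrow> \<exists>a C. code f m a \<and> T = decode f a C m"
proof (induction m arbitrary: T)
  case 0
  have "code f 0 (\<lambda>i. 1 - f)" unfolding code_def by simp
  moreover have "\<exists>C. T = decode f (\<lambda>i. 1 - f) C 0"
  proof (cases "f = 0")
    case True
    then obtain b where "T = {cdiag 1 b}" using 0 triangulation_3_4_unique(2) by (auto simp: polygon_size_def)
    then have "T = decode f (\<lambda>i. 1 - f) {i. b} 0" using True by simp
    then show ?thesis by blast
  next
    case False
    then show ?thesis using 0 triangulation_3_4_unique(1) f by (simp add: polygon_size_def le_Suc_eq)
  qed
  ultimately show ?case by blast
next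
  case (Suc m)
  let ?N = "polygon_size f m"
  have N: "3 \<le> ?N" using polygon_size_ge[OF f] .
  have T: "triangulation (?N + 2) T" "colorful (?N + 2) T" using Suc.prems polygon_size_Suc[OF f] by auto
  obtain k where k: "1 \<le> k" "k + 3 \<le> ?N + 2" "{k, k + 3} \<in> T" using ear_exists[OF T] N by auto
  obtain b T' where T': "triangulation ?N T'" "colorful ?N T'" "T = ear k b T'"
    using ear_remove[OF T N k] by blast
  obtain a C where aC: "code f m a" "T' = decode f a C m" using Suc.IH[OF T'(1,2)] by blast
  show ?case using decode_insert_ear[OF f aC(1) k(1), of b C] k(2) T'(3) aC(2) by auto
qed

text \<open>This makes codes unique, since the last entry is recovered as the least \<open>k\<close>
  with \<open>{k, k + 3}\<close> drawn. A base further left would lie entirely before the new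
  points, hence would have been drawn earlier, and by the increment bound to the left of
  \<open>a m\<close>, where the induction hypothesis excludes it.\<close>

lemma decode_least_ear:
  assumes f: "f \<le> 1"
  shows "code f m a \<Longrightarrow> k < a m \<Longrightarrow> {k, k + 3} \<notin> decode f a C m"
proof (induction m arbitrary: k)
  case 0
  then have "k = 0" using f by (simp add: code_def)
  then show ?case by (auto simp: cdiag_def doubleton_eq_iff)
next
  case (Suc m)
  let ?l = "a (Suc m)"
  have c: "code f m a" "?l \<le> a m + 2" using Suc.prems(1) by (auto simp: code_Suc)
  show ?case
  proof (cases "k + 3 = ?l + 1 \<or> k + 3 = ?l + 2")
    case True
    then have "{k, k + 3} \<in> decode f a C (Suc m) \<longleftrightarrow> {k, k + 3} = cdiag ?l (Suc m \<in> C)"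
      using pair_in_ear_gap[of k "k + 3" ?l] by simp
    then show ?thesis using cdiag_cases[of ?l "Suc m \<in> C"] by (auto simp: doubleton_eq_iff)
  next
    case False
    then have "{k, k + 3} \<in> decode f a C (Suc m) \<longleftrightarrow> {unskip ?l k, unskip ?l (k + 3)} \<in> decode f a C m"
      using pair_in_ear[of k "k + 3" ?l] Suc.prems(2) by simp
    moreover have "unskip ?l k = k" "unskip ?l (k + 3) = k + 3" using Suc.prems(2) False unfolding unskip_def by auto
    moreover have "k < a m" using c(2) False Suc.prems(2) by auto
    ultimately show ?thesis using Suc.IH[OF c(1)] by simp
  qed
qed

lemma ear_inject:
  assumes T: "triangulation N T" "triangulation N T'" and eq: "ear k b T = ear k b' T'"
  shows "b = b' \<and> T = T'"
proof
  have "{k, k + 2} = cdiag k b \<longleftrightarrow> {k, k + 2} = cdiag k b'"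
    using eq pair_in_ear_gap[of k "k + 2" k] by auto
  moreover have "{k, k + 2} \<noteq> {k + 1, k + 3}" by (auto simp: doubleton_eq_iff)
  ultimately show "b = b'" unfolding cdiag_def by (auto split: if_splits)
  have sub: "T \<subseteq> T'" if "triangulation N T" "triangulation N T'" "ear k b T = ear k b' T'" for T T' b b'
  proof
    fix e assume e: "e \<in> T"
    then have "e \<in> diagonals N" using that(1) triangulation_diagonals by blast
    then obtain x y where xy: "e = {x, y}" "x < y" by (rule diagonal_cases)
    then have "{skip k x, skip k y} \<in> ear k b' T'" using e skip_pair_in_ear that(3) by metis
    then have "skip k x = k \<and> skip k y = k + 3 \<or> {x, y} \<in> T'"
      using pair_in_ear[OF strict_mono_skip[OF xy(2)] skip_not_gap(1,2) skip_not_gap(1,2)] unskip_skip by metis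
    moreover have "x + 1 < y" using triangulation_pairE[OF that(1)] e xy by blast
    then have "\<not> (skip k x = k \<and> skip k y = k + 3)" unfolding skip_def by auto
    ultimately show "e \<in> T'" using xy by blast
  qed
  show "T = T'" using sub[OF T eq] sub[OF T(2,1) eq[symmetric]] by blast
qed

lemma decode_inj:
  assumes f: "f \<le> 1"
  shows "code f m a \<Longrightarrow> code f m a' \<Longrightarrow> decode f a C m = decode f a' C' m \<Longrightarrow> i \<le> m \<Longrightarrow>
    a i = a' i \<and> (f \<le> i \<longrightarrow> (i \<in> C \<longleftrightarrow> i \<in> C'))"
proof (induction m arbitrary: i)
  case 0
  have "{1, 3} \<noteq> {2, 4::nat}" by (auto simp: doubleton_eq_iff)
  then show ?case using 0 f by (auto simp: code_def cdiag_def split: if_splits)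
next
  case (Suc m)
  have mem: "{a (Suc m), a (Suc m) + 3} \<in> decode f a C (Suc m)" for a C by (simp add: ear_def)
  have "a (Suc m) = a' (Suc m)"
    using decode_least_ear[OF f Suc.prems(1)] decode_least_ear[OF f Suc.prems(2)] mem[of a C] mem[of a' C']
      Suc.prems(3) by (metis linorder_neqE_nat)
  moreover have c: "code f m a" "code f m a'" using Suc.prems by (auto simp: code_Suc)
  ultimately have "(Suc m \<in> C) = (Suc m \<in> C') \<and> decode f a C m = decode f a' C' m"
    using ear_inject[OF decode_triangulation(1)[OF f c(1)] decode_triangulation(1)[OF f c(2)]] Suc.prems(3) by auto
  then show ?case
    using Suc.IH[OF c] \<open>a (Suc m) = a' (Suc m)\<close> Suc.prems(4) by (auto simp: le_Suc_eq)
qed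

section \<open>Flips in terms of codes and bits\<close>

lemma flip_decode_color:
  assumes f: "f \<le> 1" and "code f m a" "f \<le> t" "t \<le> m" "\<And>i. i \<noteq> t \<Longrightarrow> i \<in> C \<longleftrightarrow> i \<in> C'" "t \<in> C \<longleftrightarrow> t \<notin> C'"
  shows "flip (polygon_size f m) (decode f a C m) (decode f a C' m)"
  using assms(2,4)
proof (induction m)
  case 0
  have cd: "cdiag 1 True = {1, 3}" "cdiag 1 False = {2, 4}" unfolding cdiag_def by auto
  have "{{1, 2}, {2, 3}, {3, 4}, {1, 4}} \<subseteq> sides 4" by (simp add: pair_in_sides)
  then have tr: "triangle 4 {{1, 3}} 1 3 2" "triangle 4 {{1, 3}} 1 3 4"
    unfolding triangle_def by (simp_all add: insert_commute)
  have *: "flip 4 {cdiag 1 True} {cdiag 1 False}"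
    unfolding flip_def cd
  proof (intro exI conjI)
    show "{1, 3} \<in> {{1, 3::nat}}" "2 \<noteq> (4::nat)" by simp_all
  qed (use tr in simp_all)
  have "flip 4 {cdiag 1 b} {cdiag 1 (\<not> b)}" for b
    using * flip_sym[OF triangulation_3_4(2) triangulation_3_4(2) *] by (cases b) auto
  moreover have z: "f = 0" "t = 0" using assms(3) 0 by auto
  moreover have "0 \<in> C' \<longleftrightarrow> \<not> 0 \<in> C" using assms(6) z by auto
  ultimately show ?case by (simp add: polygon_size_def)
next
  case (Suc m)
  have c: "code f m a" "1 \<le> a (Suc m)" "a (Suc m) < polygon_size f m"
    using Suc.prems(1) code_le[of f m a] f by (auto simp: code_Suc)
  note T = decode_triangulation(1)[OF f c(1)]
  show ?case
  proof (cases "t = Suc m")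
    case True
    have "decode f a C m = decode f a C' m" by (rule decode_cong) (use True assms f in auto)
    then show ?thesis
      using flip_color[OF T[of C] c(2,3) polygon_size_ge[OF f], of "Suc m \<in> C"] True assms(6) polygon_size_Suc[OF f] by simp
  next
    case False
    then have "flip (polygon_size f m) (decode f a C m) (decode f a C' m)" using Suc c(1) by auto
    then show ?thesis
      using flip_ear[OF T[of C] c(2,3) polygon_size_ge[OF f]] False assms(5) polygon_size_Suc[OF f] by simp
  qed
qed

text \<open>The entry \<open>v\<close> exceeds its predecessor by 1 or 2. In either case the bit at
  \<open>j - 1\<close> makes the diagonal of that quadrilateral \<open>{v - 1, v + 1}\<close>, which
  is what \<open>flip_shift\<close> asks for. For \<open>j = f\<close> the predecessor is the
  initial triangle, and its side \<open>{1, 3}\<close> takes this part with \<open>v = 2\<close>.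
  The ears glued later carry the flip along.\<close>

lemma flip_decode_code:
  assumes f: "f \<le> 1" and "code f m a" "code f m a'" and a': "a' j = v - 1" "\<And>i. i \<noteq> j \<Longrightarrow> a' i = a i" and j: "1 \<le> j" "j \<le> m" and v: "a j = v"
    and lt: "a (j - 1) < v" and C: "j \<in> C \<longleftrightarrow> odd v" "j = f \<or> (j - 1 \<in> C \<longleftrightarrow> even v)"
  shows "flip (polygon_size f m) (decode f a C m) (decode f a' C m)"
  using assms(2,3) j(2)
proof (induction m)
  case (Suc m)
  have c: "code f m a" "1 \<le> a (Suc m)" "a (Suc m) < polygon_size f m" "a (Suc m) \<le> a m + 2"
    using Suc.prems(1) code_le[of f m a] f by (auto simp: code_Suc)
  note T = decode_triangulation(1)[OF f c(1)]
  show ?case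
  proof (cases "j = Suc m")
    case True
    have eq: "decode f a' C m = decode f a C m" by (rule decode_cong) (use True f a' in auto)
    have "joined (polygon_size f m) (decode f a C m) (v - 1) (v + 1)"
    proof (cases m)
      case 0
      have "v \<le> 3 - f" "a 0 = 1 - f" "2 \<le> v" using c v True 0 Suc.prems lt f a' by (auto simp: code_def)
      show ?thesis
      proof (cases "f = 0")
        case True
        then have "v = 2 \<or> v = 3" using \<open>v \<le> 3 - f\<close> \<open>2 \<le> v\<close> by auto
        then show ?thesis using 0 C \<open>j = Suc m\<close> True by (auto simp: cdiag_def)
      next
        case False
        then have "v = 2" "f = 1" using \<open>v \<le> 3 - f\<close> \<open>2 \<le> v\<close> f by auto
        then show ?thesis using 0 by (simp add: polygon_size_def pair_in_sides)
      qed
    next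
      case (Suc l)
      have "v = a m + 1 \<or> v = a m + 2" using c(4) lt True v by auto
      then have "cdiag (a m) (m \<in> C) = {v - 1, v + 1}"
        using C True Suc f unfolding cdiag_def by auto
      then show ?thesis using Suc by (simp add: ear_def)
    qed
    moreover have "1 \<le> v - 1" using True Suc.prems(2) a' by (simp add: code_Suc)
    then have "2 \<le> v" by linarith
    ultimately have "flip (polygon_size f m + 2) (ear v (Suc m \<in> C) (decode f a C m)) (ear (v - 1) (Suc m \<in> C) (decode f a C m))"
      using flip_shift[OF T[of C], of v "Suc m \<in> C"] c v True C(1) by simp
    moreover have "decode f a' C (Suc m) = ear (v - 1) (Suc m \<in> C) (decode f a C m)"
      using eq True a' by simp
    moreover have "decode f a C (Suc m) = ear v (Suc m \<in> C) (decode f a C m)" using True v by simp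
    ultimately show ?thesis by (simp only: polygon_size_Suc[OF f])
  next
    case False
    then have "flip (polygon_size f m) (decode f a C m) (decode f a' C m)"
      using Suc c(1) by (auto simp: code_Suc)
    then show ?thesis
      using flip_ear[OF T[of C] c(2,3) polygon_size_ge[OF f]] False a'(2)[of "Suc m"] polygon_size_Suc[OF f] by simp
  qed
qed (use j in simp)

section \<open>Alternating walks of two involutions\<close>

definition trail :: "('a \<Rightarrow> 'a) \<Rightarrow> ('a \<Rightarrow> 'a) \<Rightarrow> ('a \<times> 'a) set" where
  "trail g h = {(x, g x) | x. True} \<union> {(x, h x) | x. True}"

lemma trail_mem: "(x, g x) \<in> trail g h" "(x, h x) \<in> trail g h"
  unfolding trail_def by auto

primrec walk :: "('a \<Rightarrow> 'a) \<Rightarrow> ('a \<Rightarrow> 'a) \<Rightarrow> 'a \<Rightarrow> nat \<Rightarrow> 'a" where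
  "walk g h x 0 = x"
| "walk g h x (Suc i) = (if even i then g else h) (walk g h x i)"

definition fpf_involution :: "'a set \<Rightarrow> ('a \<Rightarrow> 'a) \<Rightarrow> bool" where
  "fpf_involution S g \<longleftrightarrow> (\<forall>x\<in>S. g x \<in> S \<and> g (g x) = x \<and> g x \<noteq> x)"

lemma even_card_fpf_involution:
  assumes "finite S" "fpf_involution S g"
  shows "even (card S)"
  using assms
proof (induction S rule: finite_psubset_induct)
  case (psubset S)
  show ?case
  proof (cases "S = {}")
    case False
    then obtain x where x: "x \<in> S" by blast
    have g: "g x \<in> S" "g (g x) = x" "g x \<noteq> x" using x psubset.prems unfolding fpf_involution_def by auto
    have "fpf_involution (S - {x, g x}) g"
      using psubset.prems g unfolding fpf_involution_def by (metis Diff_iff insert_iff singleton_iff)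
    then have "even (card (S - {x, g x}))" using x by (intro psubset.IH) auto
    moreover have "card (S - {x, g x}) + 2 = card S"
    proof -
      have "card {x, g x} = 2" "{x, g x} \<subseteq> S" using g x by auto
      then show ?thesis using card_Diff_subset[of "{x, g x}" S] card_mono[OF psubset.hyps, of "{x, g x}"] by simp
    qed
    ultimately show ?thesis by (metis even_add even_numeral)
  qed simp
qed

text \<open>
  A set that only the \<open>g\<close>-edges at \<open>u\<close> and \<open>v\<close> leave contains a path from \<open>u\<close> to \<open>v\<close>: otherwise the
  part of it that is reachable from \<open>u\<close> would have even size because of \<open>h\<close>, and odd size
  because of \<open>g\<close>.
\<close>

lemma trail_across_cut:
  assumes X: "finite X" "u \<in> X" and h: "fpf_involution X h"
    and g: "\<And>x. x \<in> X \<Longrightarrow> g (g x) = x \<and> g x \<noteq> x" "\<And>x. x \<in> X \<Longrightarrow> x \<noteq> u \<Longrightarrow> x \<noteq> v \<Longrightarrow> g x \<in> X"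
    and gu: "g u \<notin> X"
  shows "(u, v) \<in> (trail g h)\<^sup>*"
proof -
  define Q where "Q = {(x, h x) | x. x \<in> X} \<union> {(x, g x) | x. x \<in> X \<and> x \<noteq> u \<and> x \<noteq> v}"
  define K where "K = Q\<^sup>* `` {u}"
  have "Q \<subseteq> X \<times> X" using h g unfolding Q_def fpf_involution_def by auto
  then have KX: "K \<subseteq> X" unfolding K_def using X(2) by (auto elim: rtranclE)
  have fin: "finite K" using KX X(1) finite_subset by blast
  have uK: "u \<in> K" unfolding K_def by blast
  have Qcl: "y \<in> K" if "x \<in> K" "(x, y) \<in> Q" for x y
    using that unfolding K_def by (auto intro: rtrancl_into_rtrancl)
  have "v \<in> K"
  proof (rule ccontr)
    assume v: "v \<notin> K"
    have "fpf_involution K h"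
      unfolding fpf_involution_def
    proof
      fix x assume x: "x \<in> K"
      then have "(x, h x) \<in> Q" using KX unfolding Q_def by blast
      then show "h x \<in> K \<and> h (h x) = x \<and> h x \<noteq> x"
        using Qcl[OF x] h x KX unfolding fpf_involution_def by blast
    qed
    then have e1: "even (card K)" using even_card_fpf_involution fin by blast
    have "fpf_involution (K - {u}) g"
      unfolding fpf_involution_def
    proof
      fix x assume x: "x \<in> K - {u}"
      then have xX: "x \<in> X" and "x \<noteq> v" using KX v by auto
      then have "(x, g x) \<in> Q" using x unfolding Q_def by blast
      then have "g x \<in> K" using Qcl x by blast
      moreover have "g x \<noteq> u" using g(1)[OF xX] gu xX by metis
      ultimately show "g x \<in> K - {u} \<and> g (g x) = x \<and> g x \<noteq> x" using g(1)[OF xX] by blast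
    qed
    then have "even (card (K - {u}))" using even_card_fpf_involution fin by blast
    then show False using e1 uK fin by (metis card_Suc_Diff1 even_Suc)
  qed
  moreover have "Q \<subseteq> trail g h" unfolding Q_def trail_def by blast
  ultimately show ?thesis unfolding K_def using rtrancl_mono by blast
qed

lemma trail_commute: "trail g h = trail h g"
  unfolding trail_def by blast

locale two_involutions =
  fixes S :: "'a set" and g h :: "'a \<Rightarrow> 'a" and x :: 'a
  assumes fin: "finite S" and g: "fpf_involution S g" and h: "fpf_involution S h" and x: "x \<in> S"
begin

lemma walk_in: "walk g h x i \<in> S"
  by (induction i) (use g h x in \<open>auto simp: fpf_involution_def\<close>)

lemma walk_back: "walk g h x i = (if even i then g else h) (walk g h x (Suc i))"
  using g h walk_in[of i] unfolding fpf_involution_def by auto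

text \<open>At odd distance, the step out of the first position and the step into the second one are
  of the same kind. So an equality can be pulled inwards from both ends until two consecutive
  positions would coincide.\<close>

lemma walk_odd_distance: "walk g h x i \<noteq> walk g h x (i + 2 * d + 1)"
proof (induction d arbitrary: i)
  case 0
  have "g (walk g h x i) \<noteq> walk g h x i" "h (walk g h x i) \<noteq> walk g h x i"
    using g h walk_in[of i] unfolding fpf_involution_def by blast+
  then show ?case by (auto dest: sym)
next
  case (Suc d)
  show ?case
  proof
    assume e: "walk g h x i = walk g h x (i + 2 * Suc d + 1)"
    have "walk g h x (Suc i) = walk g h x (i + 2 * Suc d)"
      using walk_back[of "i + 2 * Suc d"] e by simp
    then show False using Suc.IH[of "Suc i"] by simp
  qed
qed

lemma walk_even_distance: "walk g h x i = walk g h x (i + 2 * d) \<Longrightarrow> x = walk g h x (2 * d)"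
proof (induction i)
  case (Suc i)
  have "walk g h x i = walk g h x (i + 2 * d)"
    using walk_back[of i] walk_back[of "i + 2 * d"] Suc.prems by simp
  then show ?case using Suc.IH by simp
qed simp

lemma walk_distance: "i < j \<Longrightarrow> walk g h x i = walk g h x j \<Longrightarrow> even (j - i) \<and> walk g h x (j - i) = x"
proof -
  assume a: "i < j" "walk g h x i = walk g h x j"
  obtain d where d: "j - i = 2 * d \<or> j - i = 2 * d + 1" by (metis oddE evenE)
  have "j - i \<noteq> 2 * d + 1"
  proof
    assume "j - i = 2 * d + 1"
    then have "j = i + 2 * d + 1" using a by auto
    then show False using walk_odd_distance a by blast
  qed
  then have "j = i + 2 * d" "j - i = 2 * d" using d a by auto
  then show ?thesis using walk_even_distance[of i d] a by auto
qed

text \<open>By the two preceding facts the first repetition is a return to \<open>x\<close> at an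
  even time, hence through an \<open>h\<close>-step. The cycle is then closed under both maps, and
  connectedness makes it all of \<open>S\<close>.\<close>

lemma walk_cycle:
  assumes conn: "\<And>y. y \<in> S \<Longrightarrow> (x, y) \<in> (trail g h)\<^sup>*"
  obtains M where "0 < M" "walk g h x M = x" "inj_on (walk g h x) {..<M}" "walk g h x ` {..<M} = S"
    "walk g h x (M - 1) = h x"
proof -
  let ?w = "walk g h x"
  have "\<not> inj_on ?w UNIV"
    using fin walk_in finite_imageD[of ?w UNIV] finite_subset[of "range ?w" S] by auto
  then obtain i j where "i < j" "?w i = ?w j" by (metis inj_onI linorder_neqE_nat)
  then have ex: "\<exists>p. 0 < p \<and> ?w p = x" using walk_distance[of i j] by (intro exI[of _ "j - i"]) auto
  define M where "M = (LEAST p. 0 < p \<and> ?w p = x)"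
  have M: "0 < M" "?w M = x" using LeastI_ex[OF ex] unfolding M_def by auto
  have least: "\<not> (0 < p \<and> ?w p = x)" if "p < M" for p using not_less_Least that unfolding M_def by blast
  have even: "even M" using walk_distance[of 0 M] M by simp
  have inj: "inj_on ?w {..<M}"
  proof (rule linorder_inj_onI)
    fix i j assume ij: "i < j" "i \<in> {..<M}" "j \<in> {..<M}"
    show "?w i \<noteq> ?w j"
    proof
      assume "?w i = ?w j"
      moreover have "0 < j - i" "j - i < M" using ij by auto
      ultimately show False using walk_distance[of i j] least[of "j - i"] ij(1) by blast
    qed
  qed auto
  have hx: "?w (M - 1) = h x"
  proof -
    have "?w (M - 1) = (if even (M - 1) then g else h) (?w (Suc (M - 1)))" by (rule walk_back)
    then show ?thesis using M even by simp
  qed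
  have cl: "g y \<in> ?w ` {..<M} \<and> h y \<in> ?w ` {..<M}" if y: "y \<in> ?w ` {..<M}" for y
  proof -
    obtain i where i: "i < M" "y = ?w i" using y by auto
    have next_in: "?w (Suc i) \<in> ?w ` {..<M}"
    proof (cases "Suc i = M")
      case True
      then have "?w (Suc i) = ?w 0" using M by simp
      then show ?thesis using M(1) by blast
    next
      case False
      then have "Suc i \<in> {..<M}" using i by simp
      then show ?thesis by (rule imageI)
    qed
    have prev_in: "(if even i then h else g) y \<in> ?w ` {..<M}"
    proof (cases i)
      case 0
      then show ?thesis using hx i M by (auto intro: image_eqI[of _ _ "M - 1"])
    next
      case (Suc l)
      then show ?thesis using walk_back[of l] i by (auto intro!: image_eqI[of _ _ l])
    qed
    show ?thesis using next_in prev_in i by (auto split: if_splits)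
  qed
  have "y \<in> ?w ` {..<M}" if "(x, y) \<in> (trail g h)\<^sup>*" for y
    using that
  proof (induction rule: rtrancl_induct)
    case base
    show ?case using M by (auto intro: image_eqI[of _ _ 0])
  next
    case (step y z)
    then show ?case using cl unfolding trail_def by blast
  qed
  then have "?w ` {..<M} = S" using conn walk_in by auto
  then show thesis using that M inj hx by blast
qed

end

section \<open>A forest of codes and Gray codes on the bits\<close>

definition toggle :: "nat \<Rightarrow> nat set \<Rightarrow> nat set" where
  "toggle t C = (if t \<in> C then C - {t} else insert t C)"

lemma toggle_mem: "i \<in> toggle t C \<longleftrightarrow> (if i = t then t \<notin> C else i \<in> C)"
  unfolding toggle_def by auto

lemma toggle_toggle: "toggle t (toggle t C) = C"
  unfolding toggle_def by auto

lemma toggle_neq: "toggle t C \<noteq> C"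
  using toggle_mem[of t t C] by auto

text \<open>The map \<open>x \<mapsto> 2 * v - 1 - x\<close> exchanges \<open>v\<close> and
  \<open>v - 1\<close>, so one formula crosses an edge in both directions.\<close>

definition shift_code :: "(nat \<Rightarrow> nat) \<Rightarrow> nat \<Rightarrow> nat \<Rightarrow> nat \<Rightarrow> nat" where
  "shift_code a q v = a(q := 2 * v - 1 - a q)"

locale gray =
  fixes f m :: nat
  assumes f: "f \<le> 1" and m: "f + 2 \<le> m"
begin

text \<open>Fixing the entries beyond \<open>m\<close> gives each code a single representative and
  makes the set finite.\<close>

definition codes :: "(nat \<Rightarrow> nat) set" where
  "codes = {a. code f m a \<and> (\<forall>i>m. a i = 0)}"

definition states :: "((nat \<Rightarrow> nat) \<times> nat set) set" where
  "states = codes \<times> Pow {f..m}"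

text \<open>
  A tree edge joins the codes with entries \<open>v\<close> and \<open>v - 1\<close> at position \<open>q\<close>, where \<open>q\<close> is the first position
  of the former code at which the entry exceeds 1 and is not followed by an entry that is larger by 2.
  The edge with \<open>q = m\<close> and \<open>v = 3\<close> is left out: otherwise the code with last entry 2 and all
  others 1 would have two edges at position \<open>m\<close> with opposite demands on bit \<open>m\<close>.
\<close>

definition linear_below :: "(nat \<Rightarrow> nat) \<Rightarrow> nat \<Rightarrow> bool" where
  "linear_below a q \<longleftrightarrow> (\<forall>i. Suc i < q \<longrightarrow> a i \<le> 1 \<or> a (Suc i) = a i + 2)"

definition tree_edge :: "(nat \<Rightarrow> nat) \<Rightarrow> nat \<Rightarrow> nat \<Rightarrow> bool" where
  "tree_edge a q v \<longleftrightarrow> 1 \<le> q \<and> q \<le> m \<and> linear_below a q \<and> 2 \<le> v \<and> v \<le> a (q - 1) + 2 \<and>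
     (a (q - 1) \<le> 1 \<or> v = a (q - 1) + 2) \<and> (a q = v \<or> a q + 1 = v) \<and> (q < m \<longrightarrow> a (q + 1) \<le> v + 1) \<and>
     \<not> (q = m \<and> v = 3)"

text \<open>
  Crossing a tree edge at \<open>q\<close> with upper value \<open>v\<close> requires \<open>q \<in> C \<longleftrightarrow> odd v\<close> and \<open>q - 1 \<in> C \<longleftrightarrow> even v\<close>. The
  Gray code edge that is given up for it flips bit \<open>m\<close> if \<open>q < m\<close>, and bit \<open>f\<close> if \<open>q = m\<close>. The remaining bits
  are chosen such that different tree edges get different Gray code edges.
\<close>

definition mark0 :: "nat set \<Rightarrow> nat \<Rightarrow> nat \<Rightarrow> bool" where
  "mark0 C q v \<longleftrightarrow> q < m \<and> C - {m} = (if even v then {q - 1} \<inter> {f..} else {q, q + 1} \<inter> {..<m})"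

definition mark1 :: "nat set \<Rightarrow> nat \<Rightarrow> nat \<Rightarrow> bool" where
  "mark1 C q v \<longleftrightarrow> q = m \<and> C - {f} = (if even v then {m - 1} else {m})"

text \<open>
  The reflected Gray code on the bits \<open>m, f, f + 1, \<dots>, m - 1\<close>, from fast to slow, alternately flips
  bit \<open>m\<close> and the bit after the lowest one that is set. Bit \<open>m\<close> counts as set iff it agrees
  with the polarity, which is chosen such that the edges for \<open>q = m\<close> belong to the Gray code.
\<close>

definition polarity :: "(nat \<Rightarrow> nat) \<Rightarrow> bool" where
  "polarity a \<longleftrightarrow> a (m - 1) \<noteq> 1 \<and> odd (a (m - 1))"

definition lowest :: "nat set \<Rightarrow> nat" where
  "lowest C = (LEAST t. f \<le> t \<and> (t \<in> C \<or> t = m - 1))"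

definition gray_bit :: "(nat \<Rightarrow> nat) \<Rightarrow> nat set \<Rightarrow> nat" where
  "gray_bit a C = (if (m \<in> C) = polarity a then f else if lowest C < m - 1 then lowest C + 1 else m - 1)"

definition marked :: "bool \<Rightarrow> (nat \<Rightarrow> nat) \<Rightarrow> nat set \<Rightarrow> nat \<Rightarrow> nat \<Rightarrow> bool" where
  "marked b a C q v \<longleftrightarrow> tree_edge a q v \<and> (if b then mark1 C q v else mark0 C q v)"

definition step_bit :: "bool \<Rightarrow> (nat \<Rightarrow> nat) \<Rightarrow> nat set \<Rightarrow> nat" where
  "step_bit b a C = (if b then gray_bit a C else m)"

definition step :: "bool \<Rightarrow> (nat \<Rightarrow> nat) \<times> nat set \<Rightarrow> (nat \<Rightarrow> nat) \<times> nat set" where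
  "step b s = (case s of (a, C) \<Rightarrow>
     if \<exists>q v. marked b a C q v then
       (let (q, v) = (SOME (q, v). marked b a C q v) in (shift_code a q v, C))
     else (a, toggle (step_bit b a C) C))"

section \<open>The two kinds of steps are fixed-point-free involutions\<close>

lemma codes_ge1: "a \<in> codes \<Longrightarrow> 1 \<le> i \<Longrightarrow> i \<le> m \<Longrightarrow> 1 \<le> a i"
  unfolding codes_def code_def by (cases i) auto

lemma codes_le: "a \<in> codes \<Longrightarrow> 1 \<le> i \<Longrightarrow> i \<le> m \<Longrightarrow> a i \<le> a (i - 1) + 2"
  unfolding codes_def code_def by (cases i) auto

lemma codes_0: "a \<in> codes \<Longrightarrow> a 0 = 1 - f"
  unfolding codes_def code_def by auto

lemma finite_codes: "finite codes"
proof (rule finite_subset)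
  show "codes \<subseteq> {a. \<forall>i. (i \<in> {..m} \<longrightarrow> a i \<in> {..polygon_size f m}) \<and> (i \<notin> {..m} \<longrightarrow> a i = 0)}"
  proof (intro subsetI CollectI allI conjI impI)
    fix a i assume a: "a \<in> codes" and "i \<in> {..m}"
    then have i: "i \<le> m" by simp
    with a have "code f i a" using code_mono unfolding codes_def by blast
    then have "a i < polygon_size f i" using code_le f by fastforce
    also have "\<dots> \<le> polygon_size f m" using i unfolding polygon_size_def by simp
    finally show "a i \<in> {..polygon_size f m}" by simp
  next
    fix a i assume "a \<in> codes" "i \<notin> {..m}"
    then show "a i = 0" unfolding codes_def by simp
  qed
  show "finite {a. \<forall>i. (i \<in> {..m} \<longrightarrow> a i \<in> {..polygon_size f m}) \<and> (i \<notin> {..m} \<longrightarrow> a i = (0::nat))}"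
    by (rule finite_set_of_finite_funs) auto
qed

lemma finite_states: "finite states"
  unfolding states_def using finite_codes by simp

lemma tree_edge_values: "tree_edge a q v \<Longrightarrow> v = (if even (a q) = even v then a q else a q + 1)"
  unfolding tree_edge_def by auto

lemma mark0_unique:
  assumes "mark0 C q v" "mark0 C q' v'" "1 \<le> q" "1 \<le> q'"
  shows "q = q' \<and> even v = even v'"
proof -
  have q: "q < m" "q' < m" using assms(1,2) unfolding mark0_def by auto
  have eq: "(if even v then {q - 1} \<inter> {f..} else {q, q + 1} \<inter> {..<m}) =
      (if even v' then {q' - 1} \<inter> {f..} else {q', q' + 1} \<inter> {..<m})"
    using assms(1,2) unfolding mark0_def by simp
  \<comment> \<open>Here the bit \<open>q + 1\<close> in the marks for odd \<open>v\<close> is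
    needed: without it, such a mark at \<open>r\<close> would equal the mark for even
    \<open>v\<close> at \<open>r + 1\<close>.\<close>
  have mixed: False if "{p - 1} \<inter> {f..} = {r, r + 1} \<inter> {..<m}" "p < m" "r < m" "1 \<le> p" for p r
  proof -
    have "r \<in> {p - 1} \<inter> {f..}" using that by auto
    then have "p = r + 1" using that by auto
    then have "p \<in> {r, r + 1} \<inter> {..<m}" using that by auto
    then have "p \<in> {p - 1}" using that(1) by blast
    then show False using that(4) by simp
  qed
  show ?thesis
  proof (cases "even v"; cases "even v'")
    assume e: "even v" "even v'"
    then have i: "{q - 1} \<inter> {f..} = {q' - 1} \<inter> {f..}" using eq by simp
    have "q = q'"
    proof (cases "f \<le> q - 1 \<or> f \<le> q' - 1")
      case True
      then have "q - 1 \<in> {q' - 1} \<or> q' - 1 \<in> {q - 1}"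
        using i by (metis IntD1 IntI atLeast_iff singletonI)
      then show ?thesis using assms by auto
    next
      case False
      then show ?thesis using f assms(3,4) by auto
    qed
    then show ?thesis using e by simp
  next
    assume e: "odd v" "odd v'"
    then have i: "{q, q + 1} \<inter> {..<m} = {q', q' + 1} \<inter> {..<m}" using eq by simp
    have "q \<in> {q', q' + 1}" "q' \<in> {q, q + 1}" using i q by blast+
    then show ?thesis using e by auto
  next
    assume "even v" "odd v'"
    then show ?thesis using eq mixed[of q q'] q assms(3) by simp
  next
    assume "odd v" "even v'"
    then show ?thesis using eq mixed[of q' q] q assms(4) by simp
  qed
qed

lemma mark1_unique:
  assumes "mark1 C q v" "mark1 C q' v'"
  shows "q = q' \<and> even v = even v'"
proof -
  have "(if even v then {m - 1} else {m}) = (if even v' then {m - 1} else {m})"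
    using assms unfolding mark1_def by simp
  moreover have "{m - 1} \<noteq> {m}" using m by auto
  ultimately show ?thesis using assms unfolding mark1_def by (metis (full_types))
qed

text \<open>A mark determines the position and the parity of the upper value. This value is
  \<open>a q\<close> or \<open>a q + 1\<close>, so its parity fixes it. Hence the choice in
  \<open>step\<close> is no choice.\<close>

lemma marked_unique: "marked b a C q v \<Longrightarrow> marked b a C q' v' \<Longrightarrow> q = q' \<and> v = v'"
proof -
  assume mk: "marked b a C q v" "marked b a C q' v'"
  then have "q = q' \<and> even v = even v'"
    using mark0_unique[of C q v q' v'] mark1_unique[of C q v q' v'] unfolding marked_def tree_edge_def
    by (auto split: if_splits)
  then show ?thesis using mk tree_edge_values[of a q v] tree_edge_values[of a q' v'] unfolding marked_def by auto
qed

lemma step_marked: "marked b a C q v \<Longrightarrow> step b (a, C) = (shift_code a q v, C)"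
proof -
  assume mk: "marked b a C q v"
  have "(SOME (q, v). marked b a C q v) = (q, v)"
    using mk marked_unique by (intro some_equality) auto
  then show ?thesis using mk unfolding step_def by auto
qed

lemma step_unmarked: "(\<And>q v. \<not> marked b a C q v) \<Longrightarrow> step b (a, C) = (a, toggle (step_bit b a C) C)"
proof -
  assume n: "\<And>q v. \<not> marked b a C q v"
  then have "\<not> (\<exists>q v. marked b a C q v)" by blast
  then show ?thesis unfolding step_def by (simp only: prod.case if_False)
qed

lemma shift_code_values: "tree_edge a q v \<Longrightarrow>
    shift_code a q v = a(q := if a q = v then v - 1 else v) \<and> 2 \<le> v"
  unfolding shift_code_def tree_edge_def by auto

lemma shift_code_at:
  assumes "tree_edge a q v"
  shows "shift_code a q v q = (if a q = v then v - 1 else v)" "i \<noteq> q \<Longrightarrow> shift_code a q v i = a i"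
  using shift_code_values[OF assms] by simp_all

lemma tree_edge_shift:
  assumes t: "tree_edge a q v"
  shows "tree_edge (shift_code a q v) q v"
proof -
  let ?b = "shift_code a q v"
  note t' = t[unfolded tree_edge_def]
  have "linear_below ?b q" using t' shift_code_at(2)[OF t] unfolding linear_below_def by simp
  moreover have "?b (q - 1) = a (q - 1)" "?b (q + 1) = a (q + 1)"
    using t' shift_code_at(2)[OF t, of "q - 1"] shift_code_at(2)[OF t, of "q + 1"] by linarith+
  moreover have "?b q = v \<or> ?b q + 1 = v" using t' shift_code_at(1)[OF t] by auto
  ultimately show ?thesis using t' unfolding tree_edge_def by presburger
qed

lemma shift_code_shift_code:
  assumes t: "tree_edge a q v"
  shows "shift_code (shift_code a q v) q v = a"
proof
  fix i
  note u = tree_edge_shift[OF t]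
  have "a q = v \<or> a q + 1 = v" "2 \<le> v" using t unfolding tree_edge_def by auto
  then show "shift_code (shift_code a q v) q v i = a i"
    using shift_code_at[OF t] shift_code_at[OF u] by (cases "i = q") auto
qed

lemma shift_code_neq: "tree_edge a q v \<Longrightarrow> shift_code a q v \<noteq> a"
proof
  assume t: "tree_edge a q v" and e: "shift_code a q v = a"
  then have "(if a q = v then v - 1 else v) = a q" using shift_code_values[OF t] by (metis fun_upd_same)
  then show False using shift_code_values[OF t] t unfolding tree_edge_def by (auto split: if_splits)
qed

lemma shift_code_codes:
  assumes a: "a \<in> codes" and t: "tree_edge a q v"
  shows "shift_code a q v \<in> codes"
proof -
  let ?a = "shift_code a q v"
  have s: "?a = a(q := if a q = v then v - 1 else v)" "2 \<le> v" using shift_code_values[OF t] by auto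
  note t' = t[unfolded tree_edge_def]
  have "?a 0 = 1 - f" using codes_0[OF a] t' s by auto
  moreover have "1 \<le> ?a (Suc i) \<and> ?a (Suc i) \<le> ?a i + 2" if "i < m" for i
  proof -
    have "1 \<le> a (Suc i) \<and> a (Suc i) \<le> a i + 2" using that codes_ge1[OF a, of "Suc i"] codes_le[OF a, of "Suc i"] by simp
    then show ?thesis using t' s that by (cases "q = i"; cases "q = Suc i") auto
  qed
  moreover have "\<forall>i>m. ?a i = 0" using a t' s unfolding codes_def by auto
  ultimately show ?thesis unfolding codes_def code_def by blast
qed

text \<open>At position \<open>m\<close> the upper value is 2 or \<open>a (m - 1) + 2\<close>, so
  its parity depends on \<open>a (m - 1)\<close> only; \<open>polarity\<close> is this parity.
  Consequently \<open>gray_bit\<close> is \<open>f\<close> at these marks, and the edges to be given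
  up do belong to the Gray code. Both codes at the ends of such a tree edge share the entry at
  \<open>m - 1\<close> and therefore the polarity.\<close>

lemma mark1_polarity:
  assumes a: "a \<in> codes" and mk: "marked True a C q v"
  shows "(m \<in> C) = polarity a"
proof -
  have t: "tree_edge a m v" and C: "C - {f} = (if even v then {m - 1} else {m})"
    using mk unfolding marked_def mark1_def by auto
  have "m \<noteq> f" "m \<noteq> m - 1" using m by auto
  then have mC: "m \<in> C \<longleftrightarrow> odd v" using C by (metis Diff_iff insert_iff singletonD singletonI empty_iff)
  have a1: "1 \<le> a (m - 1)" using codes_ge1[OF a, of "m - 1"] m by simp
  show ?thesis
  proof (cases "a (m - 1) \<le> 1")
    case True
    then have "v = 2" using t unfolding tree_edge_def by auto
    then show ?thesis using mC a1 True unfolding polarity_def by auto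
  next
    case False
    then have "v = a (m - 1) + 2" using t unfolding tree_edge_def by auto
    then show ?thesis using mC False unfolding polarity_def by auto
  qed
qed

lemma lowest_props: "f \<le> lowest C" "lowest C \<le> m - 1" "lowest C \<in> C \<or> lowest C = m - 1"
  "\<And>t. f \<le> t \<Longrightarrow> t < lowest C \<Longrightarrow> t \<notin> C"
proof -
  have ex: "f \<le> m - 1 \<and> (m - 1 \<in> C \<or> m - 1 = m - 1)" using m by auto
  show "f \<le> lowest C" "lowest C \<in> C \<or> lowest C = m - 1"
    using LeastI[of "\<lambda>t. f \<le> t \<and> (t \<in> C \<or> t = m - 1)", OF ex] unfolding lowest_def by auto
  show "lowest C \<le> m - 1" unfolding lowest_def using ex by (rule Least_le)
  show "t \<notin> C" if "f \<le> t" "t < lowest C" for t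
    using not_less_Least[of t "\<lambda>t. f \<le> t \<and> (t \<in> C \<or> t = m - 1)"] that unfolding lowest_def by auto
qed

lemma lowest_eqI:
  assumes "f \<le> t" "t \<in> C \<or> t = m - 1" "\<And>i. f \<le> i \<Longrightarrow> i < t \<Longrightarrow> i \<notin> C" "t \<le> m - 1"
  shows "lowest C = t"
  unfolding lowest_def by (rule Least_equality) (use assms in \<open>force+\<close>)

lemma gray_bit_bounds: "f \<le> gray_bit a C" "gray_bit a C < m" "(m \<in> C) \<noteq> polarity a \<Longrightarrow> f < gray_bit a C"
  using lowest_props(1,2)[of C] m unfolding gray_bit_def by auto

text \<open>Flipping the bit after the lowest set one alters neither that bit nor bit
  \<open>m\<close>. Position \<open>m - 1\<close> counts as set in \<open>lowest\<close> in any
  case, so flipping it does no harm either.\<close>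

lemma gray_bit_toggle: "gray_bit a (toggle (gray_bit a C) C) = gray_bit a C"
proof -
  let ?t = "gray_bit a C" and ?C = "toggle (gray_bit a C) C"
  have mC: "m \<in> ?C \<longleftrightarrow> m \<in> C" using gray_bit_bounds[where a = a and C = C] by (simp add: toggle_mem)
  show ?thesis
  proof (cases "(m \<in> C) = polarity a")
    case True
    then show ?thesis using mC unfolding gray_bit_def by simp
  next
    case False
    have "lowest ?C = lowest C"
    proof (rule lowest_eqI)
      show "f \<le> lowest C" "lowest C \<le> m - 1" by (rule lowest_props)+
      show "lowest C \<in> ?C \<or> lowest C = m - 1"
        using lowest_props(2,3)[of C] False unfolding gray_bit_def by (auto simp: toggle_mem)
      show "i \<notin> ?C" if "f \<le> i" "i < lowest C" for i
        using lowest_props(4)[OF that] that lowest_props(2)[of C] False unfolding gray_bit_def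
        by (auto simp: toggle_mem)
    qed
    moreover have "gray_bit a D = gray_bit a C" if "m \<in> D \<longleftrightarrow> m \<in> C" "lowest D = lowest C" for D
      using that unfolding gray_bit_def by simp
    ultimately show ?thesis using mC by blast
  qed
qed

lemma step_bit_bounds: "f \<le> step_bit b a C" "step_bit b a C \<le> m"
  using gray_bit_bounds[where a = a and C = C] m unfolding step_bit_def by auto

lemma step_bit_toggle: "step_bit b a (toggle (step_bit b a C) C) = step_bit b a C"
  unfolding step_bit_def using gray_bit_toggle by simp

text \<open>Marks sit on both ends of a Gray code edge: \<open>mark0\<close> ignores bit
  \<open>m\<close> and \<open>mark1\<close> ignores bit \<open>f\<close>, and these are the bits
  flipped by the respective kind of step. This makes the exchanged steps an involution
  again.\<close>

lemma marked_toggle: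
  assumes a: "a \<in> codes"
  shows "marked b a (toggle (step_bit b a C) C) q v \<longleftrightarrow> marked b a C q v"
proof -
  have *: "marked b a (toggle (step_bit b a C) C) q v" if mk: "marked b a C q v" for C
  proof (cases b)
    case False
    have "toggle m C - {m} = C - {m}" by (auto simp: toggle_mem)
    then show ?thesis using mk False unfolding marked_def mark0_def step_bit_def by simp
  next
    case True
    then have "(m \<in> C) = polarity a" using mark1_polarity[OF a] mk by simp
    then have "gray_bit a C = f" unfolding gray_bit_def by simp
    moreover have "toggle f C - {f} = C - {f}" by (auto simp: toggle_mem)
    ultimately show ?thesis using mk True unfolding marked_def mark1_def step_bit_def by auto
  qed
  show ?thesis
    using *[of C] *[of "toggle (step_bit b a C) C"] step_bit_toggle[of b a C] toggle_toggle by metis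
qed

lemma marked_shift: "marked b a C q v \<Longrightarrow> marked b (shift_code a q v) C q v"
  unfolding marked_def using tree_edge_shift by simp

lemma fpf_involution_step: "fpf_involution states (step b)"
  unfolding fpf_involution_def
proof
  fix s assume "s \<in> states"
  then obtain a C where s: "s = (a, C)" "a \<in> codes" "C \<subseteq> {f..m}" unfolding states_def by auto
  show "step b s \<in> states \<and> step b (step b s) = s \<and> step b s \<noteq> s"
  proof (cases "\<exists>q v. marked b a C q v")
    case True
    then obtain q v where mk: "marked b a C q v" by blast
    then have t: "tree_edge a q v" unfolding marked_def by blast
    show ?thesis
      using step_marked[OF mk] step_marked[OF marked_shift[OF mk]] s shift_code_codes[OF s(2) t]
        shift_code_neq[OF t] shift_code_shift_code[OF t] unfolding states_def by simp
  next
    case False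
    let ?C = "toggle (step_bit b a C) C"
    have "step b s = (a, ?C)" using step_unmarked False s by blast
    moreover have "step b (a, ?C) = (a, C)"
      using step_unmarked[of b a ?C] False marked_toggle[OF s(2)] step_bit_toggle toggle_toggle by metis
    moreover have "?C \<subseteq> {f..m}" using s step_bit_bounds[where b = b and a = a and C = C] unfolding toggle_def by auto
    moreover have "?C \<noteq> C" by (rule toggle_neq)
    ultimately show ?thesis using s unfolding states_def by auto
  qed
qed

section \<open>The two trees of the forest and their roots\<close>

definition parent :: "(nat \<Rightarrow> nat) \<Rightarrow> (nat \<Rightarrow> nat)" where
  "parent a = (if \<exists>q. tree_edge a q (a q) then
     (let q = (SOME q. tree_edge a q (a q)) in a(q := a q - 1)) else a)"

text \<open>It is the measure that bounds ascents by \<open>parent\<close>, and later gives the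
  program a cheap test for the starting code.\<close>

definition weight :: "(nat \<Rightarrow> nat) \<Rightarrow> nat" where
  "weight a = sum a {..m}"

text \<open>The values 1 and 3 give the two roots. The value 2 gives a child of the first root, the
  neighbour of the second root across the edge that is left out of the forest.\<close>

definition start_code :: "nat \<Rightarrow> nat \<Rightarrow> nat" where
  "start_code v i = (if i = 0 then 1 - f else if i < m then 1 else if i = m then v else 0)"

definition descendants :: "(nat \<Rightarrow> nat) \<Rightarrow> ((nat \<Rightarrow> nat) \<times> nat set) set" where
  "descendants r = {(a, C) \<in> states. \<exists>k. (parent ^^ k) a = r}"

text \<open>If \<open>q < q'\<close>, linearity below \<open>q'\<close> forces the entry after
  \<open>q\<close> to exceed \<open>a q\<close> by 2, whereas lowering \<open>a q\<close> needs
  \<open>a (q + 1) \<le> a q + 1\<close>.\<close>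

lemma tree_edge_down_unique:
  assumes "tree_edge a q (a q)" "tree_edge a q' (a q')"
  shows "q = q'"
proof -
  have False if t: "tree_edge a q (a q)" "tree_edge a q' (a q')" "q < q'" for q q'
  proof -
    note d = t(1)[unfolded tree_edge_def] and d' = t(2)[unfolded tree_edge_def]
    have "a (q + 1) \<le> a q + 1" "2 \<le> a q" using d d' t(3) by auto
    moreover have "a q \<le> 1 \<or> a (q + 1) = a q + 2"
    proof (cases "Suc q = q'")
      case True
      then show ?thesis using d' by auto
    next
      case False
      then have "Suc q < q'" using t(3) by simp
      then show ?thesis using d' unfolding linear_below_def by auto
    qed
    ultimately show False by auto
  qed
  then show ?thesis using assms by (metis linorder_neqE_nat)
qed

lemma parent_eq: "tree_edge a q (a q) \<Longrightarrow> parent a = a(q := a q - 1)"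
proof -
  assume t: "tree_edge a q (a q)"
  have "(SOME q. tree_edge a q (a q)) = q"
    by (rule some_equality[of "\<lambda>q. tree_edge a q (a q)"]) (use t tree_edge_down_unique in blast)+
  then show ?thesis using t unfolding parent_def by auto
qed

lemma parent_root: "(\<And>q. \<not> tree_edge a q (a q)) \<Longrightarrow> parent a = a"
  unfolding parent_def by simp

lemma shift_code_parent:
  assumes "tree_edge a q v"
  shows "a q = v \<Longrightarrow> shift_code a q v = parent a" "a q \<noteq> v \<Longrightarrow> parent (shift_code a q v) = a"
proof -
  show "shift_code a q v = parent a" if "a q = v"
    using parent_eq[of a q] shift_code_values[OF assms] assms that by simp
  show "parent (shift_code a q v) = a" if n: "a q \<noteq> v"
  proof -
    let ?b = "shift_code a q v"
    have b: "?b q = v" "tree_edge ?b q v" using n tree_edge_shift[OF assms] shift_code_at(1)[OF assms] by auto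
    then have "parent ?b = ?b(q := v - 1)" using parent_eq[of ?b q] by simp
    also have "\<dots> = shift_code ?b q v" using b shift_code_values[OF b(2)] by simp
    also have "\<dots> = a" using shift_code_shift_code[OF assms] .
    finally show ?thesis .
  qed
qed

lemma weight_parent: "tree_edge a q (a q) \<Longrightarrow> weight (parent a) < weight a"
proof -
  assume t: "tree_edge a q (a q)"
  then have q: "q \<le> m" "2 \<le> a q" unfolding tree_edge_def by auto
  have "sum (a(q := a q - 1)) {..m} < sum a {..m}"
    by (rule sum_strict_mono_ex1) (use q in auto)
  then show ?thesis using parent_eq[OF t] unfolding weight_def by simp
qed

lemma weight_parent_le: "weight (parent a) \<le> weight a"
  using weight_parent[of a] parent_root[of a] by (metis less_imp_le order_refl)

lemma weight_parent_pow: "weight ((parent ^^ k) a) \<le> weight a"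
  by (induction k) (use weight_parent_le order.trans in auto)

lemma parent_not_descendant: "tree_edge a q (a q) \<Longrightarrow> (parent ^^ k) (parent a) \<noteq> a"
  using weight_parent[of a q] weight_parent_pow[of k "parent a"] by auto

lemma parent_codes: "a \<in> codes \<Longrightarrow> parent a \<in> codes"
proof (cases "\<exists>q. tree_edge a q (a q)")
  case True
  assume a: "a \<in> codes"
  from True obtain q where t: "tree_edge a q (a q)" by blast
  then show ?thesis using shift_code_parent(1)[OF t] shift_code_codes[OF a t] by simp
qed (simp add: parent_def)

text \<open>The first position whose entry exceeds 1 and is not followed by an entry larger by 2
  exists because the last entry above 1 qualifies. It carries a downward edge unless it is the
  omitted case, position \<open>m\<close> with entry 3. In that case all earlier entries are 1: from
  an entry above 1, jumps by 2 would lead to at least 4 at position \<open>m\<close>.\<close>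

lemma tree_root:
  assumes a: "a \<in> codes" and n: "\<And>q. \<not> tree_edge a q (a q)"
  shows "a = start_code 1 \<or> a = start_code 3"
proof -
  have outside: "a i = 0" if "i > m" for i using a that unfolding codes_def by simp
  define P where "P j \<longleftrightarrow> j \<le> m \<and> 2 \<le> a j \<and> (j < m \<longrightarrow> a (j + 1) \<le> a j + 1)" for j
  show ?thesis
  proof (cases "\<exists>i\<le>m. 2 \<le> a i")
    case False
    have "a = start_code 1"
    proof
      fix i
      have "1 \<le> i \<Longrightarrow> i \<le> m \<Longrightarrow> a i = 1" using codes_ge1[OF a, of i] False by force
      then show "a i = start_code 1 i" using codes_0[OF a] outside[of i] unfolding start_code_def
        by (cases "i = 0") auto
    qed
    then show ?thesis ..
  next
    case True
    define I where "I = {i. i \<le> m \<and> 2 \<le> a i}"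
    have I: "finite I" "I \<noteq> {}" using True unfolding I_def by auto
    have mI: "Max I \<in> I" "\<And>i. i \<in> I \<Longrightarrow> i \<le> Max I" using Max_in[OF I] I by auto
    have "P (Max I)"
      unfolding P_def
    proof (intro conjI impI)
      assume lt: "Max I < m"
      have "Max I + 1 \<notin> I" using mI(2)[of "Max I + 1"] by auto
      then show "a (Max I + 1) \<le> a (Max I) + 1" using lt mI(1) unfolding I_def by auto
    qed (use mI in \<open>auto simp: I_def\<close>)
    then have Pj: "P (LEAST j. P j)" and least: "\<And>i. i < (LEAST j. P j) \<Longrightarrow> \<not> P i"
      by (auto intro: LeastI dest: not_less_Least)
    define j where "j = (LEAST j. P j)"
    have j: "j \<le> m" "2 \<le> a j" "j < m \<longrightarrow> a (j + 1) \<le> a j + 1" 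
    proof -
      have "P j" using Pj unfolding j_def .
      then show "j \<le> m" "2 \<le> a j" "j < m \<longrightarrow> a (j + 1) \<le> a j + 1" unfolding P_def by auto
    qed
    have below: "a i \<le> 1 \<or> a (Suc i) = a i + 2" if "i < j" for i
    proof -
      have "i < m" "\<not> P i" using that j least[of i] by (auto simp: j_def)
      then show ?thesis using codes_le[OF a, of "Suc i"] unfolding P_def by auto
    qed
    have j1: "1 \<le> j" using j(2) codes_0[OF a] by (cases j) auto
    have "tree_edge a j (a j) \<or> j = m \<and> a j = 3"
      using j j1 below below[of "j - 1"] codes_le[OF a j1 j(1)] unfolding tree_edge_def linear_below_def by auto
    then have jm: "j = m" "a m = 3" using n by auto
    have ones: "a i \<le> 1" if "i < m" for i
    proof (rule ccontr)
      assume "\<not> a i \<le> 1"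
      then have "2 \<le> a i" by simp
      have "2 \<le> a (i + d) \<and> (0 < d \<longrightarrow> 4 \<le> a (i + d))" if "i + d \<le> m" for d
        using that
      proof (induction d)
        case 0
        then show ?case using \<open>2 \<le> a i\<close> by simp
      next
        case (Suc d)
        then show ?case using below[of "i + d"] jm by auto
      qed
      from this[of "m - i"] show False using that jm by auto
    qed
    have "a = start_code 3"
    proof
      fix i
      have "1 \<le> i \<Longrightarrow> i < m \<Longrightarrow> a i = 1" using codes_ge1[OF a, of i] ones[of i] by force
      then show "a i = start_code 3 i" using codes_0[OF a] outside[of i] jm unfolding start_code_def
        by (cases "i = 0") auto
    qed
    then show ?thesis ..
  qed
qed

lemma ancestor_root:
  assumes "a \<in> codes"
  shows "\<exists>k. (parent ^^ k) a = start_code 1 \<or> (parent ^^ k) a = start_code 3"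
  using assms
proof (induction "weight a" arbitrary: a rule: less_induct)
  case less
  show ?case
  proof (cases "\<exists>q. tree_edge a q (a q)")
    case True
    then obtain q where "tree_edge a q (a q)" by blast
    then obtain k where "(parent ^^ k) (parent a) = start_code 1 \<or> (parent ^^ k) (parent a) = start_code 3"
      using less.hyps[OF weight_parent parent_codes[OF less.prems]] by blast
    then show ?thesis by (intro exI[of _ "Suc k"]) (simp add: funpow_swap1)
  next
    case False
    then show ?thesis using tree_root[OF less.prems] by (intro exI[of _ 0]) auto
  qed
qed

lemma start_code_no_edge: "\<not> tree_edge (start_code 1) q (start_code 1 q)" "\<not> tree_edge (start_code 3) q (start_code 3 q)"
  unfolding tree_edge_def start_code_def by auto

lemma parent_pow_start_code: "(parent ^^ k) (start_code 1) = start_code 1" "(parent ^^ k) (start_code 3) = start_code 3"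
  using parent_root[OF start_code_no_edge(1)] parent_root[OF start_code_no_edge(2)] by (induction k) simp_all

lemma start_code_codes: "1 \<le> v \<Longrightarrow> v \<le> 3 \<Longrightarrow> start_code v \<in> codes"
  using m f unfolding codes_def code_def start_code_def by auto

lemma start_code_neq: "start_code 1 \<noteq> start_code 3"
  using m by (auto simp: start_code_def fun_eq_iff)

lemma states_split: "states = descendants (start_code 1) \<union> descendants (start_code 3)"
  "descendants (start_code 1) \<inter> descendants (start_code 3) = {}"
proof -
  show "states = descendants (start_code 1) \<union> descendants (start_code 3)"
    using ancestor_root unfolding descendants_def states_def by blast
  show "descendants (start_code 1) \<inter> descendants (start_code 3) = {}"
  proof (rule ccontr)
    assume "\<not> ?thesis"
    then obtain a k l where kl: "(parent ^^ k) a = start_code 1" "(parent ^^ l) a = start_code 3"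
      unfolding descendants_def by blast
    have "(parent ^^ (k + l)) a = start_code 3" using kl parent_pow_start_code by (simp add: funpow_add)
    moreover have "(parent ^^ (k + l)) a = start_code 1"
      using kl parent_pow_start_code by (subst add.commute) (simp add: funpow_add)
    ultimately show False using start_code_neq by simp
  qed
qed

text \<open>A step stays in its hypercube, or goes to a child or to the parent. Only the move from
  \<open>r\<close> itself to its parent could leave the subtree, and the second assumption rules it
  out.\<close>

lemma descendants_step:
  assumes s: "(a, C) \<in> descendants r" and n: "\<not> (\<exists>q v. a = r \<and> a q = v \<and> marked b a C q v)"
  shows "step b (a, C) \<in> descendants r"
proof -
  from s have st: "(a, C) \<in> states" and ex: "\<exists>k. (parent ^^ k) a = r" unfolding descendants_def by auto
  have in_states: "step b (a, C) \<in> states" using fpf_involution_step st unfolding fpf_involution_def by blast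
  show ?thesis
  proof (cases "\<exists>q v. marked b a C q v")
    case False
    then have "step b (a, C) = (a, toggle (step_bit b a C) C)" using step_unmarked by blast
    then show ?thesis using in_states ex unfolding descendants_def by auto
  next
    case True
    then obtain q v where mk: "marked b a C q v" by blast
    then have t: "tree_edge a q v" unfolding marked_def by blast
    obtain k where k: "(parent ^^ k) a = r" using ex by blast
    have "\<exists>k. (parent ^^ k) (shift_code a q v) = r"
    proof (cases "a q = v")
      case True
      have "k \<noteq> 0"
      proof
        assume "k = 0"
        then have "a = r" using k by simp
        then show False using n mk True by blast
      qed
      then obtain l where "k = Suc l" using not0_implies_Suc by blast
      then have "(parent ^^ l) (parent a) = r" using k by (simp add: funpow_swap1)
      then show ?thesis using shift_code_parent(1)[OF t True] by auto
    next
      case False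
      have "(parent ^^ Suc k) (shift_code a q v) = r"
        using shift_code_parent(2)[OF t False] k by (simp add: funpow_swap1)
      then show ?thesis by blast
    qed
    then show ?thesis using in_states step_marked[OF mk] unfolding descendants_def by auto
  qed
qed

section \<open>Each tree carries a single alternating cycle\<close>

abbreviation connected :: "(nat \<Rightarrow> nat) \<times> nat set \<Rightarrow> (nat \<Rightarrow> nat) \<times> nat set \<Rightarrow> bool" where
  "connected s t \<equiv> (s, t) \<in> (trail (step False) (step True))\<^sup>*"

lemma connected_step: "connected s (step b s)"
proof -
  have "(s, step b s) \<in> trail (step False) (step True)" using trail_mem by (cases b) simp_all
  then show ?thesis ..
qed

lemma connected_trans: "connected s t \<Longrightarrow> connected t u \<Longrightarrow> connected s u"
  by (rule rtrancl_trans)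

lemma connected_step_back: "s \<in> states \<Longrightarrow> connected (step b s) s"
  using connected_step[of "step b s" b] fpf_involution_step[of b] unfolding fpf_involution_def by auto

text \<open>Over a fixed code, only the two ends of one Gray code edge carry a given mark. These are
  the two exits in the cut argument.\<close>

lemma marked_sets:
  assumes "marked b a C q v" "marked b a C' q v" and a: "a \<in> codes"
  shows "C' = C \<or> C' = toggle (step_bit b a C) C"
proof (cases b)
  case False
  then have "C - {m} = C' - {m}" "step_bit b a C = m" using assms unfolding marked_def mark0_def step_bit_def by auto
  then show ?thesis by (auto simp: toggle_def)
next
  case True
  then have "C - {f} = C' - {f}" using assms unfolding marked_def mark1_def by auto
  moreover have "step_bit b a C = f"
    using mark1_polarity[OF a, of C q v] assms(1) True unfolding step_bit_def gray_bit_def by simp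
  ultimately show ?thesis by (auto simp: toggle_def)
qed

text \<open>The Gray code edge at \<open>C\<close> is given up for the downward edge of
  \<open>a\<close>. The nodes over the subtree at \<open>a\<close> are closed under steps of the
  other kind, and steps of kind \<open>b\<close> leave them only at the two ends of this edge. So
  \<open>trail_across_cut\<close> joins the ends within the subtree, whatever exchanges are made
  further below.\<close>

lemma connected_toggle_child:
  assumes s: "(a, C) \<in> states" and mk: "marked b a C q v" and v: "a q = v"
  shows "connected (a, C) (a, toggle (step_bit b a C) C)"
proof -
  let ?X = "descendants a" and ?C = "toggle (step_bit b a C) C"
  have a: "a \<in> codes" using s unfolding states_def by blast
  have t: "tree_edge a q (a q)" using mk v unfolding marked_def by blast
  have X: "?X \<subseteq> states" "finite ?X"
    using finite_states finite_subset[of ?X states] unfolding descendants_def by blast+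
  have inX: "(a, D) \<in> ?X" if "(a, D) \<in> states" for D
  proof -
    have "(parent ^^ 0) a = a" by simp
    then show ?thesis using that unfolding descendants_def by blast
  qed
  \<comment> \<open>There is only one downward edge, and its position decides its kind:
    \<open>q < m\<close> for \<open>mark0\<close>, \<open>q = m\<close> for
    \<open>mark1\<close>.\<close>
  have "\<not> marked (\<not> b) a D q' (a q')" for D q'
  proof
    assume mk': "marked (\<not> b) a D q' (a q')"
    then have "q' = q" using tree_edge_down_unique[OF t] unfolding marked_def by blast
    then show False using mk mk' unfolding marked_def mark0_def mark1_def by (auto split: if_splits)
  qed
  then have h: "fpf_involution ?X (step (\<not> b))"
    using descendants_step[of _ _ a "\<not> b"] fpf_involution_step[of "\<not> b"] X(1) unfolding fpf_involution_def by fast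
  have "step b x \<in> ?X" if "x \<in> ?X" "x \<noteq> (a, C)" "x \<noteq> (a, ?C)" for x
  proof -
    obtain a' C' where x: "x = (a', C')" by (cases x)
    have "\<not> (\<exists>q v. a' = a \<and> a' q = v \<and> marked b a' C' q v)"
    proof
      assume "\<exists>q v. a' = a \<and> a' q = v \<and> marked b a' C' q v"
      then obtain q' where q': "a' = a" "marked b a C' q' (a q')" by blast
      then have "q' = q" using tree_edge_down_unique[OF t] unfolding marked_def by blast
      then show False using marked_sets[OF mk _ a, of C'] q' v x that by auto
    qed
    then show ?thesis using descendants_step that(1) x by blast
  qed
  moreover have "step b (a, C) \<notin> ?X"
  proof -
    have "step b (a, C) = (parent a, C)" using step_marked[OF mk] shift_code_parent(1)[OF t refl] v by simp
    then show ?thesis using parent_not_descendant[OF t] unfolding descendants_def by auto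
  qed
  moreover have "step b (step b x) = x \<and> step b x \<noteq> x" if "x \<in> ?X" for x
    using fpf_involution_step[of b] X(1) that unfolding fpf_involution_def by blast
  ultimately have "((a, C), (a, ?C)) \<in> (trail (step b) (step (\<not> b)))\<^sup>*"
    by (intro trail_across_cut[OF X(2) inX[OF s] h]) auto
  then show ?thesis using trail_commute[of "step True" "step False"] by (cases b) simp_all
qed

lemma states_toggle: "(a, C) \<in> states \<Longrightarrow> (a, toggle (step_bit b a C) C) \<in> states"
  using step_bit_bounds[where b = b and a = a and C = C] unfolding states_def toggle_def by auto

text \<open>A Gray code edge given up on the side of the parent is replaced by a detour: cross to
  the child, pass between the ends of the parallel edge there, and cross back.\<close>

lemma connected_toggle:
  assumes s: "(a, C) \<in> states"
  shows "connected (a, C) (a, toggle (step_bit b a C) C)"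
proof (cases "\<exists>q v. marked b a C q v")
  case False
  then show ?thesis using step_unmarked connected_step by metis
next
  case True
  let ?C = "toggle (step_bit b a C) C"
  from True obtain q v where mk: "marked b a C q v" by blast
  then have t: "tree_edge a q v" unfolding marked_def by blast
  have a: "a \<in> codes" using s unfolding states_def by blast
  show ?thesis
  proof (cases "a q = v")
    case True
    then show ?thesis using connected_toggle_child[OF s mk] by blast
  next
    case False
    let ?a = "shift_code a q v"
    have mk': "marked b ?a C q v" "?a q = v" using marked_shift[OF mk] shift_code_at(1)[OF t] False by auto
    have s': "(?a, C) \<in> states" using s shift_code_codes[OF a t] unfolding states_def by auto
    have a': "?a \<in> codes" using s' unfolding states_def by blast
    have bit: "step_bit b ?a C = step_bit b a C"
    proof (cases b)
      case b: True
      then have "step_bit b a C = f" "step_bit b ?a C = f"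
        using mark1_polarity[OF a, of C q v] mark1_polarity[OF a', of C q v] mk mk'
        unfolding step_bit_def gray_bit_def by auto
      then show ?thesis by simp
    qed (simp add: step_bit_def)
    have 1: "connected (a, C) (?a, C)" using step_marked[OF mk] connected_step by metis
    have 2: "connected (?a, C) (?a, ?C)" using connected_toggle_child[OF s' mk'] bit by simp
    have "marked b a ?C q v" using marked_toggle[OF a] mk by blast
    then have "step b (a, ?C) = (?a, ?C)" by (rule step_marked)
    then have 3: "connected (?a, ?C) (a, ?C)" using connected_step_back[OF states_toggle[OF s]] by metis
    show ?thesis using 1 2 3 connected_trans by blast
  qed
qed

lemma connected_cube_aux:
  assumes a: "a \<in> codes"
  shows "f \<le> t \<Longrightarrow> t \<le> m \<Longrightarrow> C \<subseteq> {f..m} \<Longrightarrow> C' \<subseteq> {f..m} \<Longrightarrow> C \<inter> {t..<m} = C' \<inter> {t..<m} \<Longrightarrow>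
    connected (a, C) (a, C')"
proof (induction t arbitrary: C C' rule: dec_induct)
  case base
  have "C' = C \<or> C' = toggle m C"
  proof -
    have "i \<in> C \<longleftrightarrow> i \<in> C'" if "i \<noteq> m" for i
      using base that by (cases "f \<le> i \<and> i < m") auto
    then have "C - {m} = C' - {m}" by auto
    then show ?thesis by (auto simp: toggle_def)
  qed
  moreover have "connected (a, C) (a, toggle m C)"
    using connected_toggle[of a C False] a base unfolding states_def step_bit_def by auto
  ultimately show ?case by auto
next
  case (step t)
  show ?case
  proof (cases "t \<in> C \<longleftrightarrow> t \<in> C'")
    case True
    have "C \<inter> {t..<m} = C' \<inter> {t..<m}"
    proof -
      have "{t..<m} = insert t {Suc t..<m}" using step by auto
      then show ?thesis using step.prems(4) True by auto
    qed
    then show ?thesis using step by auto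
  next
    case False
    \<comment> \<open>The set \<open>D\<close> agrees with \<open>C\<close> from \<open>t\<close>
      on, its lowest set bit is \<open>t - 1\<close> unless \<open>t = f\<close>, and bit
      \<open>m\<close> is chosen such that the Gray code flips \<open>t\<close> next. The induction
      hypothesis reaches \<open>D\<close> from \<open>C\<close>, and \<open>C'\<close> from
      \<open>D\<close> after the flip.\<close>
    define D where "D = (C \<inter> {t..<m}) \<union> (if t = f then {} else {t - 1}) \<union>
      (if polarity a = (t = f) then {m} else {})"
    have t: "f \<le> t" "t < m" using step by auto
    have mD: "m \<in> D \<longleftrightarrow> (polarity a = (t = f))" using t unfolding D_def by auto
    have bit: "gray_bit a D = t"
    proof (cases "t = f")
      case True
      then show ?thesis using mD unfolding gray_bit_def by simp
    next
      case False
      have "lowest D = t - 1"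
        by (rule lowest_eqI) (use False t in \<open>auto simp: D_def\<close>)
      then show ?thesis using mD False t unfolding gray_bit_def by auto
    qed
    have D: "D \<subseteq> {f..m}" using step.prems t unfolding D_def by (auto split: if_splits)
    have "D \<inter> {t..<m} = C \<inter> {t..<m}" using t unfolding D_def by auto
    then have 1: "connected (a, C) (a, D)" using step D by auto
    have "(a, D) \<in> states" using a D unfolding states_def by simp
    then have 2: "connected (a, D) (a, toggle t D)"
      using connected_toggle[of a D True] bit unfolding step_bit_def by simp
    have "toggle t D \<inter> {t..<m} = C' \<inter> {t..<m}"
    proof -
      have "i \<in> toggle t D \<longleftrightarrow> i \<in> C'" if "t \<le> i" "i < m" for i
      proof (cases "i = t")
        case True
        then show ?thesis using False t unfolding D_def by (auto simp: toggle_mem)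
      next
        case False
        then have "i \<in> {Suc t..<m}" using that by simp
        then have "i \<in> C \<longleftrightarrow> i \<in> C'" using step.prems(4) by (metis IntD1 IntI)
        then show ?thesis using False that t unfolding D_def by (auto simp: toggle_mem)
      qed
      then show ?thesis by auto
    qed
    moreover have "toggle t D \<subseteq> {f..m}" using D t unfolding toggle_def by auto
    ultimately have 3: "connected (a, toggle t D) (a, C')" using step by auto
    show ?thesis using 1 2 3 connected_trans by blast
  qed
qed

lemma connected_cube:
  "a \<in> codes \<Longrightarrow> C \<subseteq> {f..m} \<Longrightarrow> C' \<subseteq> {f..m} \<Longrightarrow> connected (a, C) (a, C')"
  by (rule connected_cube_aux[of _ m]) (use m in auto)

lemma marked_exists:
  assumes "tree_edge a q v"
  obtains b C where "C \<subseteq> {f..m}" "marked b a C q v"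
proof (cases "q = m")
  case True
  let ?C = "if even v then {m - 1} else {m}"
  have "?C \<subseteq> {f..m}" "?C - {f} = ?C" using m by auto
  then show thesis using that[of ?C True] True assms unfolding marked_def mark1_def by auto
next
  case False
  have q: "1 \<le> q" "q < m" using assms False unfolding tree_edge_def by auto
  let ?C = "if even v then {q - 1} \<inter> {f..} else {q, q + 1} \<inter> {..<m}"
  have "?C \<subseteq> {f..m}" "?C - {m} = ?C" using q f by auto
  then show thesis using that[of ?C False] q assms unfolding marked_def mark0_def by auto
qed

text \<open>Each forest edge is marked at some node. Since hypercubes are connected, one can go to
  that node, cross, and go on to any node over the parent.\<close>

lemma connected_parent:
  assumes "a \<in> codes" "C \<subseteq> {f..m}" "C' \<subseteq> {f..m}"
  shows "connected (a, C) (parent a, C') \<and> connected (parent a, C') (a, C)"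
proof (cases "\<exists>q. tree_edge a q (a q)")
  case True
  then obtain q where t: "tree_edge a q (a q)" by blast
  obtain b D where D: "D \<subseteq> {f..m}" "marked b a D q (a q)" by (rule marked_exists[OF t])
  have "step b (a, D) = (parent a, D)" using step_marked[OF D(2)] shift_code_parent(1)[OF t refl] by simp
  then have "connected (a, D) (parent a, D)" "connected (parent a, D) (a, D)"
    using connected_step[of "(a, D)" b] connected_step_back[of "(a, D)" b] assms D unfolding states_def by auto
  moreover have "connected (a, C) (a, D)" "connected (a, D) (a, C)"
    "connected (parent a, D) (parent a, C')" "connected (parent a, C') (parent a, D)"
    using connected_cube assms D(1) parent_codes[OF assms(1)] by simp_all
  ultimately show ?thesis using connected_trans by blast
next
  case False
  then show ?thesis using connected_cube assms parent_root by metis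
qed

lemma connected_root:
  assumes "(a, C) \<in> states" "(parent ^^ k) a = r" "C' \<subseteq> {f..m}"
  shows "connected (a, C) (r, C') \<and> connected (r, C') (a, C)"
  using assms
proof (induction k arbitrary: a C)
  case 0
  then show ?case using connected_cube unfolding states_def by auto
next
  case (Suc k)
  have a: "a \<in> codes" "C \<subseteq> {f..m}" using Suc.prems unfolding states_def by auto
  have "(parent a, C) \<in> states" using a parent_codes unfolding states_def by simp
  moreover have "(parent ^^ k) (parent a) = r" using Suc.prems by (simp add: funpow_swap1)
  ultimately have "connected (parent a, C) (r, C') \<and> connected (r, C') (parent a, C)"
    using Suc.IH Suc.prems by blast
  then show ?case using connected_parent[OF a a(2)] connected_trans by blast
qed

lemma fpf_involution_descendants: "r = start_code 1 \<or> r = start_code 3 \<Longrightarrow> fpf_involution (descendants r) (step b)"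
proof -
  assume r: "r = start_code 1 \<or> r = start_code 3"
  have "\<not> (\<exists>q v. a = r \<and> a q = v \<and> marked b a C q v)" for a C
    using r start_code_no_edge unfolding marked_def by blast
  then have "step b s \<in> descendants r" if "s \<in> descendants r" for s
    using descendants_step[of "fst s" "snd s" r b] that by simp
  moreover have "descendants r \<subseteq> states" unfolding descendants_def by blast
  ultimately show ?thesis using fpf_involution_step[of b] unfolding fpf_involution_def by blast
qed

lemma gray_cycle:
  assumes r: "r = start_code 1 \<or> r = start_code 3" and s: "s \<in> descendants r"
  obtains M where "0 < M" "walk (step False) (step True) s M = s"
    "inj_on (walk (step False) (step True) s) {..<M}"
    "walk (step False) (step True) s ` {..<M} = descendants r"
    "walk (step False) (step True) s (M - 1) = step True s"
proof -
  interpret two_involutions "descendants r" "step False" "step True" s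
  proof
    show "finite (descendants r)"
      using finite_states finite_subset[of "descendants r" states] unfolding descendants_def by auto
  qed (use fpf_involution_descendants[OF r] s in auto)
  have "connected s y" if y: "y \<in> descendants r" for y
  proof -
    obtain a C k b D l where s': "s = (a, C)" "(a, C) \<in> states" "(parent ^^ k) a = r"
      and y': "y = (b, D)" "(b, D) \<in> states" "(parent ^^ l) b = r"
      using s y unfolding descendants_def by blast
    have "connected s (r, {})" "connected (r, {}) y"
      using connected_root[OF s'(2,3), of "{}"] connected_root[OF y'(2,3), of "{}"] s'(1) y'(1) by simp_all
    then show ?thesis using connected_trans by blast
  qed
  then show thesis using walk_cycle that by blast
qed

text \<open>The marks contain the bit conditions of \<open>flip_decode_code\<close>: the bits
  \<open>q\<close> and \<open>q - 1\<close> differ from the ignored bit, which is \<open>m\<close>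
  if \<open>q < m\<close> and \<open>f < m - 1\<close> if \<open>q = m\<close>. A move towards the
  larger entry is the reverse of such a flip.\<close>

lemma step_flip:
  assumes "(a, C) \<in> states" "step b (a, C) = (a', C')"
  shows "flip (polygon_size f m) (decode f a C m) (decode f a' C' m)"
proof (cases "\<exists>q v. marked b a C q v")
  case False
  then have e: "a' = a" "C' = toggle (step_bit b a C) C" using step_unmarked[of b a C] assms(2) by auto
  show ?thesis unfolding e
    by (rule flip_decode_color[OF f, of m a "step_bit b a C"])
      (use assms(1) step_bit_bounds in \<open>auto simp: states_def codes_def toggle_mem\<close>)
next
  case True
  then obtain q v where mk: "marked b a C q v" by blast
  then have t: "tree_edge a q v" unfolding marked_def by blast
  have e: "a' = shift_code a q v" "C' = C" using step_marked[OF mk] assms(2) by auto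
  have a: "a \<in> codes" using assms(1) unfolding states_def by blast
  have C: "q \<in> C \<longleftrightarrow> odd v" "q = f \<or> (q - 1 \<in> C \<longleftrightarrow> even v)"
  proof -
    have q: "1 \<le> q" "q \<le> m" using t unfolding tree_edge_def by auto
    have "(q \<in> C \<longleftrightarrow> odd v) \<and> (q = f \<or> (q - 1 \<in> C \<longleftrightarrow> even v))"
    proof (cases b)
      case True
      then have "q = m" "C - {f} = (if even v then {m - 1} else {m})"
        using mk unfolding marked_def mark1_def by auto
      moreover have "m \<noteq> f" "m - 1 \<noteq> f" "m - 1 \<noteq> m" using m by auto
      ultimately show ?thesis by (metis Diff_iff insert_iff empty_iff)
    next
      case False
      then have C: "q < m" "C - {m} = (if even v then {q - 1} \<inter> {f..} else {q, q + 1} \<inter> {..<m})"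
        using mk unfolding marked_def mark0_def by auto
      have "q \<in> C \<longleftrightarrow> q \<in> C - {m}" "q - 1 \<in> C \<longleftrightarrow> q - 1 \<in> C - {m}" using C(1) by auto
      then show ?thesis unfolding C(2) using q f C(1) by auto
    qed
    then show "q \<in> C \<longleftrightarrow> odd v" "q = f \<or> (q - 1 \<in> C \<longleftrightarrow> even v)" by auto
  qed
  have main: "flip (polygon_size f m) (decode f b C m) (decode f b' C m)"
    if "tree_edge b q v" "b q = v" "b' = shift_code b q v" "b \<in> codes" for b b'
  proof (rule flip_decode_code[OF f])
    show "code f m b" "code f m b'" using that shift_code_codes[OF that(4,1)] unfolding codes_def by auto
    show "b' q = v - 1" "\<And>i. i \<noteq> q \<Longrightarrow> b' i = b i" using that shift_code_at[OF that(1)] by auto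
    show "1 \<le> q" "q \<le> m" "b (q - 1) < v" using that(1) unfolding tree_edge_def by auto
  qed (use that C in auto)
  show ?thesis
  proof (cases "a q = v")
    case True
    then show ?thesis using main[OF t True e(1) a] e by simp
  next
    case False
    let ?a = "shift_code a q v"
    have c: "?a \<in> codes" using shift_code_codes[OF a t] .
    have "flip (polygon_size f m) (decode f ?a C m) (decode f a C m)"
      using main[of ?a a] tree_edge_shift[OF t] shift_code_at(1)[OF t] False
        shift_code_shift_code[OF t] c by simp
    then show ?thesis
      using flip_sym decode_triangulation(1)[OF f] a c e unfolding codes_def by auto
  qed
qed

end

section \<open>Reasoning about programs\<close>

definition runs :: "nat \<Rightarrow> com \<Rightarrow> store \<Rightarrow> nat \<Rightarrow> (store \<Rightarrow> bool) \<Rightarrow> bool" where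
  "runs W c s T Q \<longleftrightarrow> (\<exists>s' t. exec W c s s' [] t \<and> t \<le> T \<and> Q s')"

text \<open>Commands without loops and output are run by a function, so that simplification computes
  their effect. Their cost bound adds up both branches of a conditional, which makes it independent
  of the store.\<close>

primrec basic :: "com \<Rightarrow> bool" where
  "basic (Write a i e) = True"
| "basic (Seq c d) = (basic c \<and> basic d)"
| "basic (If e c d) = (basic c \<and> basic d)"
| "basic (While e c) = False"
| "basic Skip = True"
| "basic Visit = False"

fun basic_run :: "nat \<Rightarrow> com \<Rightarrow> store \<Rightarrow> store" where
  "basic_run W (Write a i e) s = s(a := (s a)(eval_expr W s i := eval_expr W s e))"
| "basic_run W (Seq c d) s = basic_run W d (basic_run W c s)"
| "basic_run W (If e c d) s = (if eval_expr W s e \<noteq> 0 then basic_run W c s else basic_run W d s)"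
| "basic_run W (While e c) s = s"
| "basic_run W Skip s = s"
| "basic_run W Visit s = s"

primrec basic_cost :: "com \<Rightarrow> nat" where
  "basic_cost (Write a i e) = expr_cost i + expr_cost e + 1"
| "basic_cost (Seq c d) = basic_cost c + basic_cost d"
| "basic_cost (If e c d) = expr_cost e + 1 + basic_cost c + basic_cost d"
| "basic_cost (While e c) = 0"
| "basic_cost Skip = 1"
| "basic_cost Visit = 0"

lemma runs_basic:
  assumes "basic c" "Q (basic_run W c s)"
  shows "runs W c s (basic_cost c) Q"
proof -
  have "\<exists>t\<le>basic_cost c. exec W c s (basic_run W c s) [] t" using assms(1)
  proof (induction c arbitrary: s)
    case (Write a i e)
    show ?case
      using exec.Write[of W a i e s]
      by (intro exI[of _ "expr_cost i + expr_cost e + 1"] conjI) (simp_all only: basic_cost.simps basic_run.simps order_refl)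
  next
    case (Seq c d)
    then obtain t t' where "t \<le> basic_cost c" "exec W c s (basic_run W c s) [] t"
      "t' \<le> basic_cost d" "exec W d (basic_run W c s) (basic_run W (Seq c d) s) [] t'" by fastforce
    then show ?case using exec.Seq[of W c s _ "[]" t d _ "[]" t'] by (intro exI[of _ "t + t'"]) auto
  next
    case (If e c d)
    show ?case
    proof (cases "eval_expr W s e = 0")
      case True
      obtain t where "t \<le> basic_cost d" "exec W d s (basic_run W d s) [] t" using If by fastforce
      then show ?thesis using exec.IfFalse[OF True, of d _ "[]" t c] True
        by (intro exI[of _ "expr_cost e + 1 + t"]) auto
    next
      case False
      obtain t where "t \<le> basic_cost c" "exec W c s (basic_run W c s) [] t" using If by fastforce
      then show ?thesis using exec.IfTrue[OF False, of c _ "[]" t d] False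
        by (intro exI[of _ "expr_cost e + 1 + t"]) auto
    qed
  next
    case Skip
    show ?case using exec.Skip by (intro exI[of _ 1]) auto
  qed auto
  then show ?thesis using assms(2) unfolding runs_def by blast
qed

lemma runs_Seq:
  assumes "runs W c s T (\<lambda>s'. runs W d s' T' Q)"
  shows "runs W (Seq c d) s (T + T') Q"
proof -
  obtain s' t s'' t' where "exec W c s s' [] t" "t \<le> T" "exec W d s' s'' [] t'" "t' \<le> T'" "Q s''"
    using assms unfolding runs_def by blast
  then show ?thesis using exec.Seq[of W c s s' "[]" t d s'' "[]" t'] unfolding runs_def
    by (intro exI[of _ s''] exI[of _ "t + t'"]) auto
qed

lemma runs_If:
  assumes "eval_expr W s e \<noteq> 0 \<Longrightarrow> runs W c s T Q" "eval_expr W s e = 0 \<Longrightarrow> runs W d s T' Q"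
  shows "runs W (If e c d) s (expr_cost e + 1 + T + T') Q"
proof (cases "eval_expr W s e = 0")
  case True
  then obtain s' t where "exec W d s s' [] t" "t \<le> T'" "Q s'" using assms unfolding runs_def by blast
  then show ?thesis using exec.IfFalse[OF True, of d s' "[]" t c] unfolding runs_def
    by (intro exI[of _ s'] exI[of _ "expr_cost e + 1 + t"]) auto
next
  case False
  then obtain s' t where "exec W c s s' [] t" "t \<le> T" "Q s'" using assms unfolding runs_def by blast
  then show ?thesis using exec.IfTrue[OF False, of c s' "[]" t d] unfolding runs_def
    by (intro exI[of _ s'] exI[of _ "expr_cost e + 1 + t"]) auto
qed

lemma runs_mono: "runs W c s T Q \<Longrightarrow> T \<le> T' \<Longrightarrow> (\<And>s'. Q s' \<Longrightarrow> Q' s') \<Longrightarrow> runs W c s T' Q'"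
  unfolding runs_def by (meson order.trans)

lemma runs_SeqI:
  "runs W c s T P \<Longrightarrow> (\<And>s'. P s' \<Longrightarrow> runs W d s' T' Q) \<Longrightarrow> runs W (Seq c d) s (T + T') Q"
  by (rule runs_Seq) (erule runs_mono, simp_all)

lemma runs_basicI: "basic c \<Longrightarrow> basic_cost c \<le> T \<Longrightarrow> Q (basic_run W c s) \<Longrightarrow> runs W c s T Q"
  by (rule runs_mono[OF runs_basic[of c Q]])

lemma runs_While:
  assumes "I 0 s"
    and step: "\<And>i s. i < n \<Longrightarrow> I i s \<Longrightarrow> eval_expr W s e \<noteq> 0 \<and> runs W c s T (I (Suc i))"
    and fin: "\<And>s. I n s \<Longrightarrow> eval_expr W s e = 0"
  shows "runs W (While e c) s (n * (expr_cost e + 1 + T) + expr_cost e + 1) (I n)"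
proof -
  have "runs W (While e c) s (k * (expr_cost e + 1 + T) + expr_cost e + 1) (I n)" if "I (n - k) s" "k \<le> n" for k s
    using that
  proof (induction k arbitrary: s)
    case 0
    then have z: "eval_expr W s e = 0" using fin by simp
    show ?case using exec.WhileFalse[OF z, of c] 0 unfolding runs_def by force
  next
    case (Suc k)
    have s: "eval_expr W s e \<noteq> 0" "runs W c s T (I (Suc (n - Suc k)))" using step[of "n - Suc k" s] Suc.prems by auto
    then obtain s' t where 1: "exec W c s s' [] t" "t \<le> T" "I (n - k) s'"
      using Suc.prems unfolding runs_def by (auto simp: Suc_diff_Suc)
    then obtain s'' t' where 2: "exec W (While e c) s' s'' [] t'" "t' \<le> k * (expr_cost e + 1 + T) + expr_cost e + 1" "I n s''"
      using Suc.IH[of s'] Suc.prems unfolding runs_def by auto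
    show ?case using exec.WhileTrue[OF s(1) 1(1) 2(1)] 1 2 unfolding runs_def
      by (intro exI[of _ s''] exI[of _ "expr_cost e + 1 + t + t'"]) auto
  qed
  from this[of n s] show ?thesis using assms(1) by simp
qed

text \<open>The body must leave the counter alone. The invariant for the next round refers to the
  store after the increment, hence the update in the assumption on the body. The limit is evaluated
  anew in every round, and \<open>hi < W\<close> keeps the counter from wrapping around.\<close>

lemma runs_for:
  assumes g: "eval_expr W s g = lo" and le: "lo \<le> hi" and W: "hi < W"
    and init: "J lo (s(x := (s x)(0 := lo)))"
    and step: "\<And>i s'. lo \<le> i \<Longrightarrow> i < hi \<Longrightarrow> J i s' \<Longrightarrow> s' x 0 = i \<Longrightarrow>
      runs W c s' T (\<lambda>s''. s'' x 0 = i \<and> J (Suc i) (s''(x := (s'' x)(0 := Suc i))))"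
    and e: "\<And>i s'. J i s' \<Longrightarrow> s' x 0 = i \<Longrightarrow> eval_expr W s' e = hi"
  shows "runs W (Seq (Write x (Const 0) g) (While (Less (Read x (Const 0)) e)
      (Seq c (Write x (Const 0) (Add (Read x (Const 0)) (Const 1)))))) s
    (expr_cost g + 2 + (hi - lo + 1) * (expr_cost e + T + 10)) (J hi)"
proof -
  let ?t = "Less (Read x (Const 0)) e" and ?i = "Write x (Const 0) (Add (Read x (Const 0)) (Const 1))"
  define I where "I k s' \<longleftrightarrow> J (lo + k) s' \<and> s' x 0 = lo + k" for k s'
  have "runs W (While ?t (Seq c ?i)) (s(x := (s x)(0 := lo)))
    ((hi - lo) * (expr_cost ?t + 1 + (T + 6)) + expr_cost ?t + 1) (I (hi - lo))"
  proof (rule runs_While)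
    show "I 0 (s(x := (s x)(0 := lo)))" using init unfolding I_def by simp
    show "eval_expr W s' ?t = 0" if "I (hi - lo) s'" for s' using that e[of "lo + (hi - lo)" s'] unfolding I_def by simp
    show "eval_expr W s' ?t \<noteq> 0 \<and> runs W (Seq c ?i) s' (T + 6) (I (Suc k))" if k: "k < hi - lo" "I k s'" for k s'
    proof
      have Jk: "J (lo + k) s'" "s' x 0 = lo + k" using k(2) unfolding I_def by auto
      show "eval_expr W s' ?t \<noteq> 0" using e[OF Jk] Jk k(1) by simp
      have "runs W c s' T (\<lambda>s''. s'' x 0 = lo + k \<and> J (Suc (lo + k)) (s''(x := (s'' x)(0 := Suc (lo + k)))))"
        using step[OF _ _ Jk] k(1) by simp
      then have "runs W c s' T (\<lambda>s''. runs W ?i s'' 6 (I (Suc k)))"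
      proof (rule runs_mono)
        fix s'' assume s'': "s'' x 0 = lo + k \<and> J (Suc (lo + k)) (s''(x := (s'' x)(0 := Suc (lo + k))))"
        have "Suc (lo + k) < W" "1 < W" using W k(1) by auto
        then have "basic_run W ?i s'' = s''(x := (s'' x)(0 := Suc (lo + k)))" using s'' by simp
        then have "I (Suc k) (basic_run W ?i s'')" using s'' unfolding I_def by simp
        then have "runs W ?i s'' (basic_cost ?i) (I (Suc k))" by (intro runs_basic) simp_all
        then show "runs W ?i s'' 6 (I (Suc k))" by (rule runs_mono) simp_all
      qed simp
      then show "runs W (Seq c ?i) s' (T + 6) (I (Suc k))" by (rule runs_Seq)
    qed
  qed
  then have "runs W (Write x (Const 0) g) s (expr_cost g + 2) (\<lambda>s'. runs W (While ?t (Seq c ?i)) s'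
    ((hi - lo) * (expr_cost ?t + 1 + (T + 6)) + expr_cost ?t + 1) (I (hi - lo)))"
    using runs_basic[of "Write x (Const 0) g" _ W s] g by simp
  then have "runs W (Seq (Write x (Const 0) g) (While ?t (Seq c ?i))) s
    (expr_cost g + 2 + ((hi - lo) * (expr_cost ?t + 1 + (T + 6)) + expr_cost ?t + 1)) (I (hi - lo))"
    by (rule runs_Seq)
  then show ?thesis
  proof (rule runs_mono)
    show "expr_cost g + 2 + ((hi - lo) * (expr_cost ?t + 1 + (T + 6)) + expr_cost ?t + 1)
      \<le> expr_cost g + 2 + (hi - lo + 1) * (expr_cost e + T + 10)"
      by (simp add: algebra_simps)
  qed (use le in \<open>simp add: I_def\<close>)
qed

lemma eval_Less: "eval_expr W s (Less e g) = of_bool (eval_expr W s e < eval_expr W s g)"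
  and eval_Equal: "eval_expr W s (Equal e g) = of_bool (eval_expr W s e = eval_expr W s g)"
  by simp_all

abbreviation var :: "nat \<Rightarrow> expr" where
  "var x \<equiv> Read x (Const 0)"

abbreviation assign :: "nat \<Rightarrow> expr \<Rightarrow> com" where
  "assign x e \<equiv> Write x (Const 0) e"

notation Seq (infixr ";;" 55)

text \<open>Truncated subtraction yields 1 only if neither operand is zero. The sum can be 2, so the
  word bound has to be at least 3.\<close>

definition And :: "expr \<Rightarrow> expr \<Rightarrow> expr" where
  "And x y = Sub (Const 1) (Add (Equal x (Const 0)) (Equal y (Const 0)))"

definition Or :: "expr \<Rightarrow> expr \<Rightarrow> expr" where
  "Or x y = Less (Const 0) (Add (Less (Const 0) x) (Less (Const 0) y))"

lemma eval_And: "3 \<le> W \<Longrightarrow> eval_expr W s (And x y) = of_bool (eval_expr W s x \<noteq> 0 \<and> eval_expr W s y \<noteq> 0)"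
  unfolding And_def by simp

lemma eval_Or: "3 \<le> W \<Longrightarrow> eval_expr W s (Or x y) = of_bool (eval_expr W s x \<noteq> 0 \<or> eval_expr W s y \<noteq> 0)"
  unfolding Or_def by simp

section \<open>Reconstruction of the adjacency matrix\<close>

text \<open>
  Array 1 is the adjacency matrix, 2 the code, 3 the set of bits, 4 the labels of the points of
  the shrunken polygon; 5 and 6 hold for each quadrilateral the matrix indices of its two diagonals.
  The scalars are 7, 8, 9: scratch; 10: parity of N; 11: last position; 12: number of bits that
  are set, without the last one; 13: kind of the next step; 14: polarity; 15, 16: the tree
  edge to be crossed, if any; 17: bit to be flipped; 18, 19, 23: search for the tree edge;
  20: continue; 21: last entry of the starting code; 22: weight of the code.
\<close>

abbreviation "r_N \<equiv> var 0"

definition clear_matrix :: com where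
  "clear_matrix = assign 7 (Const 0) ;;
     While (Less (var 7) (Add (Mul r_N r_N) (Const 1)))
       (Write 1 (var 7) (Const 0) ;; assign 7 (Add (var 7) (Const 1)))"

definition init_labels :: com where
  "init_labels = assign 7 (Const 0) ;;
     While (Less (var 7) (Add r_N (Const 1)))
       (Write 4 (var 7) (var 7) ;; assign 7 (Add (var 7) (Const 1)))"

text \<open>The labels are composed with \<open>skip\<close> in place. This works in ascending
  order, since each entry is replaced by one two places ahead that is still unchanged.\<close>

definition shift_labels :: com where
  "shift_labels = assign 7 (Add (var 9) (Const 1)) ;;
     While (Less (var 7) r_N)
       (Write 4 (var 7) (Read 4 (Add (var 7) (Const 2))) ;; assign 7 (Add (var 7) (Const 1)))"

definition draw_quad :: com where
  "draw_quad = assign 8 (Sub (var 8) (Const 1)) ;; assign 9 (Read 2 (var 8)) ;;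
     Write 1 (Add (Mul (Read 4 (var 9)) r_N) (Read 4 (Add (var 9) (Const 3)))) (Const 1) ;;
     Write 5 (var 8) (Add (Mul (Read 4 (var 9)) r_N) (Read 4 (Add (var 9) (Const 2)))) ;;
     Write 6 (var 8) (Add (Mul (Read 4 (Add (var 9) (Const 1))) r_N) (Read 4 (Add (var 9) (Const 3)))) ;;
     If (Equal (Read 3 (var 8)) (Sub (var 9) (Mul (Const 2) (Div (var 9) (Const 2)))))
       (Write 1 (Read 5 (var 8)) (Const 1)) (Write 1 (Read 6 (var 8)) (Const 1))"

text \<open>Going from the last ear backwards, the map from the shrunken polygon to the final labels
  changes by a single \<open>skip\<close> per ear. The loop stops at position \<open>f\<close>, as
  an initial triangle has no diagonal.\<close>

definition rebuild :: com where
  "rebuild = clear_matrix ;; init_labels ;; assign 8 (Add (var 11) (Const 1)) ;;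
     While (Less (var 10) (var 8)) (draw_quad ;; shift_labels)"

text \<open>\<open>label m a d\<close> maps the points of the polygon without the last \<open>d\<close> ears to their final labels.\<close>

primrec label :: "nat \<Rightarrow> (nat \<Rightarrow> nat) \<Rightarrow> nat \<Rightarrow> nat \<Rightarrow> nat" where
  "label m a 0 = id"
| "label m a (Suc d) = label m a d \<circ> skip (a (m - d))"

lemma strict_mono_label: "i < j \<Longrightarrow> label m a d i < label m a d j"
  by (induction d arbitrary: i j) (auto simp: strict_mono_skip)

lemma label_le: "label m a d i \<le> i + 2 * d"
proof (induction d arbitrary: i)
  case (Suc d)
  have "label m a (Suc d) i \<le> skip (a (m - d)) i + 2 * d" using Suc by simp
  also have "\<dots> \<le> i + 2 * Suc d" unfolding skip_def by simp
  finally show ?case .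
qed simp

lemma label_ge: "i \<le> label m a d i"
proof (induction d arbitrary: i)
  case (Suc d)
  have "i \<le> skip (a (m - d)) i" unfolding skip_def by simp
  also have "\<dots> \<le> label m a (Suc d) i" using Suc by simp
  finally show ?case .
qed simp

text \<open>This unrolls \<open>decode\<close> from the outside, in the order in which
  \<open>rebuild\<close> proceeds: an ear is drawn with the relabelling caused by the ears glued
  after it.\<close>

lemma decode_label:
  assumes "d \<le> m"
  shows "decode f a C m = (\<Union>j\<in>{m - d<..m}.
      {label m a (m - j) ` {a j, a j + 3}, label m a (m - j) ` cdiag (a j) (j \<in> C)}) \<union>
    (`) (label m a d) ` decode f a C (m - d)"
  using assms
proof (induction d)
  case 0
  have "(`) id ` decode f a C m = decode f a C m" by simp
  then show ?case by (simp only: label.simps) simp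
next
  case (Suc d)
  define j where "j = m - d"
  have j: "j = Suc (m - Suc d)" "m - j = d" "j \<le> m" using Suc.prems by (auto simp: j_def)
  have "(`) (label m a d) ` decode f a C j =
    {label m a d ` {a j, a j + 3}, label m a d ` cdiag (a j) (j \<in> C)} \<union>
      (`) (label m a d) ` (`) (skip (a j)) ` decode f a C (m - Suc d)"
    unfolding j(1) decode.simps ear_def by simp
  also have "(`) (label m a d) ` (`) (skip (a j)) ` decode f a C (m - Suc d) =
    (`) (label m a (Suc d)) ` decode f a C (m - Suc d)"
    unfolding label.simps j_def by (simp add: image_comp comp_def)
  finally have 1: "(`) (label m a d) ` decode f a C j =
    {label m a d ` {a j, a j + 3}, label m a d ` cdiag (a j) (j \<in> C)} \<union>
      (`) (label m a (Suc d)) ` decode f a C (m - Suc d)" .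
  have 2: "{m - Suc d<..m} = insert j {j<..m}" using j by auto
  show ?case
    unfolding Suc.IH[OF Suc_leD[OF Suc.prems]] j_def[symmetric] 1 2 UN_insert j(2)
    by (simp only: Un_assoc Un_left_commute Un_commute)
qed


section \<open>Word arithmetic, and matrix entries of the diagonals\<close>

locale machine = gray +
  fixes N W :: nat
  assumes N: "N = polygon_size f m" and W: "W = N ^ 3"
begin

lemma N_eq: "N + f = 2 * m + 4"
  using N f unfolding polygon_size_def by simp

lemma N_ge: "8 \<le> N"
  using N_eq f m by linarith

lemma N_le_NN: "8 * N \<le> N * N"
  using N_ge by simp

text \<open>Matrix indices reach \<open>N * N\<close>, and so may the weight. The word bound
  \<open>N ^ 3\<close> together with \<open>8 \<le> N\<close> leaves a constant factor of room, so
  that no computation of the program wraps around.\<close>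

lemma W_ge: "8 * (N * N) \<le> W"
  using N_ge unfolding W power3_eq_cube by simp

lemma mod_W: "x \<le> 4 * (N * N) \<Longrightarrow> x mod W = x"
  using W_ge N_le_NN N_ge by (intro mod_less) linarith

lemma W_gt: "512 \<le> W"
  using W_ge N_le_NN N_ge by linarith

lemma W_neq: "W \<noteq> Suc 0"
  using W_gt by simp

lemma mod_N: "x \<le> 8 * N \<Longrightarrow> x mod W = x"
  using mod_W[of x] N_le_NN by linarith

definition idx :: "nat \<Rightarrow> nat \<Rightarrow> nat" where
  "idx x y = x * N + y"

text \<open>Columns run from 1 to \<open>N\<close>; they are shifted by one before dividing, as
  column \<open>N\<close> would fall into the next row.\<close>

lemma idx_inject:
  assumes "idx x y = idx x' y'" "1 \<le> y" "y \<le> N" "1 \<le> y'" "y' \<le> N"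
  shows "x = x' \<and> y = y'"
proof -
  have "x * N + (y - 1) = x' * N + (y' - 1)" using assms unfolding idx_def by simp
  moreover have "(u * N + z) div N = u" if "z < N" for u z using that by simp
  moreover have "y - 1 < N" "y' - 1 < N" using assms by auto
  ultimately have "x = x'" by metis
  then show ?thesis using assms unfolding idx_def by simp
qed

lemma idx_le: "x < N \<Longrightarrow> y \<le> N \<Longrightarrow> idx x y \<le> N * N"
proof -
  assume "x < N" "y \<le> N"
  then have "x * N + y \<le> (N - 1) * N + N" by (intro add_mono mult_right_mono) auto
  also have "\<dots> = N * N" using N_ge by (metis One_nat_def Suc_pred add.commute mult_Suc not_gr_zero not_numeral_le_zero)
  finally show ?thesis unfolding idx_def .
qed

definition pt :: "(nat \<Rightarrow> nat) \<Rightarrow> nat \<Rightarrow> nat \<Rightarrow> nat" where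
  "pt a j i = label m a (m - j) (a j + i)"

definition base_idx :: "(nat \<Rightarrow> nat) \<Rightarrow> nat \<Rightarrow> nat" where
  "base_idx a j = idx (pt a j 0) (pt a j 3)"

definition diag1_idx :: "(nat \<Rightarrow> nat) \<Rightarrow> nat \<Rightarrow> nat" where
  "diag1_idx a j = idx (pt a j 0) (pt a j 2)"

definition diag2_idx :: "(nat \<Rightarrow> nat) \<Rightarrow> nat \<Rightarrow> nat" where
  "diag2_idx a j = idx (pt a j 1) (pt a j 3)"

definition diag_idx :: "(nat \<Rightarrow> nat) \<Rightarrow> nat set \<Rightarrow> nat \<Rightarrow> nat" where
  "diag_idx a C j = (if odd (a j) = (j \<in> C) then diag1_idx a j else diag2_idx a j)"

text \<open>For \<open>f = 0\<close>, position 0 contributes the outer side \<open>{1, N}\<close> as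
  its base. This spares the program a case distinction and is harmless, since only diagonals are
  read off the matrix.\<close>

definition indices :: "(nat \<Rightarrow> nat) \<Rightarrow> nat set \<Rightarrow> nat set" where
  "indices a C = (\<Union>j\<in>{f..m}. {base_idx a j, diag_idx a C j})"

lemma codes_polygon: "a \<in> codes \<Longrightarrow> j \<le> m \<Longrightarrow> a j + 3 \<le> polygon_size f j"
  using code_le[of f j a] code_mono[of f m a j] f unfolding codes_def by fastforce

lemma pt_bounds:
  assumes a: "a \<in> codes" and j: "f \<le> j" "j \<le> m"
  shows "1 \<le> pt a j 0" "pt a j 0 < pt a j 1" "pt a j 1 < pt a j 2" "pt a j 2 < pt a j 3" "pt a j 3 \<le> N"
proof -
  have "1 \<le> a j" using codes_ge1[OF a, of j] codes_0[OF a] j by (cases "j = 0") auto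
  then show "1 \<le> pt a j 0" unfolding pt_def using label_ge[of "a j + 0" m a "m - j"] by linarith
  have "pt a j 3 \<le> a j + 3 + 2 * (m - j)" unfolding pt_def by (rule label_le)
  also have "\<dots> \<le> polygon_size f j + 2 * (m - j)" using codes_polygon[OF a j(2)] by simp
  also have "\<dots> = N" using N f j unfolding polygon_size_def by simp
  finally show "pt a j 3 \<le> N" .
qed (simp_all add: pt_def strict_mono_label)

lemma label_first: "a \<in> codes \<Longrightarrow> d \<le> m \<Longrightarrow> label m a d 1 = 1"
proof (induction d)
  case (Suc d)
  then have "1 \<le> a (m - d)" using codes_ge1[of a "m - d"] by simp
  then show ?case using Suc by (simp add: skip_def)
qed simp

lemma label_last: "a \<in> codes \<Longrightarrow> d \<le> m \<Longrightarrow> label m a d (polygon_size f (m - d)) = N"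
proof (induction d)
  case (Suc d)
  have "m - d = Suc (m - Suc d)" using Suc.prems by simp
  then have e: "polygon_size f (m - d) = polygon_size f (m - Suc d) + 2" using polygon_size_Suc[OF f] by simp
  have "a (m - d) + 3 \<le> polygon_size f (m - d)" using codes_polygon[OF Suc.prems(1)] by simp
  then have "a (m - d) < polygon_size f (m - Suc d)" using e by simp
  then show ?case using Suc e by (simp add: skip_def)
qed (simp add: N)

lemma indices_decode:
  assumes a: "a \<in> codes" and xy: "x < y" "{x, y} \<in> diagonals N"
  shows "idx x y \<in> indices a C \<longleftrightarrow> {x, y} \<in> decode f a C m"
proof -
  let ?base = "\<lambda>j. label m a (m - j) ` {a j, a j + 3}" and ?cd = "\<lambda>j. label m a (m - j) ` cdiag (a j) (j \<in> C)"
  have d: "1 \<le> x" "y \<le> N" "\<not> (x = 1 \<and> y = N)" using xy by (auto simp: pair_in_diagonals)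
  have dec: "decode f a C m = (\<Union>j\<in>{0<..m}. {?base j, ?cd j}) \<union> (`) (label m a m) ` decode f a C 0"
    using decode_label[of m m f a C] by simp
  have "{x, y} \<in> decode f a C m \<longleftrightarrow> (\<exists>j\<in>{f..m}. {x, y} = ?base j \<or> {x, y} = ?cd j)"
  proof (cases "f = 0")
    case True
    have "a 0 = 1" using codes_0[OF a] True by simp
    then have "(`) (label m a m) ` decode f a C 0 = {?cd 0}" using True by simp
    moreover have "{x, y} \<noteq> ?base 0"
    proof
      assume "{x, y} = ?base 0"
      then have "{x, y} = {1, N}"
        using label_first[OF a, of m] label_last[OF a, of m] \<open>a 0 = 1\<close> True by (simp add: polygon_size_def)
      then show False using d xy by (auto simp: doubleton_eq_iff)
    qed
    moreover have "{f..m} = insert 0 {0<..m}" using True by auto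
    ultimately show ?thesis unfolding dec by auto
  next
    case False
    then have "{f..m} = {0<..m}" "decode f a C 0 = {}" using f by auto
    then show ?thesis unfolding dec by auto
  qed
  moreover have "idx x y = base_idx a j \<longleftrightarrow> {x, y} = ?base j" "idx x y = diag_idx a C j \<longleftrightarrow> {x, y} = ?cd j"
    if j: "j \<in> {f..m}" for j
  proof -
    note b = pt_bounds[OF a, of j]
    have eq: "idx x y = idx p q \<longleftrightarrow> {x, y} = {p, q}" if "p < q" "q \<le> N" for p q
    proof
      assume "idx x y = idx p q"
      then show "{x, y} = {p, q}" using idx_inject[of x y p q] that xy d by simp
    next
      assume "{x, y} = {p, q}"
      then have "x = p" "y = q" using that xy by (auto simp: doubleton_eq_iff)
      then show "idx x y = idx p q" by simp
    qed
    have "?base j = {pt a j 0, pt a j 3}" unfolding pt_def by simp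
    then show "idx x y = base_idx a j \<longleftrightarrow> {x, y} = ?base j"
      unfolding base_idx_def using eq[of "pt a j 0" "pt a j 3"] b j by simp
    have "?cd j = (if odd (a j) = (j \<in> C) then {pt a j 0, pt a j 2} else {pt a j 1, pt a j 3})"
      unfolding pt_def cdiag_def by simp
    then show "idx x y = diag_idx a C j \<longleftrightarrow> {x, y} = ?cd j"
      unfolding diag_idx_def diag1_idx_def diag2_idx_def
      using eq[of "pt a j 0" "pt a j 2"] eq[of "pt a j 1" "pt a j 3"] b j by simp
  qed
  ultimately show ?thesis unfolding indices_def by auto
qed

definition drawn :: "store \<Rightarrow> (nat \<Rightarrow> nat) \<Rightarrow> nat set \<Rightarrow> bool" where
  "drawn s a C \<longleftrightarrow> (\<forall>x\<le>N * N. s 1 x = of_bool (x \<in> indices a C)) \<and>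
     (\<forall>j. f \<le> j \<longrightarrow> j \<le> m \<longrightarrow> s 5 j = diag1_idx a j \<and> s 6 j = diag2_idx a j)"

lemma stored_triangulation_drawn:
  assumes a: "a \<in> codes" and s: "drawn s a C"
  shows "stored_triangulation N s = decode f a C m"
proof -
  have T: "triangulation N (decode f a C m)"
    using decode_triangulation(1)[OF f] a N unfolding codes_def by simp
  have key: "s 1 (x * N + y) \<noteq> 0 \<longleftrightarrow> {x, y} \<in> decode f a C m" if "x < y" "{x, y} \<in> diagonals N" for x y
  proof -
    have "x < N" "y \<le> N" using that by (auto simp: pair_in_diagonals)
    then have "s 1 (x * N + y) = of_bool (idx x y \<in> indices a C)"
      using s idx_le[of x y] unfolding drawn_def idx_def by auto
    then show ?thesis using indices_decode[OF a that] by simp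
  qed
  show ?thesis
  proof
    show "stored_triangulation N s \<subseteq> decode f a C m"
      unfolding stored_triangulation_def using key by auto
    show "decode f a C m \<subseteq> stored_triangulation N s"
    proof
      fix e assume e: "e \<in> decode f a C m"
      then have "e \<in> diagonals N" using triangulation_diagonals[OF T] by blast
      then obtain x y where "e = {x, y}" "x < y" by (rule diagonal_cases)
      then show "e \<in> stored_triangulation N s"
        unfolding stored_triangulation_def using key e \<open>e \<in> diagonals N\<close> by auto
    qed
  qed
qed

lemma diag_idx_neq:
  assumes "a \<in> codes" "f \<le> j" "j \<le> m"
  shows "diag1_idx a j \<noteq> diag2_idx a j"
  using pt_bounds[OF assms] idx_inject[of "pt a j 0" "pt a j 2" "pt a j 1" "pt a j 3"]
  unfolding diag1_idx_def diag2_idx_def by auto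

text \<open>The diagonal not chosen in a quadrilateral cannot be contributed by another one either,
  because it would cross the chosen diagonal.\<close>

lemma diag_indices:
  assumes a: "a \<in> codes" and j: "f \<le> j" "j \<le> m"
  shows "diag1_idx a j \<in> indices a C \<longleftrightarrow> odd (a j) = (j \<in> C)"
    "diag2_idx a j \<in> indices a C \<longleftrightarrow> odd (a j) \<noteq> (j \<in> C)"
proof -
  note b = pt_bounds[OF a j]
  have T: "triangulation N (decode f a C m)"
    using decode_triangulation(1)[OF f] a N unfolding codes_def by simp
  have "diag_idx a C j \<in> indices a C" using j unfolding indices_def by auto
  moreover have "\<not> (diag1_idx a j \<in> indices a C \<and> diag2_idx a j \<in> indices a C)"
  proof
    assume "diag1_idx a j \<in> indices a C \<and> diag2_idx a j \<in> indices a C"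
    moreover have lt: "pt a j 0 < pt a j 2" "pt a j 1 < pt a j 3" using b by linarith+
    moreover have "{pt a j 0, pt a j 2} \<in> diagonals N" "{pt a j 1, pt a j 3} \<in> diagonals N"
      unfolding pair_in_diagonals[OF lt(1)] pair_in_diagonals[OF lt(2)] using b by linarith+
    ultimately have "{pt a j 0, pt a j 2} \<in> decode f a C m" "{pt a j 1, pt a j 3} \<in> decode f a C m"
      using indices_decode[OF a lt(1)] indices_decode[OF a lt(2)] unfolding diag1_idx_def diag2_idx_def by simp_all
    then show False using triangulation_noncrossing[OF T _ _ b(2,3,4)] by simp
  qed
  ultimately show "diag1_idx a j \<in> indices a C \<longleftrightarrow> odd (a j) = (j \<in> C)"
    "diag2_idx a j \<in> indices a C \<longleftrightarrow> odd (a j) \<noteq> (j \<in> C)"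
    unfolding diag_idx_def by (auto split: if_splits)
qed

text \<open>This is why flipping a bit takes constant time: two matrix entries, whose places have
  been recorded, are complemented.\<close>

lemma indices_toggle:
  assumes a: "a \<in> codes" and t: "f \<le> t" "t \<le> m"
  shows "x \<in> indices a (toggle t C) \<longleftrightarrow>
    (if x = diag1_idx a t \<or> x = diag2_idx a t then x \<notin> indices a C else x \<in> indices a C)"
proof (cases "x = diag1_idx a t \<or> x = diag2_idx a t")
  case True
  have "t \<in> toggle t C \<longleftrightarrow> t \<notin> C" by (simp add: toggle_mem)
  then have "diag1_idx a t \<in> indices a (toggle t C) \<longleftrightarrow> diag1_idx a t \<notin> indices a C"
    "diag2_idx a t \<in> indices a (toggle t C) \<longleftrightarrow> diag2_idx a t \<notin> indices a C"
    unfolding diag_indices[OF a t] by auto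
  then show ?thesis using True by auto
next
  case False
  have "diag_idx a (toggle t C) j = diag_idx a C j" if "j \<noteq> t" for j
    using that unfolding diag_idx_def by (simp add: toggle_mem)
  moreover have "x \<noteq> diag_idx a D t" for D using False unfolding diag_idx_def by auto
  ultimately have "x \<in> {base_idx a j, diag_idx a (toggle t C) j} \<longleftrightarrow> x \<in> {base_idx a j, diag_idx a C j}" for j
    by (cases "j = t") auto
  then show ?thesis using False unfolding indices_def by auto
qed

section \<open>Correctness of the reconstruction\<close>

lemma runs_clear_matrix:
  assumes "s 0 0 = N"
  shows "runs W clear_matrix s (50 * (N * N)) (\<lambda>s'. (\<forall>x\<le>N * N. s' 1 x = 0) \<and> (\<forall>y. y \<notin> {1, 7} \<longrightarrow> s' y = s y))"
proof -
  define J where "J i s' \<longleftrightarrow> (\<forall>x<i. s' 1 x = 0) \<and> (\<forall>y. y \<notin> {1, 7} \<longrightarrow> s' y = s y)" for i and s' :: store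
  have N1: "64 \<le> N * N" using N_ge N_le_NN by linarith
  have "runs W clear_matrix s (expr_cost (Const 0) + 2 +
      (N * N + 1 - 0 + 1) * (expr_cost (Add (Mul r_N r_N) (Const 1)) + 4 + 10)) (J (N * N + 1))"
    unfolding clear_matrix_def
  proof (rule runs_for)
    show "runs W (Write 1 (var 7) (Const 0)) s' 4 (\<lambda>s''. s'' 7 0 = i \<and> J (Suc i) (s''(7 := (s'' 7)(0 := Suc i))))"
      if "0 \<le> i" "i < N * N + 1" "J i s'" "s' 7 0 = i" for i s'
      by (rule runs_basicI) (use that in \<open>auto simp: J_def less_Suc_eq\<close>)
    show "eval_expr W s' (Add (Mul r_N r_N) (Const 1)) = N * N + 1" if "J i s'" for i s'
    proof -
      have "(N * N) mod W = N * N" "(N * N + 1) mod W = N * N + 1" using N1 by (intro mod_W; linarith)+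
      then show ?thesis using that assms W_neq unfolding J_def by simp
    qed
    show "N * N + 1 < W" using W_ge N1 by linarith
  qed (auto simp: J_def)
  then show ?thesis
    by (rule runs_mono) (use N1 in \<open>auto simp: J_def\<close>)
qed

lemma runs_init_labels:
  assumes "s 0 0 = N"
  shows "runs W init_labels s (50 * N) (\<lambda>s'. (\<forall>x\<le>N. s' 4 x = x) \<and> (\<forall>y. y \<notin> {4, 7} \<longrightarrow> s' y = s y))"
proof -
  define J where "J i s' \<longleftrightarrow> (\<forall>x<i. s' 4 x = x) \<and> (\<forall>y. y \<notin> {4, 7} \<longrightarrow> s' y = s y)" for i and s' :: store
  have "runs W init_labels s (expr_cost (Const 0) + 2 +
      (N + 1 - 0 + 1) * (expr_cost (Add r_N (Const 1)) + 5 + 10)) (J (N + 1))"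
    unfolding init_labels_def
  proof (rule runs_for)
    show "runs W (Write 4 (var 7) (var 7)) s' 5 (\<lambda>s''. s'' 7 0 = i \<and> J (Suc i) (s''(7 := (s'' 7)(0 := Suc i))))"
      if "0 \<le> i" "i < N + 1" "J i s'" "s' 7 0 = i" for i s'
      by (rule runs_basicI) (use that in \<open>auto simp: J_def less_Suc_eq\<close>)
    show "eval_expr W s' (Add r_N (Const 1)) = N + 1" if "J i s'" for i s'
      using that assms N_ge unfolding J_def by (simp add: mod_N W_neq)
    show "N + 1 < W" using W_ge N_le_NN N_ge by linarith
  qed (auto simp: J_def)
  then show ?thesis
    by (rule runs_mono) (use N_ge in \<open>auto simp: J_def\<close>)
qed

lemma runs_shift_labels:
  assumes "s 0 0 = N" "s 9 0 = k" "k < N"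
  shows "runs W shift_labels s (50 * N) (\<lambda>s'. (\<forall>x<N. s' 4 x = s 4 (skip k x)) \<and> (\<forall>y. y \<notin> {4, 7} \<longrightarrow> s' y = s y))"
proof -
  define J where "J i s' \<longleftrightarrow> (\<forall>x<i. s' 4 x = s 4 (skip k x)) \<and> (\<forall>x\<ge>i. s' 4 x = s 4 x) \<and>
    (\<forall>y. y \<notin> {4, 7} \<longrightarrow> s' y = s y)" for i and s' :: store
  have "runs W shift_labels s (expr_cost (Add (var 9) (Const 1)) + 2 +
      (N - (k + 1) + 1) * (expr_cost r_N + 8 + 10)) (J N)"
    unfolding shift_labels_def
  proof (rule runs_for)
    show "eval_expr W s (Add (var 9) (Const 1)) = k + 1"
      using assms N_ge by (simp add: mod_N W_neq)
    show "runs W (Write 4 (var 7) (Read 4 (Add (var 7) (Const 2)))) s' 8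
        (\<lambda>s''. s'' 7 0 = i \<and> J (Suc i) (s''(7 := (s'' 7)(0 := Suc i))))"
      if i: "k + 1 \<le> i" "i < N" "J i s'" "s' 7 0 = i" for i s'
    proof (rule runs_basicI)
      have "skip k i = i + 2" "(i + 2) mod W = i + 2" "2 mod W = 2"
        using i N_ge W_gt by (auto simp: skip_def mod_N)
      then show "basic_run W (Write 4 (var 7) (Read 4 (Add (var 7) (Const 2)))) s' 7 0 = i \<and>
        J (Suc i) ((basic_run W (Write 4 (var 7) (Read 4 (Add (var 7) (Const 2)))) s')
          (7 := (basic_run W (Write 4 (var 7) (Read 4 (Add (var 7) (Const 2)))) s' 7)(0 := Suc i)))"
        using i by (auto simp: J_def less_Suc_eq)
    qed auto
    show "eval_expr W s' r_N = N" if "J i s'" for i s' using that assms unfolding J_def by simp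
    show "N < W" using W_ge N_le_NN N_ge by linarith
  qed (use assms in \<open>auto simp: J_def skip_def\<close>)
  then show ?thesis
  proof (rule runs_mono)
    have "(N - (k + 1) + 1) * (expr_cost r_N + 8 + 10) \<le> N * (expr_cost r_N + 8 + 10)"
      using assms by (intro mult_right_mono) auto
    then show "expr_cost (Add (var 9) (Const 1)) + 2 + (N - (k + 1) + 1) * (expr_cost r_N + 8 + 10) \<le> 50 * N"
      using N_ge by simp
  qed (auto simp: J_def)
qed

lemma parity_expr: "x - 2 * (x div 2) = of_bool (odd x)" for x :: nat
  by (simp add: minus_mult_div_eq_mod mod2_eq_if)

lemma basic_run_draw_quad:
  assumes s: "s 0 0 = N" "s 8 0 = Suc j" "s 2 j = k" "s 3 j = of_bool b" and jk: "j \<le> N" "k + 3 \<le> N"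
    and P: "s 4 k = P0" "s 4 (k + 1) = P1" "s 4 (k + 2) = P2" "s 4 (k + 3) = P3"
    and le: "P0 < N" "P1 < N" "P2 \<le> N" "P3 \<le> N"
  defines "s' \<equiv> basic_run W draw_quad s"
  shows "s' 8 0 = j" "s' 9 0 = k" "s' 5 = (s 5)(j := idx P0 P2)" "s' 6 = (s 6)(j := idx P1 P3)"
    "s' 1 = (s 1)(idx P0 P3 := 1, (if odd k = b then idx P0 P2 else idx P1 P3) := 1)"
    "y \<notin> {1, 5, 6, 8, 9} \<Longrightarrow> s' y = s y"
proof -
  have "idx P0 P3 \<le> N * N" "idx P0 P2 \<le> N * N" "idx P1 P3 \<le> N * N" using le by (auto intro: idx_le)
  then have "(P0 * N + P3) mod W = idx P0 P3" "(P0 * N + P2) mod W = idx P0 P2" "(P1 * N + P3) mod W = idx P1 P3"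
    "(P0 * N) mod W = P0 * N" "(P1 * N) mod W = P1 * N"
    unfolding idx_def by (intro mod_W; linarith)+
  note idx = this
  have small: "1 mod W = 1" "2 mod W = 2" "3 mod W = 3" "(k + 1) mod W = k + 1" "(k + 2) mod W = k + 2"
    "(k + 3) mod W = k + 3" "(2 * (k div 2)) mod W = 2 * (k div 2)"
    using jk N_ge by (intro mod_N; linarith)+
  define s1 s2 s3 s4 s5 s6 where "s1 = s(8 := (s 8)(0 := j))" and "s2 = s1(9 := (s1 9)(0 := k))"
    and "s3 = s2(1 := (s2 1)(idx P0 P3 := 1))" and "s4 = s3(5 := (s3 5)(j := idx P0 P2))"
    and "s5 = s4(6 := (s4 6)(j := idx P1 P3))"
    and "s6 = s5(1 := (s5 1)((if odd k = b then idx P0 P2 else idx P1 P3) := 1))"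
  note sd = s1_def s2_def s3_def s4_def s5_def
  have v: "eval_expr W t (Const c) = c" if "c \<le> 3" for t c using that N_ge by (simp add: mod_N)
  have r: "basic_run W (assign 8 (Sub (var 8) (Const 1))) s = s1"
    "basic_run W (assign 9 (Read 2 (var 8))) s1 = s2"
    using s by (simp_all add: sd v del: One_nat_def eval_expr.simps(1))
  have w: "s2 0 0 = N" "s2 9 0 = k" "s2 8 0 = j" "s2 4 = s 4" using s by (simp_all add: sd)
  have r3: "basic_run W (Write 1 (Add (Mul (Read 4 (var 9)) r_N) (Read 4 (Add (var 9) (Const 3)))) (Const 1)) s2 = s3"
    using w P small idx by (simp add: s3_def v del: One_nat_def eval_expr.simps(1))
  have w3: "s3 0 0 = N" "s3 9 0 = k" "s3 8 0 = j" "s3 4 = s 4" using w by (simp_all add: s3_def)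
  have r4: "basic_run W (Write 5 (var 8) (Add (Mul (Read 4 (var 9)) r_N) (Read 4 (Add (var 9) (Const 2))))) s3 = s4"
    using w3 P small idx by (simp add: s4_def v del: One_nat_def eval_expr.simps(1) add_2_eq_Suc')
  have w4: "s4 0 0 = N" "s4 9 0 = k" "s4 8 0 = j" "s4 4 = s 4" using w3 by (simp_all add: s4_def)
  have r5: "basic_run W (Write 6 (var 8) (Add (Mul (Read 4 (Add (var 9) (Const 1))) r_N) (Read 4 (Add (var 9) (Const 3))))) s4 = s5"
    using w4 P small idx by (simp add: s5_def v del: One_nat_def eval_expr.simps(1) add_Suc_right Suc_eq_plus1)
  have w5: "s5 9 0 = k" "s5 8 0 = j" "s5 3 j = of_bool b" "s5 5 j = idx P0 P2" "s5 6 j = idx P1 P3"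
    using w4 s by (simp_all add: sd)
  let ?t = "Equal (Read 3 (var 8)) (Sub (var 9) (Mul (Const 2) (Div (var 9) (Const 2))))"
  have "eval_expr W s5 ?t = of_bool (odd k = b)"
    using w5 small parity_expr[of k] by (simp add: v del: One_nat_def eval_expr.simps(1))
  then have r6: "basic_run W (If ?t (Write 1 (Read 5 (var 8)) (Const 1)) (Write 1 (Read 6 (var 8)) (Const 1))) s5 = s6"
    using w5 by (auto simp add: s6_def v simp del: One_nat_def eval_expr.simps(1))
  have "s' = s6" unfolding s'_def draw_quad_def basic_run.simps(2) r r3 r4 r5 r6 ..
  then show "s' 8 0 = j" "s' 9 0 = k" "s' 5 = (s 5)(j := idx P0 P2)" "s' 6 = (s 6)(j := idx P1 P3)"
    "s' 1 = (s 1)(idx P0 P3 := 1, (if odd k = b then idx P0 P2 else idx P1 P3) := 1)"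
    "y \<notin> {1, 5, 6, 8, 9} \<Longrightarrow> s' y = s y"
    by (simp_all add: s6_def sd)
qed

definition stored :: "store \<Rightarrow> (nat \<Rightarrow> nat) \<Rightarrow> nat set \<Rightarrow> bool" where
  "stored s a C \<longleftrightarrow> s 0 0 = N \<and> s 10 0 = f \<and> s 11 0 = m \<and> (\<forall>i\<le>m. s 2 i = a i) \<and> (\<forall>i\<le>m. s 3 i = of_bool (i \<in> C))"

lemma runs_rebuild:
  assumes a: "a \<in> codes" and st: "stored s a C"
  shows "runs W rebuild s (500 * (N * N)) (\<lambda>s'. drawn s' a C \<and> (\<forall>y. y \<notin> {1, 4, 5, 6, 7, 8, 9} \<longrightarrow> s' y = s y))"
proof -
  define P where "P d = (\<Union>j\<in>{m + 1 - d..m}. {base_idx a j, diag_idx a C j})" for d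
  \<comment> \<open>After \<open>d\<close> rounds the labels are claimed only for
    \<open>i \<le> N - 2 * d\<close>, the points of the polygon without the last \<open>d\<close>
    ears; entries beyond are left over from earlier rounds.\<close>
  define I where "I d s' \<longleftrightarrow> s' 8 0 = m + 1 - d \<and> (\<forall>x\<le>N * N. s' 1 x = of_bool (x \<in> P d)) \<and>
    (\<forall>i. i + 2 * d \<le> N \<longrightarrow> s' 4 i = label m a d i) \<and>
    (\<forall>j. m + 1 - d \<le> j \<longrightarrow> j \<le> m \<longrightarrow> s' 5 j = diag1_idx a j \<and> s' 6 j = diag2_idx a j) \<and>
    (\<forall>y. y \<notin> {1, 4, 5, 6, 7, 8, 9} \<longrightarrow> s' y = s y)" for d and s' :: store
  let ?e = "Less (var 10) (var 8)" and ?body = "draw_quad ;; shift_labels"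
  let ?T = "expr_cost ?e + 1 + (basic_cost draw_quad + 50 * N)"
  have st': "s 0 0 = N" "s 10 0 = f" "s 11 0 = m" "\<And>i. i \<le> m \<Longrightarrow> s 2 i = a i" "\<And>i. i \<le> m \<Longrightarrow> s 3 i = of_bool (i \<in> C)"
    using st unfolding stored_def by auto
  have loop: "runs W (While ?e ?body) s0 ((m + 1 - f) * ?T + expr_cost ?e + 1) (I (m + 1 - f))"
    if s0: "I 0 s0" for s0
  proof (rule runs_While)
    show "I 0 s0" by (rule s0)
    show "eval_expr W s' ?e = 0" if "I (m + 1 - f) s'" for s' using that st' m unfolding I_def by simp
    show "eval_expr W s' ?e \<noteq> 0 \<and> runs W ?body s' (basic_cost draw_quad + 50 * N) (I (Suc d))"
      if d: "d < m + 1 - f" "I d s'" for d s'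
    proof
      define j where "j = m - d"
      have j: "f \<le> j" "j \<le> m" "m - j = d" "m + 1 - d = Suc j" "m + 1 - Suc d = j" using d(1) by (auto simp: j_def)
      note I' = d(2)[unfolded I_def j(4)]
      have fr: "s' 0 0 = N" "s' 10 0 = f" "s' 2 j = a j" "s' 3 j = of_bool (j \<in> C)" "s' 8 0 = Suc j"
        using I' st' j(2) by auto
      show "eval_expr W s' ?e \<noteq> 0" using fr j by simp
      have k3: "a j + 3 + 2 * d \<le> N"
        using codes_polygon[OF a j(2)] N f j unfolding polygon_size_def by simp
      have pts: "s' 4 (a j) = pt a j 0" "s' 4 (a j + 1) = pt a j 1" "s' 4 (a j + 2) = pt a j 2" "s' 4 (a j + 3) = pt a j 3"
        using I' k3 j(3) unfolding pt_def by auto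
      note b = pt_bounds[OF a j(1,2)]
      have lt: "pt a j 0 < N" "pt a j 1 < N" "pt a j 2 \<le> N" "j \<le> N" "a j + 3 \<le> N" using b k3 N_eq f j(2) by auto
      let ?s = "basic_run W draw_quad s'"
      note r = basic_run_draw_quad[OF fr(1,5,3,4) lt(4,5) pts lt(1-3) b(5)]
      have frs: "?s y = s y" if "y \<notin> {1, 4, 5, 6, 7, 8, 9}" for y
        using r(6)[of y] that I' by auto
      have s4: "?s 4 = s' 4" using r(6)[of 4] by simp
      have s1: "?s 1 x = of_bool (x \<in> P (Suc d))" if "x \<le> N * N" for x
      proof -
        have "{m + 1 - Suc d..m} = insert j {m + 1 - d..m}" using j by auto
        then have "P (Suc d) = {base_idx a j, diag_idx a C j} \<union> P d" unfolding P_def by simp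
        moreover have "s' 1 x = of_bool (x \<in> P d)" using I' that by blast
        ultimately show ?thesis
          using r(5) unfolding base_idx_def diag_idx_def diag1_idx_def diag2_idx_def by auto
      qed
      have "runs W shift_labels ?s (50 * N) (\<lambda>s''. (\<forall>x<N. s'' 4 x = ?s 4 (skip (a j) x)) \<and>
          (\<forall>y. y \<notin> {4, 7} \<longrightarrow> s'' y = ?s y))"
        by (rule runs_shift_labels) (use frs[of 0] r(2) lt st'(1) in auto)
      then have "runs W shift_labels ?s (50 * N) (I (Suc d))"
      proof (rule runs_mono)
        fix s'' :: store assume s'': "(\<forall>x<N. s'' 4 x = ?s 4 (skip (a j) x)) \<and> (\<forall>y. y \<notin> {4, 7} \<longrightarrow> s'' y = ?s y)"
        have "s'' 4 i = label m a (Suc d) i" if "i + 2 * Suc d \<le> N" for i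
        proof -
          have "s'' 4 i = s' 4 (skip (a j) i)" using s'' s4 that by auto
          also have "\<dots> = label m a d (skip (a j) i)" using I' that by (auto simp: skip_def)
          finally show ?thesis by (simp add: j_def)
        qed
        moreover have "s'' 8 0 = j" "s'' 1 = ?s 1" using s'' r(1) by auto
        moreover have "s'' 5 i = diag1_idx a i \<and> s'' 6 i = diag2_idx a i" if "j \<le> i" "i \<le> m" for i
          using s'' r(3,4) I' that by (auto simp: diag1_idx_def diag2_idx_def)
        ultimately show "I (Suc d) s''" using s'' s1 frs unfolding I_def j(5) by auto
      qed simp
      then show "runs W ?body s' (basic_cost draw_quad + 50 * N) (I (Suc d))"
        by (intro runs_Seq runs_basic) (auto simp: draw_quad_def)
    qed
  qed
  let ?TL = "(m + 1 - f) * ?T + expr_cost ?e + 1"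
  have "runs W rebuild s (50 * (N * N) + (50 * N + (basic_cost (assign 8 (Add (var 11) (Const 1))) + ?TL))) (I (m + 1 - f))"
    unfolding rebuild_def
  proof (rule runs_SeqI[OF runs_clear_matrix[of s]])
    show "s 0 0 = N" by (rule st'(1))
    fix s1 :: store assume s1: "(\<forall>x\<le>N * N. s1 1 x = 0) \<and> (\<forall>y. y \<notin> {1, 7} \<longrightarrow> s1 y = s y)"
    then have s10: "s1 0 0 = N" using st'(1) by simp
    show "runs W (init_labels ;; assign 8 (Add (var 11) (Const 1)) ;; While ?e ?body) s1
      (50 * N + (basic_cost (assign 8 (Add (var 11) (Const 1))) + ?TL)) (I (m + 1 - f))"
    proof (rule runs_SeqI[OF runs_init_labels[of s1]])
      show "s1 0 0 = N" by (rule s10)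
      fix s2 :: store assume s2: "(\<forall>x\<le>N. s2 4 x = x) \<and> (\<forall>y. y \<notin> {4, 7} \<longrightarrow> s2 y = s1 y)"
      have "s2 11 0 = m" using s1 s2 st'(3) by simp
      then have "basic_run W (assign 8 (Add (var 11) (Const 1))) s2 = s2(8 := (s2 8)(0 := m + 1))"
        using N_eq N_ge f W_neq mod_N[of "Suc m"] by simp
      moreover have "I 0 (s2(8 := (s2 8)(0 := m + 1)))"
        using s1 s2 unfolding I_def P_def by auto
      ultimately have "I 0 (basic_run W (assign 8 (Add (var 11) (Const 1))) s2)" by metis
      then show "runs W (assign 8 (Add (var 11) (Const 1)) ;; While ?e ?body) s2
        (basic_cost (assign 8 (Add (var 11) (Const 1))) + ?TL) (I (m + 1 - f))"
        by (intro runs_Seq runs_basic loop) simp_all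
    qed
  qed
  then show ?thesis
  proof (rule runs_mono)
    have cq: "basic_cost draw_quad \<le> 20 * N" using N_ge unfolding draw_quad_def by simp
    have "(m + 1 - f) * ?T \<le> N * (80 * N)"
      by (intro mult_mono) (use N_eq cq N_ge in auto)
    moreover have "8 * N \<le> N * N" "8 \<le> N" by (rule N_le_NN N_ge)+
    moreover have "N * (80 * N) = 80 * (N * N)" by simp
    ultimately show "50 * (N * N) + (50 * N + (basic_cost (assign 8 (Add (var 11) (Const 1))) + ?TL)) \<le> 500 * (N * N)"
      unfolding basic_cost.simps expr_cost.simps by linarith
    fix s' assume "I (m + 1 - f) s'"
    moreover have "m + 1 - (m + 1 - f) = f" using m by simp
    moreover from this have "P (m + 1 - f) = indices a C" unfolding P_def indices_def by simp
    ultimately show "drawn s' a C \<and> (\<forall>y. y \<notin> {1, 4, 5, 6, 7, 8, 9} \<longrightarrow> s' y = s y)"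
      unfolding I_def drawn_def by simp
  qed
qed

end

section \<open>Search for a tree edge to cross\<close>

abbreviation "r_q \<equiv> var 18"
abbreviation "r_v \<equiv> var 23"
abbreviation "r_prev \<equiv> Read 2 (Sub r_q (Const 1))"
abbreviation "r_here \<equiv> Read 2 r_q"

definition edge_test :: expr where
  "edge_test = And (Less (Const 1) r_v) (And (Less r_v (Add r_prev (Const 3)))
     (And (Or (Less r_prev (Const 2)) (Equal r_v (Add r_prev (Const 2))))
     (And (Or (Equal r_q (var 11)) (Less (Read 2 (Add r_q (Const 1))) (Add r_v (Const 2))))
       (Or (Less r_q (var 11)) (Equal (Equal r_v (Const 3)) (Const 0))))))"

definition mark0_test :: "nat \<Rightarrow> expr" where
  "mark0_test e = And (Less r_q (var 11)) (if e = 0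
     then Or (And (Equal (var 12) (Const 1)) (Read 3 (Sub r_q (Const 1))))
       (And (var 10) (And (Equal r_q (Const 1)) (Equal (var 12) (Const 0))))
     else And (Read 3 r_q) (Or (And (Equal (Add r_q (Const 1)) (var 11)) (Equal (var 12) (Const 1)))
       (And (Less (Add r_q (Const 1)) (var 11)) (And (Equal (var 12) (Const 2)) (Read 3 (Add r_q (Const 1)))))))"

definition mark1_test :: "nat \<Rightarrow> expr" where
  "mark1_test e = And (Equal r_q (var 11)) (if e = 0
     then And (Equal (Read 3 (var 11)) (Const 0)) (And (Read 3 (Sub (var 11) (Const 1)))
       (Equal (var 12) (Add (Const 1) (Read 3 (var 10)))))
     else And (Read 3 (var 11)) (Equal (var 12) (Read 3 (var 10))))"

definition mark_test :: "nat \<Rightarrow> expr" where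
  "mark_test e = Or (And (Equal (var 13) (Const 0)) (mark0_test e)) (And (Equal (var 13) (Const 1)) (mark1_test e))"

text \<open>The upper value of an edge at \<open>q\<close> is \<open>x\<close> or
  \<open>x + 1\<close> for the entry \<open>x\<close> there, so \<open>x + (x + e) mod 2\<close> is
  the only candidate of parity \<open>e\<close>. The marks depend on the upper value through its
  parity alone, hence the tests for them are indexed by \<open>e\<close>.\<close>

definition try_edge :: "nat \<Rightarrow> com" where
  "try_edge e = assign 23 (Add r_here (Sub (Add r_here (Const e)) (Mul (Const 2) (Div (Add r_here (Const e)) (Const 2))))) ;;
     If (And edge_test (mark_test e)) (assign 15 r_q ;; assign 16 r_v) Skip"

text \<open>Register 19 carries \<open>linear_below\<close> along, so that every position is tested
  in constant time.\<close>

definition find_body :: com where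
  "find_body = If (var 19) (try_edge 0 ;; try_edge 1) Skip ;;
     If (Or (Less r_prev (Const 2)) (Equal r_here (Add r_prev (Const 2)))) Skip (assign 19 (Const 0))"

definition find_edge :: com where
  "find_edge = assign 19 (Const 1) ;; assign 15 (Const 0) ;; assign 18 (Const 1) ;;
     While (Less r_q (Add (var 11) (Const 1))) (find_body ;; assign 18 (Add r_q (Const 1)))"

section \<open>Marks as bit counts, and correctness of the search\<close>

context machine
begin

lemma eval_Const: "c \<le> 8 \<Longrightarrow> eval_expr W s (Const c) = c"
  using N_ge by (simp add: mod_N)

lemma eval_Add: "eval_expr W s x + eval_expr W s y \<le> 8 * N \<Longrightarrow> eval_expr W s (Add x y) = eval_expr W s x + eval_expr W s y"
  by (simp add: mod_N)

lemma eval_Mul: "eval_expr W s x * eval_expr W s y \<le> 8 * N \<Longrightarrow> eval_expr W s (Mul x y) = eval_expr W s x * eval_expr W s y"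
  by (simp add: mod_N)

lemma W3: "3 \<le> W"
  using W_gt by simp

lemmas ev = eval_Const eval_Add eval_Mul eval_Less eval_Equal eval_And[OF W3] eval_Or[OF W3]
lemmas ev_del = eval_expr.simps(1,3,5,7,8) One_nat_def

definition loaded :: "store \<Rightarrow> (nat \<Rightarrow> nat) \<Rightarrow> nat set \<Rightarrow> bool \<Rightarrow> bool" where
  "loaded s a C b \<longleftrightarrow> stored s a C \<and> s 12 0 = card (C - {m}) \<and> s 13 0 = of_bool b"

lemma card_bits: "C \<subseteq> {f..m} \<Longrightarrow> card (C - {m}) \<le> N"
proof -
  assume "C \<subseteq> {f..m}"
  then have "card (C - {m}) \<le> card {f..m}" by (intro card_mono) auto
  then show ?thesis using N_eq f by simp
qed

text \<open>Comparing bit sets would take linear time at each position. The maintained number of set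
  bits reduces the comparison to a count and few memberships. For \<open>f = 1\<close> and
  \<open>q = 1\<close> there is no preceding bit, and the set must be empty.\<close>

lemma mark0_even_iff:
  assumes C: "C \<subseteq> {f..m}" and q: "1 \<le> q" "q < m"
  shows "C - {m} = {q - 1} \<inter> {f..} \<longleftrightarrow> card (C - {m}) = 1 \<and> q - 1 \<in> C \<or> f = 1 \<and> q = 1 \<and> card (C - {m}) = 0"
proof (cases "f \<le> q - 1")
  case True
  have "C - {m} = {q - 1} \<longleftrightarrow> card (C - {m}) = 1 \<and> q - 1 \<in> C - {m}"
    by (metis card_1_singletonE card_1_singleton_iff One_nat_def singletonD singletonI)
  moreover have eq: "{q - 1} \<inter> {f..} = {q - 1}" and "q - 1 \<in> C - {m} \<longleftrightarrow> q - 1 \<in> C" "\<not> (f = 1 \<and> q = 1)"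
    using True q by auto
  ultimately show ?thesis unfolding eq by blast
next
  case False
  then have "{q - 1} \<inter> {f..} = {}" "f = 1" "q = 1" "q - 1 \<notin> C" using f C q by auto
  moreover have "finite (C - {m})" using C finite_subset by blast
  ultimately show ?thesis by auto
qed

lemma mark0_odd_iff:
  assumes C: "C \<subseteq> {f..m}" and q: "1 \<le> q" "q < m"
  shows "C - {m} = {q, q + 1} \<inter> {..<m} \<longleftrightarrow>
    q \<in> C \<and> (q + 1 = m \<and> card (C - {m}) = 1 \<or> q + 1 < m \<and> card (C - {m}) = 2 \<and> q + 1 \<in> C)"
proof (cases "q + 1 = m")
  case True
  then have "{q, q + 1} \<inter> {..<m} = {q}" by auto
  moreover have "C - {m} = {q} \<longleftrightarrow> card (C - {m}) = 1 \<and> q \<in> C - {m}"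
    by (metis card_1_singletonE card_1_singleton_iff One_nat_def singletonD singletonI)
  ultimately show ?thesis using True q by auto
next
  case False
  then have eq: "{q, q + 1} \<inter> {..<m} = {q, q + 1}" using q by auto
  have "C - {m} = {q, q + 1} \<longleftrightarrow> card (C - {m}) = 2 \<and> q \<in> C - {m} \<and> q + 1 \<in> C - {m}"
  proof
    assume r: "card (C - {m}) = 2 \<and> q \<in> C - {m} \<and> q + 1 \<in> C - {m}"
    moreover have "finite (C - {m})" using C finite_subset by blast
    ultimately have "{q, q + 1} = C - {m}" by (intro card_subset_eq) auto
    then show "C - {m} = {q, q + 1}" by simp
  qed auto
  moreover have "q \<in> C - {m} \<longleftrightarrow> q \<in> C" "q + 1 \<in> C - {m} \<longleftrightarrow> q + 1 \<in> C" "q + 1 < m" using False q by auto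
  ultimately show ?thesis unfolding eq using False by blast
qed

lemma mark1_iff:
  assumes C: "C \<subseteq> {f..m}"
  shows "C - {f} = {m - 1} \<longleftrightarrow> m \<notin> C \<and> m - 1 \<in> C \<and> card (C - {m}) = 1 + of_bool (f \<in> C)"
    "C - {f} = {m} \<longleftrightarrow> m \<in> C \<and> card (C - {m}) = of_bool (f \<in> C)"
proof -
  have ne: "m \<noteq> f" "m - 1 \<noteq> f" "m - 1 \<noteq> m" using m by auto
  have fin: "finite C" using C finite_subset by blast
  have c1: "C - {f} = {x} \<longleftrightarrow> card (C - {f}) = 1 \<and> x \<in> C - {f}" for x
    by (metis card_1_singletonE card_1_singleton_iff One_nat_def singletonD singletonI)
  have cf: "card (C - {f}) + of_bool (f \<in> C) = card C" using fin by (auto simp: card_Suc_Diff1 dest: card_Suc_Diff1)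
  have cm: "card (C - {m}) + of_bool (m \<in> C) = card C" using fin by (auto simp: card_Suc_Diff1 dest: card_Suc_Diff1)
  show "C - {f} = {m - 1} \<longleftrightarrow> m \<notin> C \<and> m - 1 \<in> C \<and> card (C - {m}) = 1 + of_bool (f \<in> C)"
  proof
    assume e: "C - {f} = {m - 1}"
    have x: "x \<in> C \<and> x \<noteq> f \<longleftrightarrow> x = m - 1" for x using e by (metis Diff_iff singleton_iff)
    have "m \<notin> C" "m - 1 \<in> C" using ne x[of m] x[of "m - 1"] by simp_all
    then show "m \<notin> C \<and> m - 1 \<in> C \<and> card (C - {m}) = 1 + of_bool (f \<in> C)" using cf cm arg_cong[OF e, of card] by simp
  next
    assume r: "m \<notin> C \<and> m - 1 \<in> C \<and> card (C - {m}) = 1 + of_bool (f \<in> C)"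
    then have "of_bool (m \<in> C) = (0::nat)" by simp
    then have "card (C - {f}) = 1" using cf cm r by linarith
    then show "C - {f} = {m - 1}" unfolding c1 using r ne by blast
  qed
  show "C - {f} = {m} \<longleftrightarrow> m \<in> C \<and> card (C - {m}) = of_bool (f \<in> C)"
  proof
    assume e: "C - {f} = {m}"
    then have "m \<in> C" by (metis Diff_iff singletonI)
    then show "m \<in> C \<and> card (C - {m}) = of_bool (f \<in> C)" using cf cm arg_cong[OF e, of card] by simp
  next
    assume r: "m \<in> C \<and> card (C - {m}) = of_bool (f \<in> C)"
    then have "of_bool (m \<in> C) = (1::nat)" by simp
    then have "card (C - {f}) = 1" using cf cm r by linarith
    then show "C - {f} = {m}" unfolding c1 using r ne by blast
  qed
qed

lemma eval_mark_test:
  assumes C: "C \<subseteq> {f..m}" and s: "loaded s a C b" and q: "s 18 0 = q" "1 \<le> q" "q \<le> m"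
    and e: "e = 0 \<or> e = 1" "even v \<longleftrightarrow> e = 0"
  shows "eval_expr W s (mark_test e) \<noteq> 0 \<longleftrightarrow> (if b then mark1 C q v else mark0 C q v)"
proof -
  have st: "s 10 0 = f" "s 11 0 = m" "s 12 0 = card (C - {m})" "s 13 0 = of_bool b"
    "\<And>i. i \<le> m \<Longrightarrow> s 3 i = of_bool (i \<in> C)"
    using s unfolding loaded_def stored_def by auto
  have bd: "q + 1 \<le> 8 * N" "m \<le> N" using q N_eq f by auto
  have 0: "eval_expr W s (mark0_test e) \<noteq> 0 \<longleftrightarrow> mark0 C q v"
  proof (cases "q < m")
    case True
    then have "s 3 q = of_bool (q \<in> C)" "s 3 (q + 1) = of_bool (q + 1 \<in> C)" "s 3 (q - 1) = of_bool (q - 1 \<in> C)"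
      using st(5) by auto
    then have k: "eval_expr W s (mark0_test 0) \<noteq> 0 \<longleftrightarrow> card (C - {m}) = 1 \<and> q - 1 \<in> C \<or> f \<noteq> 0 \<and> q = 1 \<and> card (C - {m}) = 0"
      "eval_expr W s (mark0_test 1) \<noteq> 0 \<longleftrightarrow>
        q \<in> C \<and> (q + 1 = m \<and> card (C - {m}) = 1 \<or> q + 1 < m \<and> card (C - {m}) = 2 \<and> q + 1 \<in> C)"
      using True q(1) st(1-4) bd unfolding mark0_test_def by (auto simp: ev simp del: ev_del)
    have f1: "f \<noteq> 0 \<longleftrightarrow> f = 1" using f by auto
    show ?thesis
    proof (cases "e = 0")
      case z: True
      then have "mark0 C q v \<longleftrightarrow> C - {m} = {q - 1} \<inter> {f..}" using True e unfolding mark0_def by simp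
      then show ?thesis unfolding z k f1 mark0_even_iff[OF C q(2) True] by blast
    next
      case False
      then have z: "e = 1" "odd v" using e by auto
      then have "mark0 C q v \<longleftrightarrow> C - {m} = {q, q + 1} \<inter> {..<m}" using True unfolding mark0_def by simp
      then show ?thesis unfolding z(1) k mark0_odd_iff[OF C q(2) True] by blast
    qed
  next
    case False
    then show ?thesis using q st(2) unfolding mark0_test_def mark0_def by (simp add: ev del: ev_del)
  qed
  have 1: "eval_expr W s (mark1_test e) \<noteq> 0 \<longleftrightarrow> mark1 C q v"
  proof -
    have "s 3 m = of_bool (m \<in> C)" "s 3 (m - 1) = of_bool (m - 1 \<in> C)" "s 3 f = of_bool (f \<in> C)"
      using st(5) m by auto
    moreover define w where "w = card (C - {m})"
    ultimately have "eval_expr W s (mark1_test 0) \<noteq> 0 \<longleftrightarrow> q = m \<and> m \<notin> C \<and> m - 1 \<in> C \<and> w = 1 + of_bool (f \<in> C)"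
      "eval_expr W s (mark1_test 1) \<noteq> 0 \<longleftrightarrow> q = m \<and> m \<in> C \<and> w = of_bool (f \<in> C)"
      using q(1) st(1,2) st(3)[folded w_def] bd N_ge unfolding mark1_test_def by (auto simp: ev simp del: ev_del)
    note k = this
    show ?thesis
    proof (cases "e = 0")
      case z: True
      then have "mark1 C q v \<longleftrightarrow> q = m \<and> C - {f} = {m - 1}" using e unfolding mark1_def by simp
      then show ?thesis unfolding z k mark1_iff[OF C] w_def by blast
    next
      case False
      then have z: "e = 1" "odd v" using e by auto
      then have "mark1 C q v \<longleftrightarrow> q = m \<and> C - {f} = {m}" unfolding mark1_def by simp
      then show ?thesis unfolding z(1) k mark1_iff[OF C] w_def by blast
    qed
  qed
  show ?thesis using 0 1 st(4) unfolding mark_test_def by (simp add: ev del: ev_del)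
qed

lemma codes_le_N: "a \<in> codes \<Longrightarrow> i \<le> m \<Longrightarrow> a i \<le> N"
  using codes_polygon[of a i] N f unfolding polygon_size_def by simp

lemma eval_edge_test:
  assumes a: "a \<in> codes" and s: "stored s a C" and q: "s 18 0 = q" "1 \<le> q" "q \<le> m" and v: "s 23 0 = v"
    and lin: "linear_below a q" and av: "a q = v \<or> a q + 1 = v"
  shows "eval_expr W s edge_test \<noteq> 0 \<longleftrightarrow> tree_edge a q v"
proof -
  have st: "s 11 0 = m" "s 2 q = a q" "s 2 (q - 1) = a (q - 1)" "q < m \<Longrightarrow> s 2 (q + 1) = a (q + 1)"
    using s q unfolding stored_def by auto
  have bd: "q + 1 \<le> 8 * N" "a (q - 1) + 3 \<le> 8 * N" "v + 2 \<le> 8 * N"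
  proof -
    have "q - 1 \<le> m" using q by simp
    then have "a (q - 1) \<le> N" "a q \<le> N" using codes_le_N[OF a] q by blast+
    then show "q + 1 \<le> 8 * N" "a (q - 1) + 3 \<le> 8 * N" "v + 2 \<le> 8 * N" using q N_eq N_ge f av by linarith+
  qed
  have "eval_expr W s edge_test \<noteq> 0 \<longleftrightarrow> 1 < v \<and> v < a (q - 1) + 3 \<and> (a (q - 1) < 2 \<or> v = a (q - 1) + 2) \<and>
    (q = m \<or> s 2 (q + 1) < v + 2) \<and> (q < m \<or> v \<noteq> 3)"
    using q(1) st(1-3) v bd unfolding edge_test_def by (auto simp: ev simp del: ev_del)
  also have "\<dots> \<longleftrightarrow> tree_edge a q v"
    using st(4) q(2,3) lin av unfolding tree_edge_def by (cases "q = m") auto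
  finally show ?thesis .
qed

definition edge_value :: "(nat \<Rightarrow> nat) \<Rightarrow> nat \<Rightarrow> nat \<Rightarrow> nat" where
  "edge_value a q e = a q + of_bool (odd (a q + e))"

lemma basic_run_try_edge:
  assumes a: "a \<in> codes" and C: "C \<subseteq> {f..m}" and s: "loaded s a C b" and q: "s 18 0 = q" "1 \<le> q" "q \<le> m"
    and lin: "linear_below a q" and e: "e = 0 \<or> e = 1"
  shows "basic_run W (try_edge e) s = (let s1 = s(23 := (s 23)(0 := edge_value a q e)) in
    if marked b a C q (edge_value a q e) then s1(15 := (s 15)(0 := q), 16 := (s 16)(0 := edge_value a q e)) else s1)"
proof -
  let ?v = "edge_value a q e"
  define s1 where "s1 = s(23 := (s 23)(0 := ?v))"
  let ?x = "Add r_here (Sub (Add r_here (Const e)) (Mul (Const 2) (Div (Add r_here (Const e)) (Const 2))))"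
  have st: "s 2 q = a q" using s q unfolding loaded_def stored_def by auto
  have bd: "a q + 1 \<le> 8 * N" "a q + 2 \<le> 8 * N" using codes_le_N[OF a q(3)] N_ge by auto
  have "eval_expr W s ?x = a q + (a q + e - 2 * ((a q + e) div 2))"
  proof -
    have 1: "eval_expr W s (Add r_here (Const e)) = a q + e" using q(1) st bd e by (auto simp: ev simp del: ev_del)
    have 2: "eval_expr W s (Mul (Const 2) (Div (Add r_here (Const e)) (Const 2))) = 2 * ((a q + e) div 2)"
    proof -
      have "2 * ((a q + e) div 2) \<le> 8 * N" using bd e by auto
      then show ?thesis using 1 by (simp add: ev del: ev_del)
    qed
    have 3: "a q + (a q + e - 2 * ((a q + e) div 2)) \<le> 8 * N" unfolding parity_expr using bd by auto
    show ?thesis using 1 2 3 q(1) st by (simp add: ev del: ev_del)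
  qed
  then have v: "eval_expr W s ?x = ?v" unfolding edge_value_def parity_expr .
  then have r1: "basic_run W (assign 23 ?x) s = s1" unfolding s1_def by (simp add: eval_Const del: ev_del)
  have l1: "loaded s1 a C b" using s unfolding loaded_def stored_def s1_def by simp
  have q1: "s1 18 0 = q" "s1 23 0 = ?v" using q unfolding s1_def by simp_all
  have av: "a q = ?v \<or> a q + 1 = ?v" "even ?v \<longleftrightarrow> e = 0" using e unfolding edge_value_def by auto
  have "eval_expr W s1 edge_test \<noteq> 0 \<longleftrightarrow> tree_edge a q ?v"
    using eval_edge_test[of a s1 C q ?v] a l1 q1 q(2,3) lin av(1) unfolding loaded_def by blast
  moreover have "eval_expr W s1 (mark_test e) \<noteq> 0 \<longleftrightarrow> (if b then mark1 C q ?v else mark0 C q ?v)"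
    by (rule eval_mark_test[OF C l1 q1(1) q(2,3) e av(2)])
  ultimately have "eval_expr W s1 (And edge_test (mark_test e)) = of_bool (marked b a C q ?v)"
    unfolding marked_def by (simp add: eval_And[OF W3])
  then have "basic_run W (try_edge e) s =
    (if marked b a C q ?v then s1(15 := (s1 15)(0 := q), 16 := (s1 16)(0 := ?v)) else s1)"
    unfolding try_edge_def basic_run.simps(2) r1 using q1 by (simp add: eval_Const del: ev_del)
  then show ?thesis unfolding s1_def by (simp add: Let_def)
qed

text \<open>Positions of tree edges are at least 1, so 0 can stand for the absence of a marked
  edge.\<close>

definition find_result :: "(nat \<Rightarrow> nat) \<Rightarrow> nat set \<Rightarrow> bool \<Rightarrow> nat \<Rightarrow> store \<Rightarrow> bool" where
  "find_result a C b n s \<longleftrightarrow> (if \<exists>q<n. \<exists>v. marked b a C q v then marked b a C (s 15 0) (s 16 0) else s 15 0 = 0)"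

lemma runs_find_body:
  assumes a: "a \<in> codes" and C: "C \<subseteq> {f..m}" and s: "loaded s a C b" and q: "s 18 0 = q" "1 \<le> q" "q \<le> m"
    and ok: "s 19 0 = of_bool (linear_below a q)" and res: "find_result a C b q s"
  shows "runs W find_body s (basic_cost find_body) (\<lambda>s'. s' 18 0 = q \<and> s' 19 0 = of_bool (linear_below a (Suc q)) \<and>
    find_result a C b (Suc q) s' \<and> (\<forall>y. y \<notin> {15, 16, 19, 23} \<longrightarrow> s' y = s y))"
proof (rule runs_basic)
  show "basic find_body" unfolding find_body_def try_edge_def by simp
  define s1 where "s1 = (if linear_below a q then basic_run W (try_edge 1) (basic_run W (try_edge 0) s) else s)"
  have ex: "(\<exists>q'<Suc q. \<exists>v. marked b a C q' v) \<longleftrightarrow> (\<exists>q'<q. \<exists>v. marked b a C q' v) \<or> (\<exists>v. marked b a C q v)"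
    by (auto simp: less_Suc_eq)
  have "find_result a C b (Suc q) s1 \<and> (\<forall>y. y \<notin> {15, 16, 23} \<longrightarrow> s1 y = s y)"
  proof (cases "linear_below a q")
    case False
    then have "\<not> (\<exists>v. marked b a C q v)" unfolding marked_def tree_edge_def by blast
    then show ?thesis using res False unfolding s1_def find_result_def ex by auto
  next
    case True
    let ?v = "edge_value a q"
    have mv: "(\<exists>v. marked b a C q v) \<longleftrightarrow> marked b a C q (?v 0) \<or> marked b a C q (?v 1)"
    proof
      assume "\<exists>v. marked b a C q v"
      then obtain v where v: "marked b a C q v" by blast
      then have "a q = v \<or> a q + 1 = v" unfolding marked_def tree_edge_def by blast
      then have "v = ?v 0 \<or> v = ?v 1" unfolding edge_value_def by auto
      then show "marked b a C q (?v 0) \<or> marked b a C q (?v 1)" using v by auto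
    qed auto
    let ?s0 = "basic_run W (try_edge 0) s"
    note r0 = basic_run_try_edge[OF a C s q True disjI1[OF refl]]
    have l0: "loaded ?s0 a C b" "?s0 18 0 = q"
      using r0 s q unfolding loaded_def stored_def Let_def by auto
    note r1 = basic_run_try_edge[OF a C l0(1,2) q(2,3) True disjI2[OF refl]]
    have res0: "if marked b a C q (?v 0) then ?s0 15 0 = q \<and> ?s0 16 0 = ?v 0 else ?s0 15 = s 15 \<and> ?s0 16 = s 16"
      using r0 by (simp add: Let_def)
    have s1: "s1 = basic_run W (try_edge 1) ?s0" using True unfolding s1_def by simp
    have res1: "if marked b a C q (?v 1) then s1 15 0 = q \<and> s1 16 0 = ?v 1 else s1 15 = ?s0 15 \<and> s1 16 = ?s0 16"
      using r1 unfolding s1 by (simp add: Let_def)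
    have "find_result a C b (Suc q) s1"
      using res res0 res1 unfolding find_result_def ex mv by (auto split: if_splits)
    moreover have "s1 y = s y" if y: "y \<notin> {15, 16, 23}" for y
    proof -
      have "s1 y = ?s0 y" unfolding s1 by (subst r1) (use y in \<open>simp add: Let_def\<close>)
      also have "\<dots> = s y" by (subst r0) (use y in \<open>simp add: Let_def\<close>)
      finally show ?thesis .
    qed
    ultimately show ?thesis by blast
  qed
  then have s1: "find_result a C b (Suc q) s1" "\<And>y. y \<notin> {15, 16, 23} \<Longrightarrow> s1 y = s y" by auto
  have st: "s1 2 q = a q" "s1 2 (q - 1) = a (q - 1)" "s1 18 0 = q" "s1 19 0 = of_bool (linear_below a q)"
    using s1(2) s q ok unfolding loaded_def stored_def by auto
  have bd: "a (q - 1) + 2 \<le> 8 * N"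
  proof -
    have "q - 1 \<le> m" using q by simp
    then show ?thesis using codes_le_N[OF a, of "q - 1"] N_ge by linarith
  qed
  let ?t = "Or (Less r_prev (Const 2)) (Equal r_here (Add r_prev (Const 2)))"
  have t: "eval_expr W s1 ?t \<noteq> 0 \<longleftrightarrow> a (q - 1) \<le> 1 \<or> a q = a (q - 1) + 2"
    using st bd by (auto simp: ev simp del: ev_del)
  have lin: "linear_below a (Suc q) \<longleftrightarrow> linear_below a q \<and> (a (q - 1) \<le> 1 \<or> a q = a (q - 1) + 2)"
  proof
    assume l: "linear_below a (Suc q)"
    have "Suc (q - 1) < Suc q" using q(2) by simp
    then have "a (q - 1) \<le> 1 \<or> a (Suc (q - 1)) = a (q - 1) + 2" using l unfolding linear_below_def by blast
    moreover have "linear_below a q" using l unfolding linear_below_def by auto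
    ultimately show "linear_below a q \<and> (a (q - 1) \<le> 1 \<or> a q = a (q - 1) + 2)" using q(2) by simp
  next
    assume l: "linear_below a q \<and> (a (q - 1) \<le> 1 \<or> a q = a (q - 1) + 2)"
    show "linear_below a (Suc q)" unfolding linear_below_def
    proof (intro allI impI)
      fix i assume "Suc i < Suc q"
      then show "a i \<le> 1 \<or> a (Suc i) = a i + 2"
        using l unfolding linear_below_def by (cases "Suc i = q") auto
    qed
  qed
  have "basic_run W (If (var 19) (try_edge 0 ;; try_edge 1) Skip) s = s1"
    using ok unfolding s1_def by (simp add: eval_Const del: ev_del)
  then have fin: "basic_run W find_body s = (if a (q - 1) \<le> 1 \<or> a q = a (q - 1) + 2 then s1 else s1(19 := (s1 19)(0 := 0)))"
    unfolding find_body_def basic_run.simps(2) using t by (simp add: eval_Const del: ev_del)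
  show "basic_run W find_body s 18 0 = q \<and> basic_run W find_body s 19 0 = of_bool (linear_below a (Suc q)) \<and>
    find_result a C b (Suc q) (basic_run W find_body s) \<and>
    (\<forall>y. y \<notin> {15, 16, 19, 23} \<longrightarrow> basic_run W find_body s y = s y)"
    unfolding fin lin using s1 st by (auto simp: find_result_def)
qed

lemma marked_bounds: "marked b a C q v \<Longrightarrow> 1 \<le> q \<and> q \<le> m"
  unfolding marked_def tree_edge_def by blast

lemma runs_find_edge:
  assumes a: "a \<in> codes" and C: "C \<subseteq> {f..m}" and s: "loaded s a C b"
  shows "runs W find_edge s ((basic_cost find_body + 40) * N) (\<lambda>s'. find_result a C b (Suc m) s' \<and>
    (\<forall>y. y \<notin> {15, 16, 18, 19, 23} \<longrightarrow> s' y = s y))"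
proof -
  define J where "J q s' \<longleftrightarrow> s' 19 0 = of_bool (linear_below a q) \<and> find_result a C b q s' \<and>
    (\<forall>y. y \<notin> {15, 16, 18, 19, 23} \<longrightarrow> s' y = s y)" for q s'
  define s2 where "s2 = s(19 := (s 19)(0 := 1), 15 := (s 15)(0 := 0))"
  have r2: "basic_run W (assign 15 (Const 0)) (basic_run W (assign 19 (Const 1)) s) = s2"
    unfolding s2_def by (simp add: eval_Const del: ev_del)
  have J1: "J 1 (s2(18 := (s2 18)(0 := 1)))"
    using marked_bounds unfolding J_def s2_def find_result_def linear_below_def by fastforce
  have L: "runs W (assign 18 (Const 1) ;; While (Less r_q (Add (var 11) (Const 1))) (find_body ;; assign 18 (Add r_q (Const 1)))) s2
    (expr_cost (Const 1) + 2 + (m + 1 - 1 + 1) * (expr_cost (Add (var 11) (Const 1)) + basic_cost find_body + 10)) (J (m + 1))"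
  proof (rule runs_for)
    show "eval_expr W s2 (Const 1) = 1" by (simp add: eval_Const del: ev_del)
    show "m + 1 < W" using N_eq f W_ge N_le_NN by linarith
    show "J 1 (s2(18 := (s2 18)(0 := 1)))" by (rule J1)
    show "eval_expr W s' (Add (var 11) (Const 1)) = m + 1" if "J i s'" for i s'
    proof -
      have "s' 11 0 = m" using that s unfolding J_def loaded_def stored_def by auto
      then show ?thesis using N_eq f by (simp add: ev del: ev_del)
    qed
    show "runs W find_body s' (basic_cost find_body)
        (\<lambda>s''. s'' 18 0 = i \<and> J (Suc i) (s''(18 := (s'' 18)(0 := Suc i))))"
      if i: "1 \<le> i" "i < m + 1" "J i s'" "s' 18 0 = i" for i s'
    proof (rule runs_mono[OF runs_find_body[OF a C, of s' b i]])
      show "loaded s' a C b" using s i(3) unfolding J_def loaded_def stored_def by auto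
      show "s'' 18 0 = i \<and> J (Suc i) (s''(18 := (s'' 18)(0 := Suc i)))"
        if "s'' 18 0 = i \<and> s'' 19 0 = of_bool (linear_below a (Suc i)) \<and>
          find_result a C b (Suc i) s'' \<and> (\<forall>y. y \<notin> {15, 16, 19, 23} \<longrightarrow> s'' y = s' y)" for s''
        using that i(3) unfolding J_def find_result_def by auto
      show "s' 18 0 = i" "1 \<le> i" "i \<le> m" "s' 19 0 = of_bool (linear_below a i)" "find_result a C b i s'"
        using i unfolding J_def by auto
    qed auto
  qed auto
  have "runs W find_edge s (basic_cost (assign 19 (Const 1)) + (basic_cost (assign 15 (Const 0)) +
    (expr_cost (Const 1) + 2 + (m + 1 - 1 + 1) * (expr_cost (Add (var 11) (Const 1)) + basic_cost find_body + 10)))) (J (m + 1))"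
    unfolding find_edge_def
    by (rule runs_Seq, rule runs_basic, simp, rule runs_Seq, rule runs_basic, simp) (unfold r2, rule L)
  then show ?thesis
  proof (rule runs_mono)
    have "(m + 1 - 1 + 1) * (expr_cost (Add (var 11) (Const 1)) + basic_cost find_body + 10)
      \<le> N * (basic_cost find_body + 14)"
      by (intro mult_mono) (use N_eq f m in auto)
    then show "basic_cost (assign 19 (Const 1)) + (basic_cost (assign 15 (Const 0)) +
      (expr_cost (Const 1) + 2 + (m + 1 - 1 + 1) * (expr_cost (Add (var 11) (Const 1)) + basic_cost find_body + 10)))
      \<le> (basic_cost find_body + 40) * N"
      using N_ge by (simp add: algebra_simps)
  qed (auto simp: J_def)
qed

end

section \<open>One step of the walk\<close>

definition toggle_bit :: com where
  "toggle_bit = If (Less (var 17) (var 11))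
       (assign 12 (Sub (Add (var 12) (Const 1)) (Mul (Const 2) (Read 3 (var 17))))) Skip ;;
     Write 3 (var 17) (Sub (Const 1) (Read 3 (var 17))) ;;
     Write 1 (Read 5 (var 17)) (Sub (Const 1) (Read 1 (Read 5 (var 17)))) ;;
     Write 1 (Read 6 (var 17)) (Sub (Const 1) (Read 1 (Read 6 (var 17))))"

definition scan_body :: com where
  "scan_body = assign 17 (Add (var 17) (Const 1))"

definition scan_test :: expr where
  "scan_test = And (Less (Add (var 17) (Const 1)) (var 11)) (Equal (Read 3 (var 17)) (Const 0))"

definition scan_bits :: com where
  "scan_bits = assign 17 (var 10) ;; While scan_test scan_body ;;
     If (Less (Add (var 17) (Const 1)) (var 11)) scan_body Skip"

definition choose_bit :: com where
  "choose_bit = If (Equal (var 13) (Const 0)) (assign 17 (var 11))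
     (If (Equal (Read 3 (var 11)) (var 14)) (assign 17 (var 10)) scan_bits)"

definition set_polarity :: com where
  "set_polarity = If (Equal (Read 2 (Sub (var 11) (Const 1))) (Const 1)) (assign 14 (Const 0))
     (assign 14 (Sub (Read 2 (Sub (var 11) (Const 1)))
       (Mul (Const 2) (Div (Read 2 (Sub (var 11) (Const 1))) (Const 2)))))"

text \<open>The new entry is added to the weight before the old one is subtracted, as subtraction is
  truncated.\<close>

definition shift_entry :: com where
  "shift_entry = assign 9 (Sub (Sub (Mul (Const 2) (var 16)) (Const 1)) (Read 2 (var 15))) ;;
     assign 22 (Sub (Add (var 22) (var 9)) (Read 2 (var 15))) ;; Write 2 (var 15) (var 9)"

text \<open>A marked node has at most two set bits besides bit \<open>m\<close>. This necessary
  condition is checked in constant time and keeps the search away from all but few nodes.\<close>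

definition next_state :: com where
  "next_state = If (Less (var 12) (Const 3)) find_edge (assign 15 (Const 0)) ;;
     If (var 15) (shift_entry ;; set_polarity ;; rebuild) (choose_bit ;; toggle_bit) ;;
     assign 13 (Sub (Const 1) (var 13))"

definition next_cost :: nat where
  "next_cost = basic_cost find_body + basic_cost choose_bit + basic_cost toggle_bit + basic_cost set_polarity +
     basic_cost shift_entry + expr_cost scan_test + basic_cost scan_body + 1000"

section \<open>Correctness and cost of one step\<close>

context machine
begin

definition ready :: "store \<Rightarrow> (nat \<Rightarrow> nat) \<Rightarrow> nat set \<Rightarrow> bool \<Rightarrow> bool" where
  "ready s a C b \<longleftrightarrow> loaded s a C b \<and> drawn s a C \<and> s 14 0 = of_bool (polarity a) \<and> s 22 0 = weight a"

lemma card_toggle: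
  assumes C: "C \<subseteq> {f..m}" and t: "t < m"
  shows "card (toggle t C - {m}) = card (C - {m}) + 1 - 2 * of_bool (t \<in> C)"
proof -
  have fin: "finite (C - {m})" using C finite_subset by blast
  show ?thesis
  proof (cases "t \<in> C")
    case True
    then have "toggle t C - {m} = (C - {m}) - {t}" "t \<in> C - {m}" using t unfolding toggle_def by auto
    then have "Suc (card (toggle t C - {m})) = card (C - {m})" using card_Suc_Diff1[OF fin] by simp
    then show ?thesis using True by simp
  next
    case False
    then have "toggle t C - {m} = insert t (C - {m})" "t \<notin> C - {m}" using t unfolding toggle_def by auto
    then show ?thesis using fin False by simp
  qed
qed

lemma diag_idx_le:
  assumes "a \<in> codes" "f \<le> j" "j \<le> m"
  shows "diag1_idx a j \<le> N * N" "diag2_idx a j \<le> N * N"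
  using pt_bounds[OF assms] unfolding diag1_idx_def diag2_idx_def by (auto intro!: idx_le)

lemma runs_toggle_bit:
  assumes st: "(a, C) \<in> states" and s: "ready s a C b" and t: "s 17 0 = t" "f \<le> t" "t \<le> m"
  shows "runs W toggle_bit s (basic_cost toggle_bit) (\<lambda>s'. ready s' a (toggle t C) b \<and> s' 21 = s 21)"
proof (rule runs_basic)
  show "basic toggle_bit" unfolding toggle_bit_def by simp
  have a: "a \<in> codes" and C: "C \<subseteq> {f..m}" using st unfolding states_def by auto
  let ?i = "diag1_idx a t" and ?j = "diag2_idx a t"
  have v: "s 0 0 = N" "s 10 0 = f" "s 11 0 = m" "\<And>i. i \<le> m \<Longrightarrow> s 2 i = a i" "\<And>i. i \<le> m \<Longrightarrow> s 3 i = of_bool (i \<in> C)"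
    "s 12 0 = card (C - {m})" "s 13 0 = of_bool b" "s 14 0 = of_bool (polarity a)" "s 22 0 = weight a"
    "s 5 t = ?i" "s 6 t = ?j" "\<And>x. x \<le> N * N \<Longrightarrow> s 1 x = of_bool (x \<in> indices a C)"
    "\<And>j. f \<le> j \<Longrightarrow> j \<le> m \<Longrightarrow> s 5 j = diag1_idx a j \<and> s 6 j = diag2_idx a j"
    using s t unfolding ready_def loaded_def stored_def drawn_def by auto
  let ?w = "card (toggle t C - {m})"
  define s1 s2 s3 s4 where "s1 = s(12 := (s 12)(0 := ?w))" and "s2 = s1(3 := (s1 3)(t := of_bool (t \<notin> C)))"
    and "s3 = s2(1 := (s2 1)(?i := of_bool (?i \<notin> indices a C)))"
    and "s4 = s3(1 := (s3 1)(?j := of_bool (?j \<notin> indices a C)))"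
  have r1: "basic_run W (If (Less (var 17) (var 11))
       (assign 12 (Sub (Add (var 12) (Const 1)) (Mul (Const 2) (Read 3 (var 17))))) Skip) s = s1"
  proof (cases "t < m")
    case True
    have "card (C - {m}) + 1 \<le> 8 * N" "2 * of_bool (t \<in> C) \<le> 8 * N" using card_bits[OF C] N_ge by auto
    then show ?thesis using True v t card_toggle[OF C True] unfolding s1_def
      by (simp add: ev del: ev_del)
  next
    case False
    then have "toggle t C - {m} = C - {m}" using t by (auto simp: toggle_def)
    then have "s1 = s" using v(6) unfolding s1_def by (simp add: fun_upd_idem)
    then show ?thesis using False v t by (simp add: ev del: ev_del)
  qed
  have r2: "basic_run W (Write 3 (var 17) (Sub (Const 1) (Read 3 (var 17)))) s1 = s2"
    using v(5) t unfolding s2_def s1_def by (simp add: ev del: ev_del)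
  have r3: "basic_run W (Write 1 (Read 5 (var 17)) (Sub (Const 1) (Read 1 (Read 5 (var 17))))) s2 = s3"
    using v(10,12) t diag_idx_le[OF a t(2,3)] unfolding s3_def s2_def s1_def by (simp add: ev del: ev_del)
  have r4: "basic_run W (Write 1 (Read 6 (var 17)) (Sub (Const 1) (Read 1 (Read 6 (var 17))))) s3 = s4"
    using v(11,12) t diag_idx_le[OF a t(2,3)] diag_idx_neq[OF a t(2,3)] unfolding s4_def s3_def s2_def s1_def
    by (simp add: ev del: ev_del)
  have run: "basic_run W toggle_bit s = s4" unfolding toggle_bit_def basic_run.simps(2) r1 r2 r3 r4 ..
  have "stored s4 a (toggle t C)"
    using v unfolding stored_def s4_def s3_def s2_def s1_def by (simp add: toggle_mem)
  moreover have "drawn s4 a (toggle t C)"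
  proof -
    have "s4 1 x = of_bool (x \<in> indices a (toggle t C))" if "x \<le> N * N" for x
      using v(12)[OF that] diag_idx_neq[OF a t(2,3)] unfolding s4_def s3_def s2_def s1_def indices_toggle[OF a t(2,3)]
      by simp
    then show ?thesis using v(13) unfolding drawn_def s4_def s3_def s2_def s1_def by simp
  qed
  ultimately have "ready s4 a (toggle t C) b"
    using v unfolding ready_def loaded_def s4_def s3_def s2_def s1_def by simp
  then show "ready (basic_run W toggle_bit s) a (toggle t C) b \<and> basic_run W toggle_bit s 21 = s 21"
    unfolding run by (simp add: s4_def s3_def s2_def s1_def)
qed

text \<open>The scan is not of constant cost. Its length \<open>lowest C - f\<close> is kept in the
  bound and averaged over the hypercube later.\<close>

lemma runs_scan_bits:
  assumes C: "C \<subseteq> {f..m}" and s: "loaded s a C b"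
  shows "runs W scan_bits s ((lowest C - f) * (expr_cost scan_test + 1 + basic_cost scan_body) + expr_cost scan_test + basic_cost scan_body + 20)
    (\<lambda>s'. s' 17 0 = (if lowest C < m - 1 then lowest C + 1 else m - 1) \<and> (\<forall>y. y \<noteq> 17 \<longrightarrow> s' y = s y))"
proof -
  note lp = lowest_props[where C = C]
  have v: "s 10 0 = f" "s 11 0 = m" "\<And>i. i \<le> m \<Longrightarrow> s 3 i = of_bool (i \<in> C)"
    using s unfolding loaded_def stored_def by auto
  define I where "I k s' \<longleftrightarrow> s' 17 0 = f + k \<and> (\<forall>y. y \<noteq> 17 \<longrightarrow> s' y = s y)" for k and s' :: store
  have ev_plus: "eval_expr W s' (Add (var 17) (Const 1)) = f + k + 1" if "I k s'" "k \<le> m" for k s'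
    using that N_eq f m unfolding I_def by (simp add: ev del: ev_del)
  have body: "runs W scan_body s' (basic_cost scan_body) (I (Suc k))" if "I k s'" "k \<le> m" for k s'
  proof (rule runs_basic)
    show "I (Suc k) (basic_run W scan_body s')"
      using that ev_plus[OF that] unfolding I_def scan_body_def by (simp add: eval_Const del: ev_del)
  qed (simp add: scan_body_def)
  have ev_test: "eval_expr W s' scan_test \<noteq> 0 \<longleftrightarrow> f + k + 1 < m \<and> f + k \<notin> C" if "I k s'" "f + k \<le> m - 1" for k s'
  proof -
    have "s' 11 0 = m" "s' 3 (f + k) = of_bool (f + k \<in> C)" "s' 17 0 = f + k"
      using that v m unfolding I_def by auto
    then show ?thesis using ev_plus[OF that(1)] that(2) m unfolding scan_test_def
      by (simp add: eval_And[OF W3] eval_Less eval_Equal eval_Const del: ev_del)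
  qed
  have loop: "runs W (While scan_test scan_body) s0
      ((lowest C - f) * (expr_cost scan_test + 1 + basic_cost scan_body) + expr_cost scan_test + 1) (I (lowest C - f))"
    if s0: "I 0 s0" for s0
  proof (rule runs_While)
    show "I 0 s0" by (rule s0)
    show "eval_expr W s' scan_test \<noteq> 0 \<and> runs W scan_body s' (basic_cost scan_body) (I (Suc k))"
      if k: "k < lowest C - f" "I k s'" for k s'
    proof
      show "eval_expr W s' scan_test \<noteq> 0"
        using ev_test[OF k(2)] k(1) lp(2) lp(4)[of "f + k"] by auto
      show "runs W scan_body s' (basic_cost scan_body) (I (Suc k))"
        by (rule body[OF k(2)]) (use k(1) lp(2) in auto)
    qed
    show "eval_expr W s' scan_test = 0" if "I (lowest C - f) s'" for s'
      using ev_test[OF that] lp(1,2,3) by (cases "eval_expr W s' scan_test = 0") auto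
  qed
  have last: "runs W (If (Less (Add (var 17) (Const 1)) (var 11)) scan_body Skip) s' (basic_cost scan_body + 10)
    (\<lambda>s'. s' 17 0 = (if lowest C < m - 1 then lowest C + 1 else m - 1) \<and> (\<forall>y. y \<noteq> 17 \<longrightarrow> s' y = s y))"
    if s': "I (lowest C - f) s'" for s'
  proof (rule runs_basicI)
    have le: "lowest C - f \<le> m" using lp(2) by simp
    have "eval_expr W s' (Less (Add (var 17) (Const 1)) (var 11)) = of_bool (lowest C + 1 < m)"
      using ev_plus[OF s' le] s' v lp(1) unfolding I_def by (simp add: eval_Less eval_Const del: ev_del)
    moreover have "basic_run W scan_body s' = s'(17 := (s' 17)(0 := lowest C + 1))"
      using ev_plus[OF s' le] lp(1) unfolding scan_body_def by (simp add: eval_Const del: ev_del)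
    ultimately show "basic_run W (If (Less (Add (var 17) (Const 1)) (var 11)) scan_body Skip) s' 17 0 =
        (if lowest C < m - 1 then lowest C + 1 else m - 1) \<and>
      (\<forall>y. y \<noteq> 17 \<longrightarrow> basic_run W (If (Less (Add (var 17) (Const 1)) (var 11)) scan_body Skip) s' y = s y)"
      using s' lp(1,2) unfolding I_def by auto
  qed (simp_all add: scan_body_def)
  have "runs W (assign 17 (var 10)) s 4 (I 0)"
    by (rule runs_basicI) (use v in \<open>simp_all add: I_def\<close>)
  then have "runs W scan_bits s (4 + (((lowest C - f) * (expr_cost scan_test + 1 + basic_cost scan_body) + expr_cost scan_test + 1) +
      (basic_cost scan_body + 10))) (\<lambda>s'. s' 17 0 = (if lowest C < m - 1 then lowest C + 1 else m - 1) \<and> (\<forall>y. y \<noteq> 17 \<longrightarrow> s' y = s y))"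
    unfolding scan_bits_def by (rule runs_SeqI) (rule runs_SeqI[OF loop], assumption, rule last)
  then show ?thesis by (rule runs_mono) simp_all
qed

lemma runs_choose_bit:
  assumes C: "C \<subseteq> {f..m}" and s: "ready s a C b"
  shows "runs W choose_bit s (next_cost + (lowest C - f) * next_cost)
    (\<lambda>s'. s' 17 0 = step_bit b a C \<and> (\<forall>y. y \<noteq> 17 \<longrightarrow> s' y = s y))"
proof -
  let ?Q = "\<lambda>s'. s' 17 0 = step_bit b a C \<and> (\<forall>y. y \<noteq> 17 \<longrightarrow> s' y = s y)"
  let ?T = "(lowest C - f) * (expr_cost scan_test + 1 + basic_cost scan_body) + expr_cost scan_test + basic_cost scan_body + 20"
  have v: "s 10 0 = f" "s 11 0 = m" "s 3 m = of_bool (m \<in> C)" "s 13 0 = of_bool b" "s 14 0 = of_bool (polarity a)"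
    using s unfolding ready_def loaded_def stored_def by auto
  have "runs W choose_bit s (expr_cost (Equal (var 13) (Const 0)) + 1 + 4 +
    (expr_cost (Equal (Read 3 (var 11)) (var 14)) + 1 + 4 + ?T)) ?Q"
    unfolding choose_bit_def
  proof (rule runs_If)
    assume "eval_expr W s (Equal (var 13) (Const 0)) \<noteq> 0"
    then have "\<not> b" using v by (simp add: ev del: ev_del split: if_splits)
    then show "runs W (assign 17 (var 11)) s 4 ?Q"
      by (intro runs_basicI) (use v in \<open>simp_all add: step_bit_def\<close>)
  next
    assume "eval_expr W s (Equal (var 13) (Const 0)) = 0"
    then have b: b using v by (simp add: ev del: ev_del split: if_splits)
    have t: "eval_expr W s (Equal (Read 3 (var 11)) (var 14)) = of_bool ((m \<in> C) = polarity a)"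
      using v by (auto simp: ev simp del: ev_del)
    show "runs W (If (Equal (Read 3 (var 11)) (var 14)) (assign 17 (var 10)) scan_bits) s
      (expr_cost (Equal (Read 3 (var 11)) (var 14)) + 1 + 4 + ?T) ?Q"
    proof (rule runs_If)
      assume "eval_expr W s (Equal (Read 3 (var 11)) (var 14)) \<noteq> 0"
      then have "(m \<in> C) = polarity a" unfolding t by simp
      then show "runs W (assign 17 (var 10)) s 4 ?Q"
        by (intro runs_basicI) (use v b in \<open>simp_all add: step_bit_def gray_bit_def\<close>)
    next
      assume "eval_expr W s (Equal (Read 3 (var 11)) (var 14)) = 0"
      then have n: "(m \<in> C) \<noteq> polarity a" unfolding t by simp
      have "loaded s a C b" using s unfolding ready_def by blast
      then show "runs W scan_bits s ?T ?Q"
        by (rule runs_mono[OF runs_scan_bits[OF C]]) (use n b in \<open>auto simp: step_bit_def gray_bit_def\<close>)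
    qed
  qed
  then show ?thesis
  proof (rule runs_mono)
    have "(lowest C - f) * (expr_cost scan_test + 1 + basic_cost scan_body) \<le> (lowest C - f) * next_cost"
      by (intro mult_left_mono) (auto simp: next_cost_def)
    then show "expr_cost (Equal (var 13) (Const 0)) + 1 + 4 +
      (expr_cost (Equal (Read 3 (var 11)) (var 14)) + 1 + 4 + ?T) \<le> next_cost + (lowest C - f) * next_cost"
      by (simp add: next_cost_def)
  qed
qed

lemma weight_le: "a \<in> codes \<Longrightarrow> weight a \<le> N * N"
proof -
  assume a: "a \<in> codes"
  have "weight a \<le> (\<Sum>i\<in>{..m}. N)" unfolding weight_def by (rule sum_mono) (use codes_le_N[OF a] in simp)
  also have "\<dots> = Suc m * N" by simp
  also have "\<dots> \<le> N * N" using N_eq f by (intro mult_right_mono) auto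
  finally show ?thesis .
qed

lemma weight_shift:
  assumes "q \<le> m"
  shows "weight (a(q := x)) = weight a + x - a q"
proof -
  have "sum (a(q := x)) {..m} = x + sum (a(q := x)) ({..m} - {q})" using assms by (subst sum.remove[of _ q]) auto
  also have "sum (a(q := x)) ({..m} - {q}) = sum a ({..m} - {q})" by (rule sum.cong) auto
  finally have "sum (a(q := x)) {..m} = x + sum a ({..m} - {q})" .
  moreover have "sum a {..m} = a q + sum a ({..m} - {q})" using assms by (subst sum.remove[of _ q]) auto
  ultimately show ?thesis unfolding weight_def by simp
qed

lemma runs_set_polarity:
  assumes a: "a \<in> codes" and s: "stored s a C"
  shows "runs W set_polarity s (basic_cost set_polarity)
    (\<lambda>s'. s' 14 0 = of_bool (polarity a) \<and> (\<forall>y. y \<noteq> 14 \<longrightarrow> s' y = s y))"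
proof (rule runs_basic)
  show "basic set_polarity" unfolding set_polarity_def by simp
  have v: "s 11 0 = m" "s 2 (m - 1) = a (m - 1)" using s unfolding stored_def by auto
  have le: "2 * (a (m - 1) div 2) \<le> 8 * N" using codes_le_N[OF a, of "m - 1"] by simp
  have r: "eval_expr W s (Read 2 (Sub (var 11) (Const 1))) = a (m - 1)"
    using v by (simp add: eval_Const del: ev_del)
  have "eval_expr W s (Mul (Const 2) (Div (Read 2 (Sub (var 11) (Const 1))) (Const 2))) = 2 * (a (m - 1) div 2)"
  proof (subst eval_Mul)
    have "eval_expr W s (Div (Read 2 (Sub (var 11) (Const 1))) (Const 2)) = a (m - 1) div 2"
      using r by (simp only: eval_expr.simps(6) eval_Const numeral_le_iff) (simp add: eval_Const del: ev_del)
    then show "eval_expr W s (Const 2) * eval_expr W s (Div (Read 2 (Sub (var 11) (Const 1))) (Const 2)) = 2 * (a (m - 1) div 2)"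
      "eval_expr W s (Const 2) * eval_expr W s (Div (Read 2 (Sub (var 11) (Const 1))) (Const 2)) \<le> 8 * N"
      using le by (simp_all add: eval_Const del: ev_del eval_expr.simps)
  qed
  then have p: "eval_expr W s (Sub (Read 2 (Sub (var 11) (Const 1)))
       (Mul (Const 2) (Div (Read 2 (Sub (var 11) (Const 1))) (Const 2)))) = of_bool (odd (a (m - 1)))"
    using r parity_expr[of "a (m - 1)"] by (simp only: eval_expr.simps(4))
  have t: "eval_expr W s (Equal (Read 2 (Sub (var 11) (Const 1))) (Const 1)) = of_bool (a (m - 1) = 1)"
    using r by (simp only: eval_Equal) (simp add: eval_Const del: ev_del)
  have "basic_run W set_polarity s = s(14 := (s 14)(0 := of_bool (polarity a)))"
    unfolding set_polarity_def basic_run.simps t p polarity_def by (simp add: eval_Const del: ev_del)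
  then show "basic_run W set_polarity s 14 0 = of_bool (polarity a) \<and> (\<forall>y. y \<noteq> 14 \<longrightarrow> basic_run W set_polarity s y = s y)"
    by simp
qed

lemma runs_shift:
  assumes st: "(a, C) \<in> states" and s: "ready s a C b" and mk: "marked b a C (s 15 0) (s 16 0)"
  shows "runs W (shift_entry ;; set_polarity ;; rebuild) s (next_cost + 500 * (N * N))
    (\<lambda>s'. ready s' (shift_code a (s 15 0) (s 16 0)) C b \<and> s' 21 = s 21)"
proof -
  define q v where "q = s 15 0" and "v = s 16 0"
  have t: "tree_edge a q v" using mk unfolding q_def v_def marked_def by blast
  have a: "a \<in> codes" and C: "C \<subseteq> {f..m}" using st unfolding states_def by auto
  let ?a = "shift_code a q v"
  have a': "?a \<in> codes" by (rule shift_code_codes[OF a t])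
  have q: "1 \<le> q" "q \<le> m" "a q = v \<or> a q + 1 = v" using t unfolding tree_edge_def by auto
  have x: "?a q = 2 * v - 1 - a q" "?a = a(q := 2 * v - 1 - a q)" unfolding shift_code_def by auto
  have sv: "s 0 0 = N" "s 10 0 = f" "s 11 0 = m" "\<And>i. i \<le> m \<Longrightarrow> s 2 i = a i" "\<And>i. i \<le> m \<Longrightarrow> s 3 i = of_bool (i \<in> C)"
    "s 12 0 = card (C - {m})" "s 13 0 = of_bool b" "s 22 0 = weight a"
    using s unfolding ready_def loaded_def stored_def by auto
  define s1 s2 s3 where "s1 = s(9 := (s 9)(0 := ?a q))" and "s2 = s1(22 := (s1 22)(0 := weight ?a))"
    and "s3 = s2(2 := (s2 2)(q := ?a q))"
  have r1: "basic_run W (assign 9 (Sub (Sub (Mul (Const 2) (var 16)) (Const 1)) (Read 2 (var 15)))) s = s1"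
  proof -
    have "2 * v \<le> 8 * N" using q(3) codes_le_N[OF a q(2)] N_ge by auto
    then show ?thesis using sv(4) q x q_def v_def unfolding s1_def by (simp add: ev del: ev_del)
  qed
  have r2: "basic_run W (assign 22 (Sub (Add (var 22) (var 9)) (Read 2 (var 15)))) s1 = s2"
  proof -
    have "?a q \<le> N" "weight a \<le> N * N" using codes_le_N[OF a' q(2)] weight_le[OF a] by auto
    then have "(weight a + ?a q) mod W = weight a + ?a q" using N_le_NN by (intro mod_W) linarith
    moreover have "weight ?a = weight a + ?a q - a q" using weight_shift[OF q(2), of a "?a q"] x by simp
    ultimately show ?thesis
      using sv(4)[OF q(2)] sv(8) q_def unfolding s2_def s1_def by (simp add: eval_Const del: eval_expr.simps(1))
  qed
  have r3: "basic_run W (Write 2 (var 15) (var 9)) s2 = s3"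
    using q_def unfolding s3_def s2_def s1_def by (simp add: eval_Const del: ev_del)
  have run: "basic_run W shift_entry s = s3" unfolding shift_entry_def basic_run.simps(2) r1 r2 r3 ..
  have st3: "stored s3 ?a C" using sv x unfolding stored_def s3_def s2_def s1_def by simp
  have "runs W (shift_entry ;; set_polarity ;; rebuild) s
    (basic_cost shift_entry + (basic_cost set_polarity + 500 * (N * N))) (\<lambda>s'. ready s' ?a C b \<and> s' 21 = s 21)"
  proof (rule runs_Seq, rule runs_basic, unfold run)
    show "basic shift_entry" unfolding shift_entry_def by simp
    show "runs W (set_polarity ;; rebuild) s3 (basic_cost set_polarity + 500 * (N * N)) (\<lambda>s'. ready s' ?a C b \<and> s' 21 = s 21)"
    proof (rule runs_SeqI[OF runs_set_polarity[OF a' st3]])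
      fix s4 assume s4: "s4 14 0 = of_bool (polarity ?a) \<and> (\<forall>y. y \<noteq> 14 \<longrightarrow> s4 y = s3 y)"
      then have st4: "stored s4 ?a C" using st3 unfolding stored_def by simp
      show "runs W rebuild s4 (500 * (N * N)) (\<lambda>s'. ready s' ?a C b \<and> s' 21 = s 21)"
      proof (rule runs_mono[OF runs_rebuild[OF a' st4]])
        fix s5 assume s5: "drawn s5 ?a C \<and> (\<forall>y. y \<notin> {1, 4, 5, 6, 7, 8, 9} \<longrightarrow> s5 y = s4 y)"
        then have fr: "s5 y = s4 y" if "y \<notin> {1, 4, 5, 6, 7, 8, 9}" for y using that by blast
        have "stored s5 ?a C" using st4 fr unfolding stored_def by simp
        moreover have "s5 12 = s 12" "s5 13 = s 13" "s5 22 0 = weight ?a" "s5 21 = s 21" "s5 14 0 = of_bool (polarity ?a)"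
          using fr s4 unfolding s3_def s2_def s1_def by simp_all
        ultimately show "ready s5 ?a C b \<and> s5 21 = s 21" using s5 sv unfolding ready_def loaded_def by simp
      qed simp
    qed
  qed
  then show ?thesis unfolding q_def[symmetric] v_def[symmetric]
    by (rule runs_mono) (simp_all add: next_cost_def)
qed

lemma marked_few_bits:
  assumes "C \<subseteq> {f..m}" "marked b a C q v"
  shows "card (C - {m}) \<le> 2"
proof -
  have fin: "finite C" using assms(1) finite_subset by blast
  show ?thesis
  proof (cases b)
    case True
    then have "C - {f} \<subseteq> {m - 1, m}" using assms(2) unfolding marked_def mark1_def by (auto split: if_splits)
    then have "C - {m} \<subseteq> {m - 1, f}" by auto
    then have "card (C - {m}) \<le> card {m - 1, f}" by (intro card_mono) auto
    also have "\<dots> \<le> 2" by (simp add: card_insert_if)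
    finally show ?thesis .
  next
    case False
    then have "C - {m} \<subseteq> {q - 1} \<or> C - {m} \<subseteq> {q, q + 1}"
      using assms(2) unfolding marked_def mark0_def by (auto split: if_splits)
    then have "card (C - {m}) \<le> card {q - 1} \<or> card (C - {m}) \<le> card {q, q + 1}" by (meson card_mono finite.intros)
    then show ?thesis by auto
  qed
qed

definition step_cost :: "nat set \<Rightarrow> nat" where
  "step_cost C = 4 * next_cost * (1 + (lowest C - f) + of_bool (card (C - {m}) \<le> 2) * (N * N))"

lemma runs_next_state:
  assumes st: "(a, C) \<in> states" and s: "ready s a C b"
  shows "runs W next_state s (step_cost C)
    (\<lambda>s'. ready s' (fst (step b (a, C))) (snd (step b (a, C))) (\<not> b) \<and> s' 21 = s 21)"
proof -
  have a: "a \<in> codes" and C: "C \<subseteq> {f..m}" using st unfolding states_def by auto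
  let ?few = "card (C - {m}) \<le> 2" and ?w = "of_bool (card (C - {m}) \<le> 2) * (N * N)"
  let ?find = "If (Less (var 12) (Const 3)) find_edge (assign 15 (Const 0))"
  let ?move = "If (var 15) (shift_entry ;; set_polarity ;; rebuild) (choose_bit ;; toggle_bit)"
  let ?R = "\<lambda>s'. ready s' (fst (step b (a, C))) (snd (step b (a, C))) b \<and> s' 21 = s 21"
  have l: "loaded s a C b" using s unfolding ready_def by blast
  have w: "eval_expr W s (Less (var 12) (Const 3)) = of_bool ?few"
    using l unfolding loaded_def by (auto simp: ev simp del: ev_del)
  have find: "runs W ?find s (6 + 4 + next_cost * ?w)
    (\<lambda>s'. find_result a C b (Suc m) s' \<and> (\<forall>y. y \<notin> {15, 16, 18, 19, 23} \<longrightarrow> s' y = s y))" (is "runs _ _ _ _ ?F")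
  proof -
    have "runs W find_edge s (next_cost * ?w) ?F" if "?few"
    proof (rule runs_mono[OF runs_find_edge[OF a C l]])
      have "(basic_cost find_body + 40) * N \<le> next_cost * (N * N)"
        using N_le_NN by (intro mult_mono) (auto simp: next_cost_def)
      then show "(basic_cost find_body + 40) * N \<le> next_cost * ?w" using that by simp
    qed
    moreover have "runs W (assign 15 (Const 0)) s 4 ?F" if "\<not> ?few"
    proof (rule runs_basicI)
      have "\<not> marked b a C q v" for q v using marked_few_bits[OF C] that by blast
      then show "?F (basic_run W (assign 15 (Const 0)) s)" unfolding find_result_def by simp
    qed simp_all
    ultimately have "runs W ?find s (expr_cost (Less (var 12) (Const 3)) + 1 + next_cost * ?w + 4) ?F"
      by (intro runs_If) (use w in auto)
    then show ?thesis by (rule runs_mono) auto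
  qed
  have move: "runs W ?move s' (3 + (next_cost + 500 * ?w) + (next_cost + (lowest C - f) * next_cost + next_cost)) ?R"
    if s': "?F s'" for s'
  proof -
    have fr: "s' y = s y" if "y \<notin> {15, 16, 18, 19, 23}" for y using s' that by blast
    have rd: "ready s' a C b" using s fr unfolding ready_def loaded_def stored_def drawn_def by simp
    have 21: "s' 21 = s 21" using fr by simp
    have "runs W ?move s' (expr_cost (var 15) + 1 + (next_cost + 500 * ?w) + (next_cost + (lowest C - f) * next_cost + next_cost)) ?R"
    proof (rule runs_If)
      assume "eval_expr W s' (var 15) \<noteq> 0"
      then have "s' 15 0 \<noteq> 0" by simp
      then have mk: "marked b a C (s' 15 0) (s' 16 0)" using s' unfolding find_result_def by (auto split: if_splits)
      have "?few" by (rule marked_few_bits[OF C mk])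
      then show "runs W (shift_entry ;; set_polarity ;; rebuild) s' (next_cost + 500 * ?w) ?R"
        using runs_shift[OF st rd mk] step_marked[OF mk] 21 by simp
    next
      assume "eval_expr W s' (var 15) = 0"
      then have z: "s' 15 0 = 0" by simp
      have n: "\<not> marked b a C q v" for q v
      proof
        assume mk: "marked b a C q v"
        then have "q < Suc m" using marked_bounds[OF mk] by simp
        then have "\<exists>q<Suc m. \<exists>v. marked b a C q v" using mk by blast
        then have "marked b a C (s' 15 0) (s' 16 0)" using s' unfolding find_result_def by presburger
        then show False using marked_bounds z by fastforce
      qed
      have e: "step b (a, C) = (a, toggle (step_bit b a C) C)" by (rule step_unmarked[OF n])
      show "runs W (choose_bit ;; toggle_bit) s' (next_cost + (lowest C - f) * next_cost + next_cost) ?R"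
      proof (rule runs_SeqI[OF runs_choose_bit[OF C rd]])
        fix s2 assume s2: "s2 17 0 = step_bit b a C \<and> (\<forall>y. y \<noteq> 17 \<longrightarrow> s2 y = s' y)"
        have rd2: "ready s2 a C b" using rd s2 unfolding ready_def loaded_def stored_def drawn_def by simp
        show "runs W toggle_bit s2 next_cost ?R"
        proof (rule runs_mono[OF runs_toggle_bit[OF st rd2]])
          show "s2 17 0 = step_bit b a C" using s2 by blast
          show "f \<le> step_bit b a C" "step_bit b a C \<le> m" by (rule step_bit_bounds)+
          show "?R s3" if "ready s3 a (toggle (step_bit b a C) C) b \<and> s3 21 = s2 21" for s3
            using that e s2 21 by simp
        qed (simp add: next_cost_def)
      qed
    qed
    then show ?thesis by (rule runs_mono) auto
  qed
  have flag: "runs W (assign 13 (Sub (Const 1) (var 13))) s' 6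
    (\<lambda>s'. ready s' (fst (step b (a, C))) (snd (step b (a, C))) (\<not> b) \<and> s' 21 = s 21)" if "?R s'" for s'
  proof (rule runs_basicI)
    have "basic_run W (assign 13 (Sub (Const 1) (var 13))) s' = s'(13 := (s' 13)(0 := of_bool (\<not> b)))"
      using that unfolding ready_def loaded_def by (simp add: ev del: ev_del)
    then show "ready (basic_run W (assign 13 (Sub (Const 1) (var 13))) s') (fst (step b (a, C))) (snd (step b (a, C))) (\<not> b) \<and>
      basic_run W (assign 13 (Sub (Const 1) (var 13))) s' 21 = s 21"
      using that unfolding ready_def loaded_def stored_def drawn_def by simp
  qed simp_all
  have "runs W next_state s ((6 + 4 + next_cost * ?w) +
    ((3 + (next_cost + 500 * ?w) + (next_cost + (lowest C - f) * next_cost + next_cost)) + 6))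
    (\<lambda>s'. ready s' (fst (step b (a, C))) (snd (step b (a, C))) (\<not> b) \<and> s' 21 = s 21)"
    unfolding next_state_def by (rule runs_SeqI[OF find]) (rule runs_SeqI[OF move], assumption, rule flag)
  then show ?thesis
  proof (rule runs_mono)
    \<comment> \<open>A step pays \<open>next_cost\<close> at most three times besides small tests
      and the scan. The summand 1000 in \<open>next_cost\<close> covers these tests as well as the
      factor 500 of \<open>rebuild\<close>.\<close>
    have "1000 \<le> next_cost" unfolding next_cost_def by simp
    moreover from this have "500 * ?w \<le> next_cost * ?w" by (intro mult_right_mono) auto
    moreover have "step_cost C = 4 * next_cost + 4 * ((lowest C - f) * next_cost) + 4 * (next_cost * ?w)"
      unfolding step_cost_def by (simp add: algebra_simps)
    ultimately show "(6 + 4 + next_cost * ?w) +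
      ((3 + (next_cost + 500 * ?w) + (next_cost + (lowest C - f) * next_cost + next_cost)) + 6) \<le> step_cost C"
      by linarith
  qed
qed

end

section \<open>The program\<close>

text \<open>
  The weight identifies the starting code in constant time: all other codes with the same last entry are
  heavier.
\<close>

definition check_start :: com where
  "check_start = assign 20 (Equal (And (Equal (Read 2 (var 11)) (var 21))
     (And (Equal (var 22) (Sub (Add (var 11) (var 21)) (var 10)))
     (And (Read 3 (var 11)) (And (Equal (Read 3 (Sub (var 11) (Const 1))) (Sub (Const 3) (var 21)))
       (Equal (var 12) (Sub (Const 3) (var 21))))))) (Const 0))"

definition main_loop :: com where
  "main_loop = While (var 20) (Visit ;; next_state ;; check_start)"

definition clear_code :: com where
  "clear_code = assign 7 (Const 0) ;; While (Less (var 7) (Add (var 11) (Const 1)))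
     ((Write 2 (var 7) (Const 1) ;; Write 3 (var 7) (Const 0)) ;; assign 7 (Add (var 7) (Const 1)))"

text \<open>The polarity is 0 for both values of \<open>p\<close>, as the entry at
  \<open>m - 1\<close> is 1. The constant \<open>3 - p\<close> is bit \<open>m - 1\<close> and at
  the same time the number of set bits other than \<open>m\<close>.\<close>

definition set_start :: "nat \<Rightarrow> com" where
  "set_start p = Write 2 (Const 0) (Sub (Const 1) (var 10)) ;; Write 2 (var 11) (Const p) ;;
     Write 3 (var 11) (Const 1) ;; Write 3 (Sub (var 11) (Const 1)) (Const (3 - p)) ;;
     assign 12 (Const (3 - p)) ;; assign 13 (Const 0) ;; assign 14 (Const 0) ;;
     assign 22 (Sub (Add (var 11) (Const p)) (var 10)) ;; assign 20 (Const 1) ;; assign 21 (Const p)"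

definition init_phase :: "nat \<Rightarrow> com" where
  "init_phase p = clear_code ;; set_start p ;; rebuild"

definition read_input :: com where
  "read_input = assign 10 (Sub r_N (Mul (Const 2) (Div r_N (Const 2)))) ;; assign 11 (Div (Sub r_N (Const 3)) (Const 2))"

definition program :: com where
  "program = read_input ;; (init_phase 2 ;; main_loop) ;; (init_phase 3 ;; main_loop)"

lemma set_vwalk_arcs: "successively (\<lambda>x y. (x, y) \<in> E) p \<Longrightarrow> set (vwalk_arcs p) \<subseteq> E"
  by (induction p rule: vwalk_arcs.induct) auto

definition visit_cost :: nat where
  "visit_cost = basic_cost check_start + 10"

definition init_cost :: nat where
  "init_cost = basic_cost (set_start 2) + basic_cost (set_start 3) + basic_cost read_input + 1000"

section \<open>Starting states and correctness of the loop\<close>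

context machine
begin

text \<open>The first tour closes with the step of kind \<open>True\<close> between its last node
  and its start. From \<open>start 2\<close> this step flips bit \<open>m - 1\<close>, so the tour
  ends at \<open>(start_code 2, {m})\<close>, from which the omitted edge with \<open>q = m\<close>
  and \<open>v = 3\<close> leads to \<open>start 3\<close>.\<close>

definition start :: "nat \<Rightarrow> (nat \<Rightarrow> nat) \<times> nat set" where
  "start p = (start_code p, if p = 2 then {m - 1, m} else {m})"

definition tri :: "(nat \<Rightarrow> nat) \<times> nat set \<Rightarrow> nat set set" where
  "tri s = decode f (fst s) (snd s) m"

lemma start_states: "p = 2 \<or> p = 3 \<Longrightarrow> start p \<in> states"
  using start_code_codes[of p] m unfolding start_def states_def by auto

lemma weight_start_code: "weight (start_code p) = m + p - f"
proof -
  have "{..m} = insert 0 (insert m {1..<m})" using m by auto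
  moreover have "sum (start_code p) {1..<m} = sum (\<lambda>_. 1) {1..<m}"
    by (rule sum.cong) (auto simp: start_code_def)
  ultimately have "weight (start_code p) = (1 - f) + (p + (m - 1))"
    using m unfolding weight_def by (simp add: start_code_def)
  then show ?thesis using m f by auto
qed

text \<open>Entries cannot be smaller than those of \<open>start_code p\<close> once the last one is
  \<open>p\<close>, so equal weight means equal codes. For \<open>p = 2\<close> the count 1 and the
  membership of \<open>m - 1\<close> determine the remaining bits; for \<open>p = 3\<close> the
  count 0 does.\<close>

lemma start_iff:
  assumes st: "(a, C) \<in> states" and p: "p = 2 \<or> p = 3"
  shows "a m = p \<and> weight a = m + p - f \<and> m \<in> C \<and> of_bool (m - 1 \<in> C) = 3 - p \<and> card (C - {m}) = 3 - p
    \<longleftrightarrow> (a, C) = start p"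
proof
  assume r: "(a, C) = start p"
  have "m - 1 \<noteq> m" using m by simp
  then show "a m = p \<and> weight a = m + p - f \<and> m \<in> C \<and> of_bool (m - 1 \<in> C) = 3 - p \<and> card (C - {m}) = 3 - p"
    using r p m weight_start_code[of p] unfolding start_def by (auto simp: start_code_def insert_Diff_if)
next
  assume l: "a m = p \<and> weight a = m + p - f \<and> m \<in> C \<and> of_bool (m - 1 \<in> C) = 3 - p \<and> card (C - {m}) = 3 - p"
  have a: "a \<in> codes" and C: "C \<subseteq> {f..m}" using st unfolding states_def by auto
  have ge: "start_code p i \<le> a i" if "i \<le> m" for i
    using codes_ge1[OF a, of i] codes_0[OF a] l that unfolding start_code_def by auto
  have "a = start_code p"
  proof (rule ccontr)
    assume "a \<noteq> start_code p"
    then obtain i where i: "a i \<noteq> start_code p i" by blast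
    have im: "i \<le> m"
    proof (rule ccontr)
      assume "\<not> i \<le> m"
      then show False using i a unfolding codes_def start_code_def by auto
    qed
    then have "start_code p i < a i" using ge[OF im] i by simp
    then have "weight (start_code p) < weight a"
      unfolding weight_def by (intro sum_strict_mono_ex1) (use ge im in auto)
    then show False using weight_start_code l by simp
  qed
  moreover have "C = (if p = 2 then {m - 1, m} else {m})"
  proof -
    have fin: "finite (C - {m})" using C finite_subset by blast
    show ?thesis
    proof (cases "p = 2")
      case True
      then have "m - 1 \<in> C" using l by (cases "m - 1 \<in> C") auto
      then have "m - 1 \<in> C - {m}" "card (C - {m}) = 1" using l m True by auto
      then have "C - {m} = {m - 1}" by (metis card_1_singletonE singletonD)
      then show ?thesis using True l by auto
    next
      case False
      then have "C - {m} = {}" using l p fin by auto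
      then show ?thesis using False l by auto
    qed
  qed
  ultimately show "(a, C) = start p" unfolding start_def by simp
qed

lemma runs_check_start:
  assumes st: "(a, C) \<in> states" and s: "ready s a C b" and p: "p = 2 \<or> p = 3" "s 21 0 = p"
  shows "runs W check_start s (basic_cost check_start) (\<lambda>s'. ready s' a C b \<and> s' 21 = s 21 \<and>
    s' 20 0 = of_bool ((a, C) \<noteq> start p))"
proof (rule runs_basic)
  show "basic check_start" unfolding check_start_def by simp
  have v: "s 10 0 = f" "s 11 0 = m" "s 2 m = a m" "s 3 m = of_bool (m \<in> C)" "s 3 (m - 1) = of_bool (m - 1 \<in> C)"
    "s 12 0 = card (C - {m})" "s 22 0 = weight a"
    using s unfolding ready_def loaded_def stored_def by auto
  define w where "w = card (C - {m})"
  have bd: "m + p \<le> 8 * N" using p N_eq f by auto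
  let ?e = "Equal (And (Equal (Read 2 (var 11)) (var 21))
     (And (Equal (var 22) (Sub (Add (var 11) (var 21)) (var 10)))
     (And (Read 3 (var 11)) (And (Equal (Read 3 (Sub (var 11) (Const 1))) (Sub (Const 3) (var 21)))
       (Equal (var 12) (Sub (Const 3) (var 21))))))) (Const 0)"
  have "eval_expr W s ?e = of_bool (\<not> (a m = p \<and> weight a = m + p - f \<and> m \<in> C \<and> of_bool (m - 1 \<in> C) = 3 - p \<and> w = 3 - p))"
    using v(1-5,7) v(6)[folded w_def] p(2) bd by (simp add: ev del: ev_del)
  then have e: "eval_expr W s ?e = of_bool ((a, C) \<noteq> start p)" unfolding w_def start_iff[OF st p(1)] .
  have "basic_run W check_start s = s(20 := (s 20)(0 := of_bool ((a, C) \<noteq> start p)))"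
    unfolding check_start_def basic_run.simps e by (simp add: eval_Const del: ev_del)
  then show "ready (basic_run W check_start s) a C b \<and> basic_run W check_start s 21 = s 21 \<and>
    basic_run W check_start s 20 0 = of_bool ((a, C) \<noteq> start p)"
    using s unfolding ready_def loaded_def stored_def drawn_def by simp
qed

text \<open>The kind of the next step is the parity of the index, which register 13 reproduces
  without the index being stored. The starting node is compared only after a step, so the loop does
  not stop at once but at the first return, at time \<open>M\<close>.\<close>

lemma exec_main_loop:
  assumes p: "p = 2 \<or> p = 3" and inS: "\<And>i. w i \<in> states" and succ: "\<And>i. w (Suc i) = step (odd i) (w i)"
    and M: "\<And>i. 0 < i \<Longrightarrow> i < M \<Longrightarrow> w i \<noteq> start p" "w M = start p"
  shows "i \<le> M \<Longrightarrow> ready s (fst (w i)) (snd (w i)) (odd i) \<Longrightarrow> s 21 0 = p \<Longrightarrow> s 20 0 = of_bool (i < M) \<Longrightarrow>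
    \<exists>s' vs t. exec W main_loop s s' vs t \<and> map (stored_triangulation N) vs = map (tri \<circ> w) [i..<M] \<and>
      t \<le> (\<Sum>j\<in>{i..<M}. step_cost (snd (w j)) + visit_cost) + 3 \<and>
      s' 0 0 = N \<and> s' 10 0 = f \<and> s' 11 0 = m"
proof (induction "M - i" arbitrary: i s)
  case 0
  then have z: "eval_expr W s (var 20) = 0" "i = M" by auto
  have "s 0 0 = N \<and> s 10 0 = f \<and> s 11 0 = m" using 0 unfolding ready_def loaded_def stored_def by blast
  then show ?case using exec.WhileFalse[OF z(1), of "Visit ;; next_state ;; check_start"] z(2)
    unfolding main_loop_def by (intro exI[of _ s] exI[of _ "[]"] exI[of _ 3]) (auto simp: numeral_eq_Suc)
next
  case (Suc k)
  then have i: "i < M" by simp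
  have nz: "eval_expr W s (var 20) \<noteq> 0" using Suc.prems i by simp
  obtain a C where aC: "w i = (a, C)" by (cases "w i")
  have st: "(a, C) \<in> states" using inS[of i] aC by simp
  have a: "a \<in> codes" using st unfolding states_def by blast
  have rd: "ready s a C (odd i)" using Suc.prems aC by simp
  obtain s1 t1 where 1: "exec W next_state s s1 [] t1" "t1 \<le> step_cost C"
    "ready s1 (fst (w (Suc i))) (snd (w (Suc i))) (odd (Suc i))" "s1 21 = s 21"
    using runs_next_state[OF st rd] unfolding runs_def succ[of i] aC by auto
  have st1: "(fst (w (Suc i)), snd (w (Suc i))) \<in> states" using inS[of "Suc i"] by simp
  have "s1 21 0 = p" using 1 Suc.prems by simp
  then obtain s2 t2 where 2: "exec W check_start s1 s2 [] t2" "t2 \<le> basic_cost check_start"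
    "ready s2 (fst (w (Suc i))) (snd (w (Suc i))) (odd (Suc i))" "s2 21 = s1 21"
    "s2 20 0 = of_bool (w (Suc i) \<noteq> start p)"
    using runs_check_start[OF st1 1(3) p] unfolding runs_def by auto
  have go: "s2 20 0 = of_bool (Suc i < M)"
    using 2(5) M(1)[of "Suc i"] M(2) i by (cases "Suc i = M") auto
  obtain s' vs t where 3: "exec W main_loop s2 s' vs t" "map (stored_triangulation N) vs = map (tri \<circ> w) [Suc i..<M]"
    "t \<le> (\<Sum>j\<in>{Suc i..<M}. step_cost (snd (w j)) + visit_cost) + 3" "s' 0 0 = N \<and> s' 10 0 = f \<and> s' 11 0 = m"
  proof -
    have "k = M - Suc i" "Suc i \<le> M" "s2 21 0 = p" using Suc.hyps(2) i 2(4) \<open>s1 21 0 = p\<close> by auto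
    then show ?thesis using Suc.hyps(1)[of "Suc i" s2] 2(3) go that by blast
  qed
  have body: "exec W (Visit ;; next_state ;; check_start) s s2 ([s] @ ([] @ [])) (1 + (t1 + t2))"
    by (intro exec.Seq[OF exec.Visit] exec.Seq[OF 1(1) 2(1)])
  have ex: "exec W main_loop s s' (([s] @ ([] @ [])) @ vs) (expr_cost (var 20) + 1 + (1 + (t1 + t2)) + t)"
    using exec.WhileTrue[OF nz body] 3(1) unfolding main_loop_def by blast
  have "stored_triangulation N s = tri (w i)"
    using stored_triangulation_drawn[OF a, of s C] rd aC unfolding ready_def tri_def by simp
  then have "map (stored_triangulation N) (([s] @ ([] @ [])) @ vs) = map (tri \<circ> w) [i..<M]"
    using 3(2) i by (simp add: upt_conv_Cons)
  moreover have "expr_cost (var 20) + 1 + (1 + (t1 + t2)) + t \<le> (\<Sum>j\<in>{i..<M}. step_cost (snd (w j)) + visit_cost) + 3"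
  proof -
    have "(\<Sum>j\<in>{i..<M}. step_cost (snd (w j)) + visit_cost) =
      step_cost C + visit_cost + (\<Sum>j\<in>{Suc i..<M}. step_cost (snd (w j)) + visit_cost)"
      using i aC by (subst sum.atLeast_Suc_lessThan) auto
    then show ?thesis using 3(3) 1(2) 2(2) unfolding visit_cost_def by simp
  qed
  ultimately show ?case using ex 3(4) by blast
qed

lemma runs_clear_code:
  assumes "s 11 0 = m"
  shows "runs W clear_code s (100 * N) (\<lambda>s'. (\<forall>i\<le>m. s' 2 i = 1 \<and> s' 3 i = 0) \<and> (\<forall>y. y \<notin> {2, 3, 7} \<longrightarrow> s' y = s y))"
proof -
  define J where "J i s' \<longleftrightarrow> (\<forall>x<i. s' 2 x = 1 \<and> s' 3 x = 0) \<and> (\<forall>y. y \<notin> {2, 3, 7} \<longrightarrow> s' y = s y)" for i and s' :: store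
  have mN: "m + 2 \<le> N" using N_eq f m by simp
  have "runs W clear_code s (expr_cost (Const 0) + 2 +
      (m + 1 - 0 + 1) * (expr_cost (Add (var 11) (Const 1)) + 8 + 10)) (J (m + 1))"
    unfolding clear_code_def
  proof (rule runs_for)
    show "runs W (Write 2 (var 7) (Const 1) ;; Write 3 (var 7) (Const 0)) s' 8
      (\<lambda>s''. s'' 7 0 = i \<and> J (Suc i) (s''(7 := (s'' 7)(0 := Suc i))))"
      if "0 \<le> i" "i < m + 1" "J i s'" "s' 7 0 = i" for i s'
      by (rule runs_basicI) (use that W_neq in \<open>auto simp: J_def less_Suc_eq\<close>)
    show "eval_expr W s' (Add (var 11) (Const 1)) = m + 1" if "J i s'" for i s'
      using that assms mN unfolding J_def by (simp add: mod_N W_neq)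
    show "m + 1 < W" using mN W_ge N_le_NN by linarith
  qed (auto simp: J_def)
  then show ?thesis
  proof (rule runs_mono)
    have "(m + 1 - 0 + 1) * (expr_cost (Add (var 11) (Const 1)) + 8 + 10) \<le> N * (expr_cost (Add (var 11) (Const 1)) + 8 + 10)"
      using mN by (intro mult_right_mono) auto
    then show "expr_cost (Const 0) + 2 + (m + 1 - 0 + 1) * (expr_cost (Add (var 11) (Const 1)) + 8 + 10) \<le> 100 * N"
      using N_ge by simp
  qed (auto simp: J_def)
qed

lemma runs_init_phase:
  assumes p: "p = 2 \<or> p = 3" and s: "s 0 0 = N" "s 10 0 = f" "s 11 0 = m"
  shows "runs W (init_phase p) s (init_cost * (N * N)) (\<lambda>s'. ready s' (fst (start p)) (snd (start p)) False \<and>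
    s' 21 0 = p \<and> s' 20 0 = 1)"
proof -
  let ?a = "start_code p" and ?C = "snd (start p)"
  have a: "?a \<in> codes" using start_code_codes p by auto
  have mm: "m - 1 \<noteq> m" "m \<noteq> 0" "m - 1 \<noteq> 0" using m by auto
  have "runs W (init_phase p) s (100 * N + (basic_cost (set_start p) + 500 * (N * N)))
    (\<lambda>s'. ready s' ?a ?C False \<and> s' 21 0 = p \<and> s' 20 0 = 1)"
    unfolding init_phase_def
  proof (rule runs_SeqI[OF runs_clear_code])
    show "s 11 0 = m" by (rule s(3))
    fix s1 :: store assume s1: "(\<forall>i\<le>m. s1 2 i = 1 \<and> s1 3 i = 0) \<and> (\<forall>y. y \<notin> {2, 3, 7} \<longrightarrow> s1 y = s y)"
    then have v: "s1 0 0 = N" "s1 10 0 = f" "s1 11 0 = m" "\<And>i. i \<le> m \<Longrightarrow> s1 2 i = 1" "\<And>i. i \<le> m \<Longrightarrow> s1 3 i = 0"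
      using s by auto
    let ?s = "basic_run W (set_start p) s1"
    have bd: "m + p \<le> 8 * N" "p \<le> 8" using p N_eq f by auto
    have r: "?s 0 0 = N" "?s 10 0 = f" "?s 11 0 = m" "?s 2 = (s1 2)(0 := 1 - f, m := p)"
      "?s 3 = (s1 3)(m := 1, m - 1 := 3 - p)" "?s 12 0 = 3 - p" "?s 13 0 = 0" "?s 14 0 = 0"
      "?s 22 0 = m + p - f" "?s 20 0 = 1" "?s 21 0 = p"
      unfolding set_start_def using v(1-3) bd by (simp_all add: ev del: ev_del)
    have mem: "i \<in> ?C \<longleftrightarrow> i = m \<or> i = m - 1 \<and> p = 2" for i unfolding start_def by auto
    have card: "card (?C - {m}) = 3 - p" using p mm unfolding start_def by (auto simp: insert_Diff_if)
    have st: "stored ?s ?a ?C"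
      unfolding stored_def
    proof (intro conjI allI impI)
      fix i assume "i \<le> m"
      then show "?s 2 i = ?a i" using r(4) v(4) mm by (simp add: start_code_def)
      show "?s 3 i = of_bool (i \<in> ?C)" using r(5) v(5) \<open>i \<le> m\<close> mm mem p by auto
    qed (use r in auto)
    show "runs W (set_start p ;; rebuild) s1 (basic_cost (set_start p) + 500 * (N * N))
      (\<lambda>s'. ready s' ?a ?C False \<and> s' 21 0 = p \<and> s' 20 0 = 1)"
    proof (rule runs_Seq, rule runs_basic)
      show "basic (set_start p)" unfolding set_start_def by simp
      show "runs W rebuild ?s (500 * (N * N)) (\<lambda>s'. ready s' ?a ?C False \<and> s' 21 0 = p \<and> s' 20 0 = 1)"
      proof (rule runs_mono[OF runs_rebuild[OF a st]])
        fix s2 assume s2: "drawn s2 ?a ?C \<and> (\<forall>y. y \<notin> {1, 4, 5, 6, 7, 8, 9} \<longrightarrow> s2 y = ?s y)"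
        then have fr: "s2 y = ?s y" if "y \<notin> {1, 4, 5, 6, 7, 8, 9}" for y using that by blast
        have "stored s2 ?a ?C" using st fr unfolding stored_def by simp
        moreover have "\<not> polarity ?a" using mm unfolding polarity_def start_code_def by auto
        ultimately show "ready s2 ?a ?C False \<and> s2 21 0 = p \<and> s2 20 0 = 1"
          using s2 fr r card weight_start_code unfolding ready_def loaded_def by simp
      qed simp
    qed
  qed
  then have run: "runs W (init_phase p) s (100 * N + (basic_cost (set_start p) + 500 * (N * N)))
    (\<lambda>s'. ready s' (fst (start p)) (snd (start p)) False \<and> s' 21 0 = p \<and> s' 20 0 = 1)"
    by (simp add: start_def)
  have "basic_cost (set_start p) + 600 \<le> init_cost" using p unfolding init_cost_def by auto
  then have "(basic_cost (set_start p) + 600) * (N * N) \<le> init_cost * (N * N)" by (intro mult_right_mono) auto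
  moreover have "basic_cost (set_start p) * 1 \<le> basic_cost (set_start p) * (N * N)"
    using N_le_NN N_ge by (intro mult_left_mono) auto
  ultimately have "100 * N + (basic_cost (set_start p) + 500 * (N * N)) \<le> init_cost * (N * N)"
    using N_le_NN unfolding distrib_right by linarith
  with run show ?thesis by (rule runs_mono)
qed

section \<open>Average cost over a hypercube\<close>

lemma sum_powers: "f \<le> k \<Longrightarrow> k \<le> m + 1 \<Longrightarrow> (\<Sum>t\<in>{f..<k}. 2 ^ (m - t)) + 2 ^ (m + 1 - k) = (2::nat) ^ (m + 1 - f)"
proof (induction k rule: dec_induct)
  case (step k)
  have "m + 1 - k = Suc (m - k)" "m + 1 - Suc k = m - k" using step by auto
  then show ?case using step by (simp add: sum.atLeastLessThan_Suc)
qed simp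

text \<open>The number \<open>lowest C - f\<close> is at most the number of \<open>t < m\<close> for
  which \<open>C\<close> misses all of \<open>f, \<dots>, t\<close>. For each \<open>t\<close> there
  are \<open>2 ^ (m - t)\<close> such sets, and the geometric series stays below the size of the
  hypercube.\<close>

lemma sum_lowest: "(\<Sum>C\<in>Pow {f..m}. lowest C - f) \<le> 2 ^ (m + 1 - f)"
proof -
  have "lowest C - f \<le> (\<Sum>t\<in>{f..<m}. of_bool (C \<inter> {f..t} = {}))" for C
  proof -
    have "lowest C - f = card {f..<lowest C}" by simp
    also have "\<dots> \<le> card ({f..<m} \<inter> {t. C \<inter> {f..t} = {}})"
    proof (rule card_mono)
      show "{f..<lowest C} \<subseteq> {f..<m} \<inter> {t. C \<inter> {f..t} = {}}"
      proof
        fix t assume t: "t \<in> {f..<lowest C}"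
        have "t < m" using t lowest_props(2)[of C] by auto
        moreover have "C \<inter> {f..t} = {}" using lowest_props(4)[of _ C] t by fastforce
        ultimately show "t \<in> {f..<m} \<inter> {t. C \<inter> {f..t} = {}}" using t by auto
      qed
    qed simp
    also have "\<dots> = (\<Sum>t\<in>{f..<m}. of_bool (C \<inter> {f..t} = {}))" by simp
    finally show ?thesis .
  qed
  then have "(\<Sum>C\<in>Pow {f..m}. lowest C - f) \<le> (\<Sum>C\<in>Pow {f..m}. \<Sum>t\<in>{f..<m}. of_bool (C \<inter> {f..t} = {}))"
    by (intro sum_mono) auto
  also have "\<dots> = (\<Sum>t\<in>{f..<m}. \<Sum>C\<in>Pow {f..m}. of_bool (C \<inter> {f..t} = {}))" by (rule sum.swap)
  also have "\<dots> = (\<Sum>t\<in>{f..<m}. 2 ^ (m - t))"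
  proof (rule sum.cong)
    fix t assume t: "t \<in> {f..<m}"
    have "(\<Sum>C\<in>Pow {f..m}. of_bool (C \<inter> {f..t} = {})) = card (Pow {f..m} \<inter> {C. C \<inter> {f..t} = {}})" by simp
    also have "Pow {f..m} \<inter> {C. C \<inter> {f..t} = {}} = Pow {Suc t..m}"
    proof
      show "Pow {f..m} \<inter> {C. C \<inter> {f..t} = {}} \<subseteq> Pow {Suc t..m}"
      proof
        fix C assume C: "C \<in> Pow {f..m} \<inter> {C. C \<inter> {f..t} = {}}"
        have "Suc t \<le> x \<and> x \<le> m" if "x \<in> C" for x
        proof -
          have "f \<le> x" "x \<le> m" "x \<notin> {f..t}" using C that by auto
          then show ?thesis by auto
        qed
        then show "C \<in> Pow {Suc t..m}" by auto
      qed
      show "Pow {Suc t..m} \<subseteq> Pow {f..m} \<inter> {C. C \<inter> {f..t} = {}}" using t by fastforce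
    qed
    also have "card (Pow {Suc t..m}) = 2 ^ (m - t)" by (simp add: card_Pow)
    finally show "(\<Sum>C\<in>Pow {f..m}. of_bool (C \<inter> {f..t} = {})) = (2::nat) ^ (m - t)" .
  qed simp
  also have "\<dots> \<le> 2 ^ (m + 1 - f)" using sum_powers[of m] m by linarith
  finally show ?thesis .
qed

lemma card_few_bits: "card {C \<in> Pow {f..m}. card (C - {m}) \<le> 2} \<le> 2 * (N * N)"
proof -
  \<comment> \<open>A set with at most two bits besides \<open>m\<close> is given by two positions,
    where \<open>m\<close> or a repetition stands for a missing bit, and a truth value for bit
    \<open>m\<close>.\<close>
  define F where "F = (\<lambda>(x, y, z). ({x, y} - {m}) \<union> (if z then {m} else {}) :: nat set)"
  have "{C \<in> Pow {f..m}. card (C - {m}) \<le> 2} \<subseteq> F ` ({f..m} \<times> {f..m} \<times> UNIV)"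
  proof
    fix C assume "C \<in> {C \<in> Pow {f..m}. card (C - {m}) \<le> 2}"
    then have C: "C \<subseteq> {f..m}" "card (C - {m}) \<le> 2" by auto
    have fin: "finite (C - {m})" using C(1) finite_subset by blast
    have "\<exists>x\<in>{f..m}. \<exists>y\<in>{f..m}. C - {m} = {x, y} - {m}"
    proof -
      consider "card (C - {m}) = 0" | "card (C - {m}) = 1" | "card (C - {m}) = 2" using C(2) by linarith
      then show ?thesis
      proof cases
        case 1
        then have "C - {m} = {m, m} - {m}" using fin by simp
        moreover have "m \<in> {f..m}" using m by simp
        ultimately show ?thesis by blast
      next
        case 2
        then obtain x where x: "C - {m} = {x}" using card_1_singletonE by blast
        then have xC: "x \<in> C - {m}" by simp
        then have "{x, x} - {m} = {x}" by auto
        then have "C - {m} = {x, x} - {m}" using x by (simp only:)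
        moreover have "x \<in> {f..m}" using xC C(1) by blast
        ultimately show ?thesis by blast
      next
        case 3
        then obtain x y where x: "C - {m} = {x, y}" by (meson card_2_iff)
        then have xC: "x \<in> C - {m}" "y \<in> C - {m}" by simp_all
        then have "{x, y} - {m} = {x, y}" by auto
        then have "C - {m} = {x, y} - {m}" using x by (simp only:)
        moreover have "x \<in> {f..m}" "y \<in> {f..m}" using xC C(1) by blast+
        ultimately show ?thesis by blast
      qed
    qed
    then obtain x y where xy: "x \<in> {f..m}" "y \<in> {f..m}" "C - {m} = {x, y} - {m}" by blast
    have "C = (C - {m}) \<union> (if m \<in> C then {m} else {})" by auto
    then have "C = F (x, y, m \<in> C)" unfolding F_def xy(3) by simp
    then show "C \<in> F ` ({f..m} \<times> {f..m} \<times> UNIV)" using xy by blast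
  qed
  then have "card {C \<in> Pow {f..m}. card (C - {m}) \<le> 2} \<le> card (F ` ({f..m} \<times> {f..m} \<times> UNIV))"
    by (intro card_mono) auto
  also have "\<dots> \<le> card ({f..m} \<times> {f..m} \<times> (UNIV :: bool set))" by (rule card_image_le) simp
  also have "\<dots> = (Suc m - f) * ((Suc m - f) * 2)" by (simp add: card_cartesian_product)
  also have "\<dots> \<le> N * (N * 2)" using N_eq f by (intro mult_mono) auto
  finally show ?thesis by simp
qed

text \<open>The number \<open>N\<close> is about twice the dimension \<open>m + 1 - f\<close>. With
  \<open>d\<close> a quarter of the dimension, rounded down,
  \<open>N \<le> 12 * (d + 1) \<le> 12 * 2 ^ d\<close>, and the constant is the fourth power of 12.
  The fourth power of \<open>N\<close> combines the number of nodes with few bits and the work at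
  each of them.\<close>

lemma N_power_le: "(N * N) * (N * N) \<le> 20736 * 2 ^ (m + 1 - f)"
proof -
  define d where "d = (m + 1 - f) div 4"
  have "m + 1 - f < 4 * (d + 1)" unfolding d_def by simp
  moreover have "N \<le> 2 * (m + 1 - f) + 3" using N_eq f m by auto
  ultimately have "N \<le> 12 * (d + 1)" using m by linarith
  also have "\<dots> \<le> 12 * 2 ^ d" using Suc_leI[OF less_exp[of d]] by (intro mult_left_mono) auto
  finally have n: "N \<le> 12 * 2 ^ d" .
  then have "(N * N) * (N * N) \<le> ((12 * 2 ^ d) * (12 * 2 ^ d)) * ((12 * 2 ^ d) * (12 * 2 ^ d))"
    by (intro mult_mono) auto
  also have "\<dots> = 20736 * 2 ^ (4 * d)"
  proof -
    have "4 * d = d + (d + (d + d))" by simp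
    then have "(2::nat) ^ (4 * d) = 2 ^ d * (2 ^ d * (2 ^ d * 2 ^ d))" by (simp only: power_add)
    then show ?thesis by simp
  qed
  also have "\<dots> \<le> 20736 * 2 ^ (m + 1 - f)" unfolding d_def by (intro mult_left_mono power_increasing) auto
  finally show ?thesis .
qed

lemma NN_le: "N * N \<le> 20736 * 2 ^ (m + 1 - f)"
proof -
  have "N * N * 1 \<le> (N * N) * (N * N)" using N_le_NN N_ge by (intro mult_left_mono) auto
  then show ?thesis using N_power_le by linarith
qed

lemma sum_step_cost: "(\<Sum>C\<in>Pow {f..m}. step_cost C + visit_cost) \<le> (400000 * next_cost + visit_cost) * 2 ^ (m + 1 - f)"
proof -
  let ?P = "2 ^ (m + 1 - f) :: nat"
  have card: "card (Pow {f..m}) = ?P" by (simp add: card_Pow)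
  have "(\<Sum>C\<in>Pow {f..m}. of_bool (card (C - {m}) \<le> 2) * (N * N)) =
      card {C \<in> Pow {f..m}. card (C - {m}) \<le> 2} * (N * N)"
  proof -
    have "{C \<in> Pow {f..m}. card (C - {m}) \<le> 2} = Pow {f..m} \<inter> {C. card (C - {m}) \<le> 2}" by blast
    then show ?thesis by (simp add: sum_distrib_right[symmetric])
  qed
  also have "\<dots> \<le> 2 * (N * N) * (N * N)" using card_few_bits by (intro mult_right_mono) auto
  also have "\<dots> \<le> 41472 * ?P" using N_power_le by (simp add: mult.assoc)
  finally have few: "(\<Sum>C\<in>Pow {f..m}. of_bool (card (C - {m}) \<le> 2) * (N * N)) \<le> 41472 * ?P" .
  have "(\<Sum>C\<in>Pow {f..m}. 1 + (lowest C - f) + of_bool (card (C - {m}) \<le> 2) * (N * N)) =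
    ?P + (\<Sum>C\<in>Pow {f..m}. lowest C - f) + (\<Sum>C\<in>Pow {f..m}. of_bool (card (C - {m}) \<le> 2) * (N * N))"
    using card by (simp only: sum.distrib sum_constant) simp
  \<comment> \<open>In units of the size of the hypercube: 1 for fixed work, 1 for the scans, and
    41472, twice 20736, for search and reconstruction.\<close>
  also have "\<dots> \<le> 50000 * ?P" using few sum_lowest by linarith
  finally have s: "(\<Sum>C\<in>Pow {f..m}. 1 + (lowest C - f) + of_bool (card (C - {m}) \<le> 2) * (N * N)) \<le> 50000 * ?P" .
  have "(\<Sum>C\<in>Pow {f..m}. step_cost C + visit_cost) =
    4 * next_cost * (\<Sum>C\<in>Pow {f..m}. 1 + (lowest C - f) + of_bool (card (C - {m}) \<le> 2) * (N * N)) + ?P * visit_cost"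
    unfolding step_cost_def using card by (simp only: sum.distrib[of "\<lambda>C. 4 * next_cost * _ C"] sum_distrib_left[symmetric] sum_constant) simp
  also have "\<dots> \<le> 4 * next_cost * (50000 * ?P) + ?P * visit_cost"
    using s by (intro add_mono mult_left_mono) auto
  also have "\<dots> \<le> (400000 * next_cost + visit_cost) * ?P" by (simp add: algebra_simps)
  finally show ?thesis .
qed

section \<open>States as nodes, steps as flips, and the whole run\<close>

lemma inj_on_tri: "inj_on tri states"
proof (rule inj_onI)
  fix s s' assume s: "s \<in> states" and s': "s' \<in> states" and e: "tri s = tri s'"
  obtain a C a' C' where eq: "s = (a, C)" "s' = (a', C')" by (cases s, cases s')
  have c: "a \<in> codes" "a' \<in> codes" "C \<subseteq> {f..m}" "C' \<subseteq> {f..m}" using s s' eq unfolding states_def by auto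
  have d: "decode f a C m = decode f a' C' m" using e eq unfolding tri_def by simp
  have i: "a i = a' i \<and> (f \<le> i \<longrightarrow> (i \<in> C \<longleftrightarrow> i \<in> C'))" if "i \<le> m" for i
    using decode_inj[OF f _ _ d that] c unfolding codes_def by blast
  have "a i = a' i" for i
    using i[of i] c(1,2) unfolding codes_def by (cases "i \<le> m") auto
  moreover have "i \<in> C \<longleftrightarrow> i \<in> C'" for i
  proof (cases "f \<le> i \<and> i \<le> m")
    case True then show ?thesis using i[of i] by blast
  next
    case False then show ?thesis using c(3,4) by auto
  qed
  ultimately show "s = s'" using eq by auto
qed

lemma tri_states: "tri ` states = {T. triangulation N T \<and> colorful N T}"
proof
  show "tri ` states \<subseteq> {T. triangulation N T \<and> colorful N T}"
    using decode_triangulation[OF f] N unfolding tri_def states_def codes_def by auto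
  show "{T. triangulation N T \<and> colorful N T} \<subseteq> tri ` states"
  proof
    fix T assume "T \<in> {T. triangulation N T \<and> colorful N T}"
    then obtain a C where aC: "code f m a" "T = decode f a C m" using decode_surj[OF f, of m T] N by auto
    define a' C' where "a' = (\<lambda>i. if i \<le> m then a i else 0)" and "C' = C \<inter> {f..m}"
    have "code f m a'" using aC(1) code_cong[of m a a' f] unfolding a'_def by simp
    then have "(a', C') \<in> states" unfolding states_def codes_def a'_def C'_def by auto
    moreover have "decode f a C m = decode f a' C' m"
      by (rule decode_cong) (use f in \<open>auto simp: a'_def C'_def\<close>)
    ultimately show "T \<in> tri ` states" using aC(2) unfolding tri_def by force
  qed
qed

lemma colorful_graph_verts: "verts (colorful_graph N) = tri ` states"
  unfolding tri_states colorful_graph_def by simp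

lemma colorful_graph_arcs:
  assumes "s \<in> states" "s' \<in> states" "flip N (tri s) (tri s')"
  shows "(tri s, tri s') \<in> arcs_ends (colorful_graph N)"
proof -
  have T: "triangulation N (tri s) \<and> colorful N (tri s)" "triangulation N (tri s') \<and> colorful N (tri s')"
    using assms(1,2) tri_states by blast+
  let ?e = "(tri s, tri s')"
  have "?e \<in> arcs (colorful_graph N)" "tail (colorful_graph N) ?e = tri s" "head (colorful_graph N) ?e = tri s'"
    using T assms(3) unfolding colorful_graph_def associahedron_def by simp_all
  then show ?thesis unfolding arcs_ends_conv by (metis (no_types, lifting) image_eqI)
qed

lemma step_arc: "s \<in> states \<Longrightarrow> (tri s, tri (step b s)) \<in> arcs_ends (colorful_graph N)"
proof -
  assume s: "s \<in> states"
  obtain a C a' C' where eq: "s = (a, C)" "step b s = (a', C')" by (cases s, cases "step b s")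
  have "flip N (tri s) (tri (step b s))" using step_flip[of a C b a' C'] s eq N unfolding tri_def by simp
  moreover have "step b s \<in> states" using s fpf_involution_step[of b] unfolding fpf_involution_def by blast
  ultimately show ?thesis using s colorful_graph_arcs by blast
qed

abbreviation tour :: "nat \<Rightarrow> nat \<Rightarrow> (nat \<Rightarrow> nat) \<times> nat set" where
  "tour p \<equiv> walk (step False) (step True) (start p)"

lemma start_descendants: "start 2 \<in> descendants (start_code 1)" "start 3 \<in> descendants (start_code 3)"
proof -
  have "tree_edge (start_code 2) m (start_code 2 m)"
    using m unfolding tree_edge_def linear_below_def start_code_def by auto
  then have "parent (start_code 2) = (start_code 2)(m := start_code 2 m - 1)" by (rule parent_eq)
  also have "\<dots> = start_code 1" using m by (auto simp: start_code_def fun_eq_iff)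
  finally have "(parent ^^ 1) (start_code 2) = start_code 1" by simp
  then show "start 2 \<in> descendants (start_code 1)"
    using start_states[of 2] unfolding descendants_def start_def by blast
  have "(parent ^^ 0) (start_code 3) = start_code 3" by simp
  then show "start 3 \<in> descendants (start_code 3)"
    using start_states[of 3] unfolding descendants_def start_def by blast
qed

text \<open>This is the edge left out of the forest. At \<open>{m}\<close> its bit conditions hold,
  as 3 is odd: bit \<open>m\<close> is set and bit \<open>m - 1\<close> is not. The flip from entry
  3 to entry 2 is then reversed.\<close>

lemma bridge_arc: "(tri (step True (start 2)), tri (start 3)) \<in> arcs_ends (colorful_graph N)"
proof -
  let ?C = "{m - 1, m}"
  have mm: "m - 1 \<noteq> m" "m \<noteq> 0" "m - 1 \<noteq> 0" "m - 1 < m" using m by auto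
  have c: "start_code 2 \<in> codes" "start_code 3 \<in> codes" using start_code_codes by auto
  have pol: "\<not> polarity (start_code 2)" using mm unfolding polarity_def start_code_def by auto
  have "\<not> marked True (start_code 2) ?C q v" for q v
    using mark1_polarity[OF c(1)] pol by blast
  moreover have "lowest ?C = m - 1" by (rule lowest_eqI) (use m in auto)
  then have "step_bit True (start_code 2) ?C = m - 1" using pol unfolding step_bit_def gray_bit_def by simp
  moreover have "toggle (m - 1) ?C = {m}" using mm unfolding toggle_def by auto
  ultimately have x: "step True (start 2) = (start_code 2, {m})"
    using step_unmarked[of True "start_code 2" ?C] unfolding start_def by simp
  have "flip N (tri (start_code 3, {m})) (tri (start_code 2, {m}))"
    unfolding tri_def fst_conv snd_conv N
  proof (rule flip_decode_code[OF f, where j = m and v = 3])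
    show "code f m (start_code 3)" "code f m (start_code 2)" using c unfolding codes_def by auto
    show "start_code 2 m = 3 - 1" "start_code 3 m = 3" "start_code 3 (m - 1) < 3" using mm by (auto simp: start_code_def)
    show "start_code 2 i = start_code 3 i" if "i \<noteq> m" for i using that by (simp add: start_code_def)
  qed (use mm in auto)
  moreover have st: "(start_code 2, {m}) \<in> states" "(start_code 3, {m}) \<in> states" using c m unfolding states_def by auto
  moreover have "triangulation N (tri s)" if "s \<in> states" for s using tri_states that by blast
  ultimately have "flip N (tri (start_code 2, {m})) (tri (start_code 3, {m}))" using flip_sym by blast
  then show ?thesis using colorful_graph_arcs[OF st] x unfolding start_def by simp
qed

lemma exec_phase:
  assumes p: "p = 2 \<and> r = start_code 1 \<or> p = 3 \<and> r = start_code 3"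
    and s: "s 0 0 = N" "s 10 0 = f" "s 11 0 = m"
  shows "\<exists>M s' vs t. 0 < M \<and> inj_on (tour p) {..<M} \<and> tour p ` {..<M} = descendants r \<and> tour p (M - 1) = step True (start p) \<and>
    exec W (init_phase p ;; main_loop) s s' vs t \<and> map (stored_triangulation N) vs = map (tri \<circ> tour p) [0..<M] \<and>
    t \<le> init_cost * (N * N) + (\<Sum>x\<in>descendants r. step_cost (snd x) + visit_cost) + 3 \<and>
    s' 0 0 = N \<and> s' 10 0 = f \<and> s' 11 0 = m"
proof -
  have p': "p = 2 \<or> p = 3" using p by blast
  have r: "r = start_code 1 \<or> r = start_code 3" and d: "start p \<in> descendants r" using p start_descendants by auto
  obtain M where M: "0 < M" "tour p M = start p" "inj_on (tour p) {..<M}" "tour p ` {..<M} = descendants r"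
    "tour p (M - 1) = step True (start p)"
    using gray_cycle[OF r d] by blast
  have inS: "tour p i \<in> states" for i
  proof (induction i)
    case 0
    then show ?case using start_states[OF p'] by simp
  next
    case (Suc i)
    then show ?case
      using fpf_involution_step[of "odd i"] unfolding fpf_involution_def by (cases "even i") auto
  qed
  have succ: "tour p (Suc i) = step (odd i) (tour p i)" for i by simp
  have ne: "tour p i \<noteq> start p" if "0 < i" "i < M" for i
  proof
    assume "tour p i = start p"
    then have "tour p i = tour p 0" by simp
    then have "i = 0" using M(3) that by (metis inj_onD lessThan_iff M(1))
    then show False using that by simp
  qed
  obtain s1 t1 where 1: "exec W (init_phase p) s s1 [] t1" "t1 \<le> init_cost * (N * N)"
    "ready s1 (fst (start p)) (snd (start p)) False" "s1 21 0 = p" "s1 20 0 = 1"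
    using runs_init_phase[of p s] p' s unfolding runs_def by blast
  obtain s' vs t where 2: "exec W main_loop s1 s' vs t" "map (stored_triangulation N) vs = map (tri \<circ> tour p) [0..<M]"
    "t \<le> (\<Sum>j\<in>{0..<M}. step_cost (snd (tour p j)) + visit_cost) + 3" "s' 0 0 = N \<and> s' 10 0 = f \<and> s' 11 0 = m"
    using exec_main_loop[OF p' inS succ ne M(2), of 0 s1] 1 M(1) by auto
  \<comment> \<open>As the tour visits every node once, costs are summed over nodes, regardless of
    the order of the visits.\<close>
  have "(\<Sum>j\<in>{0..<M}. step_cost (snd (tour p j)) + visit_cost) = (\<Sum>x\<in>descendants r. step_cost (snd x) + visit_cost)"
    using sum.reindex[OF M(3), of "\<lambda>x. step_cost (snd x) + visit_cost"] M(4) by (simp add: lessThan_atLeast0)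
  then have "t1 + t \<le> init_cost * (N * N) + (\<Sum>x\<in>descendants r. step_cost (snd x) + visit_cost) + 3"
    using 1(2) 2(3) by linarith
  moreover have "exec W (init_phase p ;; main_loop) s s' ([] @ vs) (t1 + t)" by (rule exec.Seq[OF 1(1) 2(1)])
  ultimately show ?thesis using M 2(2,4) by auto
qed

lemma exec_read_input:
  "\<exists>s t. exec W read_input (input_store N) s [] t \<and> t \<le> init_cost \<and> s 0 0 = N \<and> s 10 0 = f \<and> s 11 0 = m"
proof -
  have odd: "odd N \<longleftrightarrow> f = 1" using N_eq f by presburger
  have m': "(N - 3) div 2 = m" using N_eq f by (cases "f = 0") auto
  let ?s = "basic_run W read_input (input_store N)"
  have "2 * (N div 2) \<le> 8 * N" by simp
  then have "?s 0 0 = N" "?s 10 0 = N - 2 * (N div 2)" "?s 11 0 = (N - 3) div 2"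
    unfolding read_input_def input_store_def by (simp_all add: ev del: ev_del)
  then have v: "?s 0 0 = N" "?s 10 0 = f" "?s 11 0 = m" using odd m' f unfolding parity_expr by auto
  have "runs W read_input (input_store N) init_cost (\<lambda>s. s 0 0 = N \<and> s 10 0 = f \<and> s 11 0 = m)"
    by (rule runs_basicI) (use v in \<open>auto simp: read_input_def init_cost_def\<close>)
  then show ?thesis unfolding runs_def by blast
qed

lemma sum_states: "(\<Sum>x\<in>states. step_cost (snd x) + visit_cost) \<le> (400000 * next_cost + visit_cost) * card states"
proof -
  have "(\<Sum>x\<in>states. step_cost (snd x) + visit_cost) = (\<Sum>a\<in>codes. \<Sum>C\<in>Pow {f..m}. step_cost C + visit_cost)"
    unfolding states_def by (subst sum.cartesian_product) (simp add: case_prod_beta)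
  also have "\<dots> \<le> (\<Sum>a\<in>codes. (400000 * next_cost + visit_cost) * 2 ^ (m + 1 - f))"
    by (rule sum_mono) (rule sum_step_cost)
  also have "\<dots> = (400000 * next_cost + visit_cost) * card states"
    unfolding states_def by (simp add: card_cartesian_product card_Pow)
  finally show ?thesis .
qed

lemma card_states_ge: "2 ^ (m + 1 - f) \<le> card states"
proof -
  have "codes \<noteq> {}" using start_code_codes[of 2] by auto
  then have "1 \<le> card codes" using finite_codes by (simp add: Suc_leI card_gt_0_iff)
  then have "1 * 2 ^ (m + 1 - f) \<le> card codes * 2 ^ (m + 1 - f)" by (intro mult_right_mono) auto
  then show ?thesis unfolding states_def by (simp add: card_cartesian_product card_Pow)
qed

lemma exec_program:
  "\<exists>s vs t. exec W program (input_store N) s vs t \<and>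
     hamilton_path (colorful_graph N) (map (stored_triangulation N) vs) \<and>
     t \<le> (400000 * next_cost + visit_cost + 50000 * init_cost + 6) * card (verts (colorful_graph N))"
proof -
  obtain s0 t0 where 0: "exec W read_input (input_store N) s0 [] t0" "t0 \<le> init_cost"
    "s0 0 0 = N" "s0 10 0 = f" "s0 11 0 = m"
    using exec_read_input by blast
  obtain M1 s1 vs1 t1 where M1: "0 < M1" "inj_on (tour 2) {..<M1}" "tour 2 ` {..<M1} = descendants (start_code 1)"
    "tour 2 (M1 - 1) = step True (start 2)"
    and 1: "exec W (init_phase 2 ;; main_loop) s0 s1 vs1 t1" "map (stored_triangulation N) vs1 = map (tri \<circ> tour 2) [0..<M1]"
    "t1 \<le> init_cost * (N * N) + (\<Sum>x\<in>descendants (start_code 1). step_cost (snd x) + visit_cost) + 3"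
    "s1 0 0 = N" "s1 10 0 = f" "s1 11 0 = m"
    using exec_phase[of 2 "start_code 1" s0] 0(3-5) by blast
  obtain M2 s2 vs2 t2 where M2: "0 < M2" "inj_on (tour 3) {..<M2}" "tour 3 ` {..<M2} = descendants (start_code 3)"
    and 2: "exec W (init_phase 3 ;; main_loop) s1 s2 vs2 t2" "map (stored_triangulation N) vs2 = map (tri \<circ> tour 3) [0..<M2]"
    "t2 \<le> init_cost * (N * N) + (\<Sum>x\<in>descendants (start_code 3). step_cost (snd x) + visit_cost) + 3"
    using exec_phase[of 3 "start_code 3" s1] 1(4-6) by blast
  have ex: "exec W program (input_store N) s2 ([] @ (vs1 @ vs2)) (t0 + (t1 + t2))"
    unfolding program_def by (intro exec.Seq[OF 0(1)] exec.Seq[OF 1(1) 2(1)])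
  define S where "S = map (tour 2) [0..<M1] @ map (tour 3) [0..<M2]"
  have S1: "set (map (tour 2) [0..<M1]) = descendants (start_code 1)"
    and S2: "set (map (tour 3) [0..<M2]) = descendants (start_code 3)"
    using M1(3) M2(3) by (simp_all add: atLeast0LessThan)
  have setS: "set S = states" unfolding S_def set_append S1 S2 states_split(1) ..
  have "distinct S"
    unfolding S_def distinct_append S1 S2
    using M1(2) M2(2) states_split(2) by (simp add: distinct_map atLeast0LessThan)
  then have distinct: "distinct (map tri S)" using inj_on_tri setS by (simp add: distinct_map)
  have vs: "map (stored_triangulation N) ([] @ (vs1 @ vs2)) = map tri S"
    using 1(2) 2(2) unfolding S_def by simp
  let ?E = "\<lambda>x y. (x, y) \<in> arcs_ends (colorful_graph N)"
  have tour_arc: "?E (tri (tour p i)) (tri (tour p (Suc i)))" if "tour p i \<in> states" for p i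
    using step_arc[OF that, of "odd i"] by (cases "even i") simp_all
  have succ: "successively ?E (map (tri \<circ> tour p) [0..<M])" if "tour p ` {..<M} \<subseteq> states" for p M
  proof -
    have "?E (map (tri \<circ> tour p) [0..<M] ! i) (map (tri \<circ> tour p) [0..<M] ! Suc i)" if i: "Suc i < M" for i
    proof -
      have "tour p i \<in> states" using \<open>tour p ` {..<M} \<subseteq> states\<close> i by auto
      then show ?thesis using tour_arc[of p i] i by (simp del: walk.simps)
    qed
    then show ?thesis unfolding successively_conv_nth by simp
  qed
  \<comment> \<open>The two lists are consecutive because the first tour ends one step of kind
    \<open>True\<close> before its start, at the near end of the bridge.\<close>
  have "last (map (tri \<circ> tour 2) [0..<M1]) = tri (step True (start 2))"
    using M1(1,4) by (simp add: last_map)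
  moreover have "hd (map (tri \<circ> tour 3) [0..<M2]) = tri (start 3)" using M2(1) by (simp add: hd_map upt_conv_Cons)
  ultimately have "successively ?E (map (tri \<circ> tour 2) [0..<M1] @ map (tri \<circ> tour 3) [0..<M2])"
    unfolding successively_append_iff using succ bridge_arc M1(3) M2(3) states_split(1) by auto
  then have arcs: "set (vwalk_arcs (map tri S)) \<subseteq> arcs_ends (colorful_graph N)"
    using set_vwalk_arcs unfolding S_def by simp
  have "map tri S \<noteq> []" using M1(1) unfolding S_def by simp
  then have ham: "hamilton_path (colorful_graph N) (map tri S)"
    using arcs distinct setS unfolding hamilton_path_def vpath_def vwalk_def colorful_graph_verts by simp
  have fin: "finite (descendants (start_code 1))" "finite (descendants (start_code 3))"
    using states_split(1) finite_states by (metis finite_Un)+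
  have "(\<Sum>x\<in>descendants (start_code 1). step_cost (snd x) + visit_cost) + (\<Sum>x\<in>descendants (start_code 3). step_cost (snd x) + visit_cost)
    = (\<Sum>x\<in>states. step_cost (snd x) + visit_cost)"
    unfolding states_split(1) by (rule sum.union_disjoint[OF fin states_split(2), symmetric])
  then have "t0 + (t1 + t2) \<le> init_cost + 2 * (init_cost * (N * N)) + (400000 * next_cost + visit_cost) * card states + 6"
    using 0(2) 1(3) 2(3) sum_states by linarith
  also have "\<dots> \<le> (400000 * next_cost + visit_cost + 50000 * init_cost + 6) * card states"
  proof -
    have c1: "1 \<le> card states" using card_states_ge le_trans[of 1 "2 ^ (m + 1 - f)"] by simp
    \<comment> \<open>Even the initial reconstructions are paid for by a single hypercube. The
      factor 41473 below is \<open>1 + 2 * 20736\<close>: reading the input and two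
      initializations.\<close>
    have "init_cost * (N * N) \<le> init_cost * (20736 * card states)"
      using NN_le card_states_ge by (intro mult_left_mono) linarith+
    moreover have "init_cost * 1 \<le> init_cost * card states" using c1 by (intro mult_left_mono) auto
    moreover have "init_cost * (20736 * card states) = 20736 * (init_cost * card states)" by simp
    ultimately have "init_cost + 2 * (init_cost * (N * N)) \<le> 41473 * (init_cost * card states)" by linarith
    then have "init_cost + 2 * (init_cost * (N * N)) + (400000 * next_cost + visit_cost) * card states + 6 \<le>
      50000 * (init_cost * card states) + (400000 * next_cost + visit_cost) * card states + 6 * card states" using c1 by linarith
    also have "\<dots> = (400000 * next_cost + visit_cost + 50000 * init_cost + 6) * card states" by (simp add: algebra_simps)
    finally show ?thesis .
  qed
  also have "card states = card (verts (colorful_graph N))"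
    unfolding colorful_graph_verts using card_image[OF inj_on_tri] by simp
  finally show ?thesis using ex ham vs by metis
qed

end

theorem theorem6:
  shows "\<exists>(P :: com) (C :: nat) (k :: nat). 2 \<le> k \<and>
    (\<forall>N \<ge> 8. \<exists>s vs t. exec (N ^ k) P (input_store N) s vs t \<and>
       hamilton_path (colorful_graph N) (map (stored_triangulation N) vs) \<and>
       t \<le> C * card (verts (colorful_graph N)))"
proof (rule exI[of _ program], rule exI[of _ "400000 * next_cost + visit_cost + 50000 * init_cost + 6"],
    rule exI[of _ 3], intro conjI allI impI)
  fix N :: nat assume N: "8 \<le> N"
  \<comment> \<open>These values invert \<open>polygon_size\<close>. The least cases
    \<open>N = 8\<close> and \<open>N = 9\<close> give \<open>m = 2\<close> and
    \<open>m = 3\<close>, which meet \<open>f + 2 \<le> m\<close> with equality.\<close>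
  interpret machine "N mod 2" "(N - 3) div 2" N "N ^ 3"
  proof
    show "N mod 2 + 2 \<le> (N - 3) div 2" "N = polygon_size (N mod 2) ((N - 3) div 2)"
      using N unfolding polygon_size_def by presburger+
  qed auto
  show "\<exists>s vs t. exec (N ^ 3) program (input_store N) s vs t \<and>
       hamilton_path (colorful_graph N) (map (stored_triangulation N) vs) \<and>
       t \<le> (400000 * next_cost + visit_cost + 50000 * init_cost + 6) * card (verts (colorful_graph N))"
    by (rule exec_program)
qed simp

end
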